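(* Let $A$ be an irreducible affine Cartan matrix whose affine simple root $\alpha_0$ is short (that is, $A$ is not of type $B_n^{(1)}, C_n^{(1)}, F_4^{(1)}, G_2^{(1)}$), and let $\mathcal A_{\tilde W}$ be the associated double affine Artin group. The map which sends each of the generators $T_i$, $i\neq 0$, to its inverse and interchanges $X_\mu$ with $Y_\mu$ for any $\mu\in\mathring Q$ can be uniquely extended to an automorphism $\underline{\mathfrak e}:\mathcal A_{\tilde W}\to\mathcal A_{\tilde W}$ of the double affine Artin group. The square of $\underline{\mathfrak e}$ is the identity isomorphism.
   Context: $A=(a_{jk})_{0\le j,k\le n}$ is an irreducible affine Cartan matrix, labelled as in Kac's book, with $0$ the affine node. In the Dynkin diagram $S(A)$ distinct nodes $i,j$ are connected by $a_{ij}a_{ji}$ laces. Root data. $(a_0,\dots,a_n)$ and $(a_0^\vee,\dots,a_n^\vee)$ are Kac's numerical labels of $S(A)$ and $S(A^t)$. Let $\alpha_0,\dots,\alpha_n$ be the simple roots ($\alpha_1,\dots,\alpha_n$ being a basis of the associated finite root system), $\delta=\sum_{j=0}^n a_j\alpha_j$, $\theta=\delta-a_0\alpha_0$, $d_j=a_j/a_j^\vee$. On the real span of the $\alpha_j$ take the form $(\alpha_j,\alpha_k)=d_j^{-1}a_{jk}$, and put $\alpha_j^\vee=d_j\alpha_j$, $s_j(x)=x-(x,\alpha_j^\vee)\alpha_j$. The affine Weyl group $W$ is generated by $s_0,\dots,s_n$, the finite Weyl group $\mathring W$ by $s_1,\dots,s_n$. The lattice $\mathring Q$ is the root lattice $\bigoplus_{j=1}^n\mathbb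 Z\alpha_j$ of the finite root system, except for $A=A_{2n}^{(2)}$, where $\mathring Q$ denotes the weight lattice of the finite root system. $W$ is the semidirect product of $\mathring W$ and the group of elements $\lambda_\mu$, $\mu\in\mathring Q$, where $\lambda_\mu(x)=x-(x,\mu)\delta$. Affine Artin group. $\mathcal A_W$ is the group generated by $T_0,\dots,T_n$ satisfying the same braid relations as $s_0,\dots,s_n$: $T_iT_j\cdots=T_jT_i\cdots$ with $m_{ij}$ factors on each side, $m_{ij}=2,3,4,6$ if nodes $i\neq j$ are connected by $0,1,2,3$ laces respectively. For $w\in W$ with reduced decomposition $w=s_{j_1}\cdots s_{j_m}$ put $T_w=T_{j_1}\cdots T_{j_m}$. $\mathcal A_W$ contains a commutative subgroup $\{Y_\mu:\mu\in\mathring Q\}$, with $Y_\mu Y_\nu=Y_{\mu+\nu}$, such that $Y_\mu=T_{\lambda_\mu}$ for $\mu\in\mathring Q$ anti-dominant (i.e. $(\mu,\alpha_i^\vee)\le 0$ for $1\le i\le n$); for example $Y_{-a_0^{-1}\theta}=T_{s_\theta}T_0$, where $s_\theta$ is the reflection in $\theta$. Double affine Artin group. $\mathcal A_{\tilde W}$ is generated by the affine Artin group $\mathcal A_W$, the lattice $\{X_\beta:\beta\in\mathring Q\}$ (with $X_\beta X_\gamma=X_{\beta+\gamma}$) and an element $X_{a_0^{-1}\delta}$ (with $X_{\beta+k a_0^{-1}\delta}:=X_\beta X_{a_0^{-1}\delta}^k$ for $k\in\mathbb Z$), such that for all $0\le i\le n$: (i) $X_{a_0^{-1}\delta}$ is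 central; (ii) $T_iX_\beta=X_\beta T_i$ if $(\beta,\alpha_i^\vee)=0$; (iii) $T_iX_\beta T_i=X_{s_i(\beta)}$ if $(\beta,\alpha_i^\vee)=-1$.
   Formalization: Type A_{2n}^{(2)} is excluded, as no such automorphism exists there; for A_1^{(1)} and D_{n+1}^{(2)}, where the extension is not unique, uniqueness and the square are stated for the extension that sends X_{a_0^{-1}δ} to its inverse. *)

theory Defs
  imports Complex_Main "HOL-Algebra.Bij"
begin

section \<open>Groups given by generators and relations\<close>

text \<open>A word is a list of letters \<open>(g, True)\<close>, standing for \<open>g\<close>, and \<open>(g, False)\<close>,
  standing for \<open>g\<inverse>\<close>.\<close>

type_synonym 'g word = "('g \<times> bool) list"

definition words :: "'g set \<Rightarrow> 'g word set" where
  "words S = lists (S \<times> UNIV)"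

inductive word_equiv :: "'g set \<Rightarrow> ('g word \<times> 'g word) set \<Rightarrow> 'g word \<Rightarrow> 'g word \<Rightarrow> bool"
  for S R where
  refl: "w \<in> words S \<Longrightarrow> word_equiv S R w w"
| sym: "word_equiv S R u v \<Longrightarrow> word_equiv S R v u"
| trans: "word_equiv S R u v \<Longrightarrow> word_equiv S R v w \<Longrightarrow> word_equiv S R u w"
| append: "word_equiv S R u u' \<Longrightarrow> word_equiv S R v v' \<Longrightarrow> word_equiv S R (u @ v) (u' @ v')"
| cancel: "g \<in> S \<Longrightarrow> word_equiv S R [(g, b), (g, \<not> b)] []"
| relation: "(u, v) \<in> R \<Longrightarrow> u \<in> words S \<Longrightarrow> v \<in> words S \<Longrightarrow> word_equiv S R u v"

definition word_rel :: "'g set \<Rightarrow> ('g word \<times> 'g word) set \<Rightarrow> ('g word \<times> 'g word) set" where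
  "word_rel S R = {(u, v). word_equiv S R u v}"

definition word_class :: "'g set \<Rightarrow> ('g word \<times> 'g word) set \<Rightarrow> 'g word \<Rightarrow> 'g word set" where
  "word_class S R w = word_rel S R `` {w}"

definition presented_group :: "'g set \<Rightarrow> ('g word \<times> 'g word) set \<Rightarrow> 'g word set monoid" where
  "presented_group S R =
    \<lparr>carrier = words S // word_rel S R,
     mult = (\<lambda>a b. \<Union>u\<in>a. \<Union>v\<in>b. word_class S R (u @ v)),
     one = word_class S R []\<rparr>"

lemma word_equiv_words: "word_equiv S R u v \<Longrightarrow> u \<in> words S \<and> v \<in> words S"
  by (induction rule: word_equiv.induct) (auto simp: words_def)

lemma equiv_word_rel: "equiv (words S) (word_rel S R)"
proof (rule equivI)
  show "word_rel S R \<subseteq> words S \<times> words S"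
    using word_equiv_words[of S R] by (auto simp: word_rel_def)
  show "refl_on (words S) (word_rel S R)"
    by (rule refl_onI) (simp add: word_rel_def word_equiv.refl)
  show "sym (word_rel S R)"
    by (rule symI) (simp add: word_rel_def word_equiv.sym)
  show "trans (word_rel S R)"
    unfolding word_rel_def by (rule transI) (simp, rule word_equiv.trans)
qed

lemma word_class_eq_iff:
  assumes "u \<in> words S" "v \<in> words S"
  shows "word_class S R u = word_class S R v \<longleftrightarrow> word_equiv S R u v"
  using eq_equiv_class_iff[OF equiv_word_rel assms]
  by (simp add: word_class_def word_rel_def)

lemma carrier_presented_group: "carrier (presented_group S R) = word_class S R ` words S"
  by (auto simp: presented_group_def quotient_def word_class_def)

lemma mult_presented_group:
  assumes "u \<in> words S" "v \<in> words S"
  shows "word_class S R u \<otimes>\<^bsub>presented_group S R\<^esub> word_class S R v = word_class S R (u @ v)"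
proof -
  have mem: "w \<in> word_class S R w" if "w \<in> words S" for w
    using that by (simp add: word_class_def word_rel_def word_equiv.refl)
  have eq: "word_class S R (u' @ v') = word_class S R (u @ v)"
    if "u' \<in> word_class S R u" "v' \<in> word_class S R v" for u' v'
  proof -
    have "word_equiv S R u u'" "word_equiv S R v v'"
      using that by (simp_all add: word_class_def word_rel_def)
    from word_equiv.append[OF this] have "word_equiv S R (u @ v) (u' @ v')" .
    with word_equiv_words[OF this] show ?thesis
      by (simp add: word_class_eq_iff word_equiv.sym)
  qed
  have "(\<Union>u'\<in>word_class S R u. \<Union>v'\<in>word_class S R v. word_class S R (u' @ v'))
      = (\<Union>u'\<in>word_class S R u. \<Union>v'\<in>word_class S R v. word_class S R (u @ v))"
    by (intro SUP_cong) (simp_all add: eq)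
  then show ?thesis
    using mem[OF assms(1)] mem[OF assms(2)] by (auto simp: presented_group_def)
qed

lemma group_presented_group: "group (presented_group S R)"
proof (rule groupI)
  have nil: "[] \<in> words S" and app: "\<And>u v. u \<in> words S \<Longrightarrow> v \<in> words S \<Longrightarrow> u @ v \<in> words S"
    by (auto simp: words_def)
  have one: "\<one>\<^bsub>presented_group S R\<^esub> = word_class S R []"
    by (simp add: presented_group_def)
  note simps = carrier_presented_group mult_presented_group one nil app
  show "\<one>\<^bsub>presented_group S R\<^esub> \<in> carrier (presented_group S R)"
    by (simp add: simps)
  fix x assume x: "x \<in> carrier (presented_group S R)"
  show "\<one>\<^bsub>presented_group S R\<^esub> \<otimes>\<^bsub>presented_group S R\<^esub> x = x"
    using x by (auto simp: simps)
  obtain w where w: "w \<in> words S" "x = word_class S R w"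
    using x by (auto simp: simps)
  have "\<exists>u\<in>words S. word_equiv S R (u @ w) []"
    using w(1)
  proof (induction w)
    case Nil
    show ?case using nil by (auto intro: word_equiv.refl)
  next
    case (Cons a w)
    obtain g b where a: "a = (g, b)" by force
    have g: "g \<in> S" and w: "w \<in> words S" using Cons.prems by (auto simp: words_def a)
    then obtain u where u: "u \<in> words S" "word_equiv S R (u @ w) []" using Cons.IH by blast
    have "word_equiv S R [(g, \<not> b), (g, b)] []"
      using word_equiv.cancel[OF g, of R "\<not> b"] by simp
    from word_equiv.append[OF word_equiv.refl[OF u(1)]
        word_equiv.append[OF this word_equiv.refl[OF w]]]
    have "word_equiv S R ((u @ [(g, \<not> b)]) @ a # w) (u @ w)"
      by (simp add: a)
    from word_equiv.trans[OF this u(2)]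
    have "word_equiv S R ((u @ [(g, \<not> b)]) @ a # w) []" .
    moreover have "u @ [(g, \<not> b)] \<in> words S" using u(1) g by (auto simp: words_def)
    ultimately show ?case by blast
  qed
  then obtain u where u: "u \<in> words S" "word_equiv S R (u @ w) []" by blast
  then have "word_class S R (u @ w) = word_class S R []"
    using w(1) by (simp add: word_class_eq_iff nil app)
  then show "\<exists>y\<in>carrier (presented_group S R). y \<otimes>\<^bsub>presented_group S R\<^esub> x = \<one>\<^bsub>presented_group S R\<^esub>"
    using u(1) w by (intro bexI[of _ "word_class S R u"]) (auto simp: simps)
  fix y assume y: "y \<in> carrier (presented_group S R)"
  show "x \<otimes>\<^bsub>presented_group S R\<^esub> y \<in> carrier (presented_group S R)"
    using x y by (auto simp: simps)
  fix z assume z: "z \<in> carrier (presented_group S R)"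
  show "x \<otimes>\<^bsub>presented_group S R\<^esub> y \<otimes>\<^bsub>presented_group S R\<^esub> z =
        x \<otimes>\<^bsub>presented_group S R\<^esub> (y \<otimes>\<^bsub>presented_group S R\<^esub> z)"
    using x y z unfolding carrier_presented_group
    by (elim imageE) (simp add: mult_presented_group app)
qed


section \<open>Affine Cartan matrices\<close>

text \<open>Matrices are indexed by the nodes \<open>0, \<dots>, n\<close>; entries outside this range play no role.\<close>

type_synonym cartan = "nat \<Rightarrow> nat \<Rightarrow> int"

definition generalized_cartan_matrix :: "nat \<Rightarrow> cartan \<Rightarrow> bool" where
  "generalized_cartan_matrix n A \<longleftrightarrow>
    (\<forall>i\<le>n. A i i = 2) \<and>
    (\<forall>i\<le>n. \<forall>j\<le>n. i \<noteq> j \<longrightarrow> A i j \<le> 0 \<and> (A i j = 0 \<longleftrightarrow> A j i = 0))"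

definition irreducible_cartan :: "nat \<Rightarrow> cartan \<Rightarrow> bool" where
  "irreducible_cartan n A \<longleftrightarrow>
    (\<forall>I. I \<subseteq> {..n} \<and> I \<noteq> {} \<and> I \<noteq> {..n} \<longrightarrow> (\<exists>i\<in>I. \<exists>j\<in>{..n} - I. A i j \<noteq> 0))"

definition mat_vec :: "nat \<Rightarrow> cartan \<Rightarrow> (nat \<Rightarrow> real) \<Rightarrow> nat \<Rightarrow> real" where
  "mat_vec n A v i = (\<Sum>j\<le>n. of_int (A i j) * v j)"

text \<open>Kac's definition of affine type: corank one, a positive null vector, and
  \<open>A v \<ge> 0\<close> only if \<open>A v = 0\<close>.\<close>

definition irreducible_affine_cartan :: "nat \<Rightarrow> cartan \<Rightarrow> bool" where
  "irreducible_affine_cartan n A \<longleftrightarrow>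
    generalized_cartan_matrix n A \<and> irreducible_cartan n A \<and>
    (\<exists>u. (\<forall>i\<le>n. u i > 0) \<and> (\<forall>i\<le>n. mat_vec n A u i = 0) \<and>
         (\<forall>v. (\<forall>i\<le>n. mat_vec n A v i = 0) \<longrightarrow> (\<exists>c. \<forall>i\<le>n. v i = c * u i))) \<and>
    (\<forall>v. (\<forall>i\<le>n. mat_vec n A v i \<ge> 0) \<longrightarrow> (\<forall>i\<le>n. mat_vec n A v i = 0))"

text \<open>The types in Kac's tables Aff 1, Aff 2, Aff 3. The argument is the number \<open>n\<close> of nodes
  other than the affine node, so that \<open>A_even2 n\<close>, \<open>A_odd2 n\<close>, \<open>D2 n\<close> stand for
  \<open>A\<^sub>2\<^sub>n\<^sup>(\<^sup>2\<^sup>)\<close>, \<open>A\<^sub>2\<^sub>n\<^sub>-\<^sub>1\<^sup>(\<^sup>2\<^sup>)\<close>, \<open>D\<^sub>n\<^sub>+\<^sub>1\<^sup>(\<^sup>2\<^sup>)\<close>.\<close>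

datatype affine_type =
    A1 nat | B1 nat | C1 nat | D1 nat | E6_1 | E7_1 | E8_1 | F4_1 | G2_1
  | A_even2 nat | A_odd2 nat | D2 nat | E6_2 | D4_3

fun affine_rank :: "affine_type \<Rightarrow> nat" where
  "affine_rank (A1 n) = n"
| "affine_rank (B1 n) = n"
| "affine_rank (C1 n) = n"
| "affine_rank (D1 n) = n"
| "affine_rank E6_1 = 6"
| "affine_rank E7_1 = 7"
| "affine_rank E8_1 = 8"
| "affine_rank F4_1 = 4"
| "affine_rank G2_1 = 2"
| "affine_rank (A_even2 n) = n"
| "affine_rank (A_odd2 n) = n"
| "affine_rank (D2 n) = n"
| "affine_rank E6_2 = 4"
| "affine_rank D4_3 = 2"

fun admissible_type :: "affine_type \<Rightarrow> bool" where
  "admissible_type (A1 n) \<longleftrightarrow> n \<ge> 1"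
| "admissible_type (B1 n) \<longleftrightarrow> n \<ge> 3"
| "admissible_type (C1 n) \<longleftrightarrow> n \<ge> 2"
| "admissible_type (D1 n) \<longleftrightarrow> n \<ge> 4"
| "admissible_type (A_even2 n) \<longleftrightarrow> n \<ge> 1"
| "admissible_type (A_odd2 n) \<longleftrightarrow> n \<ge> 3"
| "admissible_type (D2 n) \<longleftrightarrow> n \<ge> 2"
| "admissible_type _ \<longleftrightarrow> True"

text \<open>A bond \<open>(i, j, p, q)\<close> records \<open>a\<^sub>i\<^sub>j = -p\<close> and \<open>a\<^sub>j\<^sub>i = -q\<close>; with \<open>a\<^sub>i\<^sub>j = 2 (\<alpha>\<^sub>i, \<alpha>\<^sub>j) / (\<alpha>\<^sub>i, \<alpha>\<^sub>i)\<close>,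
  \<open>p > q\<close> means that \<open>\<alpha>\<^sub>i\<close> is shorter than \<open>\<alpha>\<^sub>j\<close>.\<close>

type_synonym bond = "nat \<times> nat \<times> int \<times> int"

definition chain :: "nat \<Rightarrow> nat \<Rightarrow> bond list" where
  "chain i k = map (\<lambda>m. (m, Suc m, 1, 1)) [i..<k]"

fun kac_bonds :: "affine_type \<Rightarrow> bond list" where
  "kac_bonds (A1 n) = (if n = 1 then [(0, 1, 2, 2)] else (n, 0, 1, 1) # chain 0 n)"
| "kac_bonds (B1 n) = (0, 2, 1, 1) # chain 1 (n - 1) @ [(n - 1, n, 1, 2)]"
| "kac_bonds (C1 n) = (0, 1, 1, 2) # chain 1 (n - 1) @ [(n - 1, n, 2, 1)]"
| "kac_bonds (D1 n) = (0, 2, 1, 1) # chain 1 (n - 1) @ [(n - 2, n, 1, 1)]"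
| "kac_bonds E6_1 = (0, 6, 1, 1) # (3, 6, 1, 1) # chain 1 5"
| "kac_bonds E7_1 = (3, 7, 1, 1) # chain 0 6"
| "kac_bonds E8_1 = (5, 8, 1, 1) # chain 0 7"
| "kac_bonds F4_1 = [(0, 1, 1, 1), (1, 2, 1, 1), (2, 3, 1, 2), (3, 4, 1, 1)]"
| "kac_bonds G2_1 = [(0, 1, 1, 1), (1, 2, 1, 3)]"
| "kac_bonds (A_even2 n) =
    (if n = 1 then [(0, 1, 4, 1)]
     else (0, 1, 2, 1) # chain 1 (n - 1) @ [(n - 1, n, 2, 1)])"
| "kac_bonds (A_odd2 n) = (0, 2, 1, 1) # chain 1 (n - 1) @ [(n - 1, n, 2, 1)]"
| "kac_bonds (D2 n) = (0, 1, 2, 1) # chain 1 (n - 1) @ [(n - 1, n, 1, 2)]"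
| "kac_bonds E6_2 = [(0, 1, 1, 1), (1, 2, 1, 1), (2, 3, 2, 1), (3, 4, 1, 1)]"
| "kac_bonds D4_3 = [(0, 1, 1, 1), (1, 2, 3, 1)]"

definition kac_matrix :: "affine_type \<Rightarrow> cartan" where
  "kac_matrix t i j =
    (if i = j then 2
     else - (\<Sum>(k, l, p, q)\<leftarrow>kac_bonds t.
               (if (k, l) = (i, j) then p else 0) + (if (k, l) = (j, i) then q else 0)))"

definition kac_labelled :: "affine_type \<Rightarrow> nat \<Rightarrow> cartan \<Rightarrow> bool" where
  "kac_labelled t n A \<longleftrightarrow>
    admissible_type t \<and> n = affine_rank t \<and> (\<forall>i\<le>n. \<forall>j\<le>n. A i j = kac_matrix t i j)"


section \<open>Root data\<close>

text \<open>Kac's numerical labels: the positive, relatively prime integers \<open>a\<^sub>j\<close> with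
  \<open>\<Sum>\<^sub>j a\<^sub>i\<^sub>j a\<^sub>j = 0\<close>.\<close>

definition kac_label :: "nat \<Rightarrow> cartan \<Rightarrow> nat \<Rightarrow> int" where
  "kac_label n A =
    (THE a. (\<forall>j\<le>n. a j > 0) \<and> (\<forall>j>n. a j = 0) \<and> Gcd (a ` {..n}) = 1 \<and>
            (\<forall>i\<le>n. (\<Sum>j\<le>n. A i j * a j) = 0))"

definition kac_colabel :: "nat \<Rightarrow> cartan \<Rightarrow> nat \<Rightarrow> int" where
  "kac_colabel n A = kac_label n (\<lambda>i j. A j i)"

definition dd :: "nat \<Rightarrow> cartan \<Rightarrow> nat \<Rightarrow> real" where
  "dd n A j = of_int (kac_label n A j) / of_int (kac_colabel n A j)"

text \<open>The vector \<open>\<Sum>\<^sub>j x\<^sub>j \<alpha>\<^sub>j\<close> is represented by its coordinate function \<open>x\<close>. The maps below read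
  only the coordinates \<open>0, \<dots>, n\<close> and leave the others fixed, so that two elements of the Weyl
  group agree on the span of the \<open>\<alpha>\<^sub>j\<close> if and only if they are equal as functions.\<close>

type_synonym vec = "nat \<Rightarrow> real"

definition simple_root :: "nat \<Rightarrow> vec" where
  "simple_root j = (\<lambda>i. if i = j then 1 else 0)"

definition form :: "nat \<Rightarrow> cartan \<Rightarrow> vec \<Rightarrow> vec \<Rightarrow> real" where
  "form n A x y = (\<Sum>j\<le>n. \<Sum>k\<le>n. x j * y k * (of_int (A j k) / dd n A j))"

definition simple_coroot :: "nat \<Rightarrow> cartan \<Rightarrow> nat \<Rightarrow> vec" where
  "simple_coroot n A j = (\<lambda>i. dd n A j * simple_root j i)"

definition delta :: "nat \<Rightarrow> cartan \<Rightarrow> vec" where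
  "delta n A = (\<lambda>i. \<Sum>j\<le>n. of_int (kac_label n A j) * simple_root j i)"

definition simple_reflection :: "nat \<Rightarrow> cartan \<Rightarrow> nat \<Rightarrow> vec \<Rightarrow> vec" where
  "simple_reflection n A j x = (\<lambda>i. x i - form n A x (simple_coroot n A j) * simple_root j i)"

definition translation :: "nat \<Rightarrow> cartan \<Rightarrow> vec \<Rightarrow> vec \<Rightarrow> vec" where
  "translation n A \<mu> x = (\<lambda>i. x i - form n A x \<mu> * delta n A i)"

definition vadd :: "vec \<Rightarrow> vec \<Rightarrow> vec" where
  "vadd x y = (\<lambda>i. x i + y i)"

definition finite_root_lattice :: "nat \<Rightarrow> vec set" where
  "finite_root_lattice n = {x. (\<forall>i. x i \<in> \<int>) \<and> (\<forall>i. i \<notin> {1..n} \<longrightarrow> x i = 0)}"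

definition finite_weight_lattice :: "nat \<Rightarrow> cartan \<Rightarrow> vec set" where
  "finite_weight_lattice n A =
    {x. (\<forall>i. i \<notin> {1..n} \<longrightarrow> x i = 0) \<and> (\<forall>i\<in>{1..n}. form n A x (simple_coroot n A i) \<in> \<int>)}"

definition lattice_Q :: "affine_type \<Rightarrow> nat \<Rightarrow> cartan \<Rightarrow> vec set" where
  "lattice_Q t n A =
    (if t \<in> range A_even2 then finite_weight_lattice n A else finite_root_lattice n)"

definition antidominant :: "nat \<Rightarrow> cartan \<Rightarrow> vec \<Rightarrow> bool" where
  "antidominant n A \<mu> \<longleftrightarrow> (\<forall>i\<in>{1..n}. form n A \<mu> (simple_coroot n A i) \<le> 0)"

definition weyl_eval :: "nat \<Rightarrow> cartan \<Rightarrow> nat list \<Rightarrow> vec \<Rightarrow> vec" where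
  "weyl_eval n A js = foldr (\<lambda>j f. simple_reflection n A j \<circ> f) js id"

definition reduced_decomposition :: "nat \<Rightarrow> cartan \<Rightarrow> (vec \<Rightarrow> vec) \<Rightarrow> nat list \<Rightarrow> bool" where
  "reduced_decomposition n A w js \<longleftrightarrow>
    set js \<subseteq> {..n} \<and> weyl_eval n A js = w \<and>
    (\<forall>ks. set ks \<subseteq> {..n} \<and> weyl_eval n A ks = w \<longrightarrow> length js \<le> length ks)"


section \<open>The double affine Artin group\<close>

text \<open>\<open>Gen_delta\<close> is the generator \<open>X\<close> with index \<open>a\<^sub>0\<inverse> \<delta>\<close>.\<close>

datatype daag_gen = Gen_T nat | Gen_X vec | Gen_delta

definition daag_gens :: "affine_type \<Rightarrow> nat \<Rightarrow> cartan \<Rightarrow> daag_gen set" where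
  "daag_gens t n A = Gen_T ` {..n} \<union> Gen_X ` lattice_Q t n A \<union> {Gen_delta}"

abbreviation wT :: "nat \<Rightarrow> daag_gen word" where "wT i \<equiv> [(Gen_T i, True)]"
abbreviation wX :: "vec \<Rightarrow> daag_gen word" where "wX \<beta> \<equiv> [(Gen_X \<beta>, True)]"
abbreviation wDelta :: "daag_gen word" where "wDelta \<equiv> [(Gen_delta, True)]"

text \<open>The word for \<open>X\<close> with index \<open>\<beta> + k a\<^sub>0\<inverse> \<delta>\<close>.\<close>

definition wX_level :: "vec \<Rightarrow> int \<Rightarrow> daag_gen word" where
  "wX_level \<beta> k = wX \<beta> @ replicate (nat \<bar>k\<bar>) (Gen_delta, k \<ge> 0)"

fun alternating :: "nat \<Rightarrow> nat \<Rightarrow> nat \<Rightarrow> daag_gen word" where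
  "alternating i j 0 = []"
| "alternating i j (Suc m) = wT i @ alternating j i m"

text \<open>Pairs (number of laces, length of the braid relation). Four laces, which occur for
  \<open>A\<^sub>1\<^sup>(\<^sup>1\<^sup>)\<close> and \<open>A\<^sub>2\<^sup>(\<^sup>2\<^sup>)\<close>, impose no relation.\<close>

definition braid_lengths :: "(int \<times> nat) set" where
  "braid_lengths = {(0, 2), (1, 3), (2, 4), (3, 6)}"

definition braid_relations :: "nat \<Rightarrow> cartan \<Rightarrow> (daag_gen word \<times> daag_gen word) set" where
  "braid_relations n A =
    {(alternating i j m, alternating j i m) | i j m.
       i \<le> n \<and> j \<le> n \<and> i \<noteq> j \<and> (A i j * A j i, m) \<in> braid_lengths}"

definition lattice_relations :: "vec set \<Rightarrow> (daag_gen word \<times> daag_gen word) set" where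
  "lattice_relations Q = {(wX \<beta> @ wX \<gamma>, wX (vadd \<beta> \<gamma>)) | \<beta> \<gamma>. \<beta> \<in> Q \<and> \<gamma> \<in> Q}"

definition central_relations :: "daag_gen set \<Rightarrow> (daag_gen word \<times> daag_gen word) set" where
  "central_relations S = {(wDelta @ [(g, True)], [(g, True)] @ wDelta) | g. g \<in> S}"

definition commuting_relations ::
  "nat \<Rightarrow> cartan \<Rightarrow> vec set \<Rightarrow> (daag_gen word \<times> daag_gen word) set" where
  "commuting_relations n A Q =
    {(wT i @ wX \<beta>, wX \<beta> @ wT i) | i \<beta>.
       i \<le> n \<and> \<beta> \<in> Q \<and> form n A \<beta> (simple_coroot n A i) = 0}"

definition reflection_relations ::
  "nat \<Rightarrow> cartan \<Rightarrow> vec set \<Rightarrow> (daag_gen word \<times> daag_gen word) set" where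
  "reflection_relations n A Q =
    {(wT i @ wX \<beta> @ wT i, wX_level \<gamma> k) | i \<beta> \<gamma> k.
       i \<le> n \<and> \<beta> \<in> Q \<and> \<gamma> \<in> Q \<and> form n A \<beta> (simple_coroot n A i) = -1 \<and>
       simple_reflection n A i \<beta> =
         vadd \<gamma> (\<lambda>l. of_int k * (delta n A l / of_int (kac_label n A 0)))}"

definition daag_relations ::
  "affine_type \<Rightarrow> nat \<Rightarrow> cartan \<Rightarrow> (daag_gen word \<times> daag_gen word) set" where
  "daag_relations t n A =
    braid_relations n A \<union> lattice_relations (lattice_Q t n A) \<union>
    central_relations (daag_gens t n A) \<union> commuting_relations n A (lattice_Q t n A) \<union>
    reflection_relations n A (lattice_Q t n A)"

definition daag :: "affine_type \<Rightarrow> nat \<Rightarrow> cartan \<Rightarrow> daag_gen word set monoid" where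
  "daag t n A = presented_group (daag_gens t n A) (daag_relations t n A)"

definition daag_elem :: "affine_type \<Rightarrow> nat \<Rightarrow> cartan \<Rightarrow> daag_gen word \<Rightarrow> daag_gen word set" where
  "daag_elem t n A = word_class (daag_gens t n A) (daag_relations t n A)"

definition T_elem :: "affine_type \<Rightarrow> nat \<Rightarrow> cartan \<Rightarrow> nat \<Rightarrow> daag_gen word set" where
  "T_elem t n A i = daag_elem t n A (wT i)"

definition X_elem :: "affine_type \<Rightarrow> nat \<Rightarrow> cartan \<Rightarrow> vec \<Rightarrow> daag_gen word set" where
  "X_elem t n A \<beta> = daag_elem t n A (wX \<beta>)"

definition X_delta :: "affine_type \<Rightarrow> nat \<Rightarrow> cartan \<Rightarrow> daag_gen word set" where
  "X_delta t n A = daag_elem t n A wDelta"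

text \<open>By Matsumoto's theorem the result does not depend on the reduced decomposition chosen.\<close>

definition T_weyl :: "affine_type \<Rightarrow> nat \<Rightarrow> cartan \<Rightarrow> (vec \<Rightarrow> vec) \<Rightarrow> daag_gen word set" where
  "T_weyl t n A w =
    daag_elem t n A (map (\<lambda>j. (Gen_T j, True)) (SOME js. reduced_decomposition n A w js))"

definition Y_family ::
  "affine_type \<Rightarrow> nat \<Rightarrow> cartan \<Rightarrow> (vec \<Rightarrow> daag_gen word set) \<Rightarrow> bool" where
  "Y_family t n A Y \<longleftrightarrow>
    Y \<in> lattice_Q t n A \<rightarrow>\<^sub>E carrier (daag t n A) \<and>
    (\<forall>\<mu>\<in>lattice_Q t n A. \<forall>\<nu>\<in>lattice_Q t n A.
       Y \<mu> \<otimes>\<^bsub>daag t n A\<^esub> Y \<nu> = Y (vadd \<mu> \<nu>)) \<and>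
    (\<forall>\<mu>\<in>lattice_Q t n A. antidominant n A \<mu> \<longrightarrow>
       Y \<mu> = T_weyl t n A (translation n A \<mu>))"

text \<open>Every element of the lattice is a difference of two antidominant ones, so there is only one
  such family, and it takes its values in the subgroup generated by the \<open>T\<^sub>i\<close>.\<close>

definition Y_elem :: "affine_type \<Rightarrow> nat \<Rightarrow> cartan \<Rightarrow> vec \<Rightarrow> daag_gen word set" where
  "Y_elem t n A = (THE Y. Y_family t n A Y)"

definition inverts_T_swaps_X_Y ::
  "affine_type \<Rightarrow> nat \<Rightarrow> cartan \<Rightarrow> (daag_gen word set \<Rightarrow> daag_gen word set) \<Rightarrow> bool" where
  "inverts_T_swaps_X_Y t n A e \<longleftrightarrow>
    (\<forall>i\<in>{1..n}. e (T_elem t n A i) = inv\<^bsub>daag t n A\<^esub> T_elem t n A i) \<and>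
    (\<forall>\<mu>\<in>lattice_Q t n A. e (X_elem t n A \<mu>) = Y_elem t n A \<mu> \<and>
                           e (Y_elem t n A \<mu>) = X_elem t n A \<mu>)"

text \<open>Type \<open>A\<^sub>2\<^sub>n\<^sup>(\<^sup>2\<^sup>)\<close> has a short affine root, but there no homomorphism has this property.
  The lattice contains \<open>\<omega> = \<alpha>\<^sub>n / 2\<close>, and \<open>(-\<omega>, \<alpha>\<^sub>n\<^sup>\<or>) = -1\<close> gives \<open>T\<^sub>n X\<^sub>-\<^sub>\<omega> T\<^sub>n = X\<^sub>\<omega>\<close>, which would be
  mapped to \<open>T\<^sub>n\<inverse> Y\<^sub>-\<^sub>\<omega> T\<^sub>n\<inverse> = Y\<^sub>\<omega>\<close>. But \<open>(\<beta>, \<alpha>\<^sub>0\<^sup>\<or>)\<close> is even for all \<open>\<beta>\<close> in the lattice, so that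
  \<open>T\<^sub>0 \<mapsto> 1\<close>, with all other generators mapped to \<open>0\<close>, defines a homomorphism to the integers, whose
  values at \<open>Y\<^sub>\<omega>\<close> and \<open>Y\<^sub>-\<^sub>\<omega>\<close> are \<open>-1\<close> and \<open>1\<close>. (For \<open>n = 1\<close>: \<open>Y\<^sub>-\<^sub>\<omega> = T\<^sub>1 T\<^sub>0\<close>, and \<open>T\<^sub>0\<^sup>2 = 1\<close>
  would follow.)\<close>

text \<open>The central generator occurs in relations other than the central ones only if some \<open>\<beta>\<close> in the
  lattice has \<open>(\<beta>, \<alpha>\<^sub>0\<^sup>\<or>) = -1\<close>, namely in \<open>T\<^sub>0 X\<^sub>\<beta> T\<^sub>0 = X\<^sub>\<gamma>\<close> with \<open>\<gamma> = s\<^sub>0 \<beta>\<close>. Among the types with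
  short affine root other than \<open>A\<^sub>2\<^sub>n\<^sup>(\<^sup>2\<^sup>)\<close>, such a \<open>\<beta>\<close> fails to exist exactly for \<open>A\<^sub>1\<^sup>(\<^sup>1\<^sup>)\<close> and
  \<open>D\<^sub>n\<^sub>+\<^sub>1\<^sup>(\<^sup>2\<^sup>)\<close>. In these two cases the group is the direct product of the subgroup generated by all
  \<open>T\<^sub>i\<close>, \<open>X\<^sub>\<mu>\<close> and the infinite cyclic group generated by the central generator, so the values of an
  automorphism on \<open>T\<^sub>1, \<dots>, T\<^sub>n\<close>, \<open>X\<^sub>\<mu>\<close>, \<open>Y\<^sub>\<mu>\<close> leave its value on the central generator open; in all
  other types they determine the automorphism.\<close>

definition delta_detached :: "affine_type \<Rightarrow> nat \<Rightarrow> cartan \<Rightarrow> bool" where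
  "delta_detached t n A \<longleftrightarrow>
    \<not> (\<exists>\<beta>\<in>lattice_Q t n A. form n A \<beta> (simple_coroot n A 0) = -1)"

end

theory Submission
  imports Defs
begin

text \<open>Real roots are characterised by arithmetic: they are integral vectors of the norm of a simple
  root that are also integral with respect to the coroots. Evenness of the form makes such vectors
  sign coherent, which yields the exchange property and Matsumoto's theorem for the affine Weyl
  group, the additivity of lengths on antidominant translations, and Lusztig's relations
  \<open>T\<^sub>i Y\<^sub>\<beta> = Y\<^sub>\<beta> T\<^sub>i\<close> for \<open>(\<beta>, \<alpha>\<^sub>i\<^sup>\<or>) = 0\<close> and \<open>T\<^sub>i\<inverse> Y\<^sub>\<beta> T\<^sub>i\<inverse> = Y\<^bsub>s\<^sub>i \<beta>\<^esub>\<close> for \<open>(\<beta>, \<alpha>\<^sub>i\<^sup>\<or>) = -1\<close>.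
  The involution must send \<open>T\<^sub>0\<close> to \<open>S = T\<^bsub>s\<^sub>\<theta>\<^esub> X\<^sub>-\<^sub>\<theta>\<close>, so what remains are the relations of \<open>S\<close> with the
  \<open>T\<^sub>i\<inverse>\<close> and the \<open>Y\<^sub>\<beta>\<close>. If \<open>\<alpha>\<^sub>k\<close> is joined to \<open>\<alpha>\<^sub>0\<close> by a simple bond and \<open>\<theta>' = \<theta> - \<alpha>\<^sub>k\<close>, then
  \<open>S T\<^bsub>s\<^bsub>\<theta>'\<^esub>\<^esub> = T\<^bsub>s\<^bsub>\<theta>'\<^esub>\<^esub> T\<^sub>k X\<^bsub>-\<alpha>\<^sub>k\<^esub>\<close>. This exhibits \<open>S\<close> as a conjugate of \<open>T\<^sub>k\<inverse>\<close>, and gives the braid relation and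
  the relation \<open>S Y\<^bsub>\<alpha>\<^sub>k\<^esub> S = Y\<^bsub>\<alpha>\<^sub>k - \<theta>\<^esub> X\<^sub>\<delta>\<inverse>\<close>; the relations for the other \<open>Y\<^sub>\<beta>\<close> follow by applying the
  \<open>T\<^sub>j\<inverse>\<close> that commute with \<open>S\<close>.\<close>

text \<open>The image of T_0 is forced. One has Y_{-\<theta>} = T_{s_\<theta>} T_0, and a
  homomorphism inverting T_1, ..., T_n also inverts T_{s_\<theta>} because s_\<theta> is an
  involution. Conversely, the resulting assignment together with inversion of X_\<delta> squares to
  the identity on generators, so existence rests on the defining relations being respected, and the
  obstacle is the affine node. The argument along a simple bond needs a_{0k} = a_{k0} = -1. In
  D_{n+1}^{(2)} the affine node has only a double bond, but there \<theta> and \<theta>' = \<theta>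
  - \<alpha>_1 are orthogonal, so s_{\<theta>'} fixes \<theta> and T_{s_{\<theta>'}} commutes with
  S; this replaces the conjugation. In A_1^{(1)} there is no braid relation, and only \<beta> = 0 is
  orthogonal to \<alpha>_0. In both types the lattice pairs evenly with the coroot of \<alpha>_0, no
  reflection relation arises at the affine node, and the image of X_\<delta> has to be prescribed.
  Elsewhere S Y_\<beta> S = Y_{\<beta> - \<theta>} X_\<delta>^{-1} forces its inversion.\<close>

lemma even_sum_symmetric:
  fixes F :: "nat \<Rightarrow> nat \<Rightarrow> int"
  assumes "\<And>j k. j \<le> m \<Longrightarrow> k \<le> m \<Longrightarrow> F j k = F k j" "\<And>j. j \<le> m \<Longrightarrow> even (F j j)"
  shows "even (\<Sum>j\<le>m. \<Sum>k\<le>m. F j k)"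
  using assms
proof (induction m)
  case 0
  then show ?case by simp
next
  case (Suc m)
  have "(\<Sum>j\<le>m. F j (Suc m)) = (\<Sum>k\<le>m. F (Suc m) k)"
    by (rule sum.cong) (simp_all add: Suc.prems)
  then have "(\<Sum>j\<le>Suc m. \<Sum>k\<le>Suc m. F j k)
      = (\<Sum>j\<le>m. \<Sum>k\<le>m. F j k) + 2 * (\<Sum>k\<le>m. F (Suc m) k) + F (Suc m) (Suc m)"
    by (simp add: sum.distrib)
  then show ?case using Suc by simp
qed

section \<open>Linear algebra of the invariant form\<close>

text \<open>Vectors are bare functions, so this one operation carries the linear algebra:
  reflections and translations are rewritten through it, and equations between vectors are closed by
  unfolding it pointwise.\<close>

definition lc :: "vec \<Rightarrow> real \<Rightarrow> vec \<Rightarrow> vec" where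
  "lc x c y = (\<lambda>i. x i + c * y i)"

lemma vadd_eq_lc: "vadd x y = lc x 1 y"
  by (simp add: vadd_def lc_def)

text \<open>Here \<open>e j\<close> is a_j^vee / a_j, half the norm of \<alpha>_j. The
  normalizations \<open>a_0\<close> and \<open>e_0\<close> give \<delta> the coordinate 1 at the
  affine node and \<alpha>_0 the norm 2, so that \<theta> = \<delta> - \<alpha>_0 and a_0^{-1}
  \<delta> = \<delta>.\<close>

locale affine_datum =
  fixes n :: nat and A :: cartan and a e :: "nat \<Rightarrow> int"
  assumes gcm: "generalized_cartan_matrix n A"
    and irr: "irreducible_cartan n A"
    and a_pos: "j \<le> n \<Longrightarrow> a j > 0" and a_0: "a 0 = 1"
    and null: "i \<le> n \<Longrightarrow> (\<Sum>j\<le>n. A i j * a j) = 0"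
    and e_pos: "j \<le> n \<Longrightarrow> e j > 0" and e_0: "e 0 = 1"
    and sym: "i \<le> n \<Longrightarrow> j \<le> n \<Longrightarrow> e i * A i j = e j * A j i"
    and label: "j \<le> n \<Longrightarrow> kac_label n A j = a j"
    and dd: "j \<le> n \<Longrightarrow> dd n A j = 1 / of_int (e j)"
begin

lemma diag: "i \<le> n \<Longrightarrow> A i i = 2"
  using gcm by (simp add: generalized_cartan_matrix_def)

lemma offdiag: "i \<le> n \<Longrightarrow> j \<le> n \<Longrightarrow> i \<noteq> j \<Longrightarrow> A i j \<le> 0"
  using gcm by (simp add: generalized_cartan_matrix_def)

lemma zero_iff: "i \<le> n \<Longrightarrow> j \<le> n \<Longrightarrow> A i j = 0 \<longleftrightarrow> A j i = 0"
  using gcm by (metis generalized_cartan_matrix_def)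

abbreviation B :: "vec \<Rightarrow> vec \<Rightarrow> real" where "B \<equiv> form n A"
abbreviation rt :: "nat \<Rightarrow> vec" where "rt \<equiv> simple_root"
abbreviation s :: "nat \<Rightarrow> vec \<Rightarrow> vec" where "s \<equiv> simple_reflection n A"
abbreviation \<delta> :: vec where "\<delta> \<equiv> delta n A"
abbreviation Q :: "vec set" where "Q \<equiv> finite_root_lattice n"
abbreviation trans :: "vec \<Rightarrow> vec \<Rightarrow> vec" where "trans \<equiv> translation n A"

text \<open>The pairing of x with the coroot of \<alpha>_j, by \<open>form_coroot\<close>; written
  with the integral Cartan entries so that integrality is immediate.\<close>

definition pr :: "nat \<Rightarrow> vec \<Rightarrow> real" where
  "pr j x = (\<Sum>k\<le>n. of_int (A j k) * x k)"

lemma B_eq: "B x y = (\<Sum>j\<le>n. \<Sum>k\<le>n. x j * y k * of_int (e j * A j k))"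
  unfolding form_def by (intro sum.cong HOL.refl) (simp add: dd mult_ac)

lemma pr_uminus: "pr i (\<lambda>k. - x k) = - pr i x"
  by (simp add: pr_def sum_negf)

lemma B_sym: "B x y = B y x"
proof -
  have "B x y = (\<Sum>j\<le>n. \<Sum>k\<le>n. x j * y k * of_int (e k * A k j))"
    unfolding B_eq by (intro sum.cong HOL.refl) (simp add: sym del: of_int_mult)
  also have "\<dots> = B y x"
    unfolding B_eq by (subst sum.swap) (simp add: mult_ac)
  finally show ?thesis .
qed

lemma B_lc_left: "B (lc x c y) z = B x z + c * B y z"
  by (simp add: B_eq lc_def algebra_simps sum.distrib sum_distrib_left)

lemma B_lc_right: "B z (lc x c y) = B z x + c * B z y"
  by (simp add: B_sym[of z] B_lc_left)

lemma pr_lc: "pr j (lc x c y) = pr j x + c * pr j y"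
  by (simp add: pr_def lc_def algebra_simps sum.distrib sum_distrib_left)

lemmas lin = B_lc_left B_lc_right pr_lc

lemma rt_apply: "rt j i = (if i = j then 1 else 0)"
  by (simp add: simple_root_def)

lemma delta_apply: "\<delta> i = (if i \<le> n then of_int (a i) else 0)"
proof -
  have "\<delta> i = (\<Sum>j\<le>n. if i = j then real_of_int (kac_label n A j) else 0)"
    unfolding delta_def rt_apply by (intro sum.cong) auto
  then show ?thesis by (auto simp: label)
qed

lemma B_pr_sum: "B x y = (\<Sum>j\<le>n. x j * of_int (e j) * pr j y)"
  by (simp add: B_eq pr_def sum_distrib_left algebra_simps)

lemma B_rt_left: "j \<le> n \<Longrightarrow> B (rt j) y = of_int (e j) * pr j y"
proof -
  assume j: "j \<le> n"
  have "B (rt j) y = (\<Sum>i\<le>n. if i = j then of_int (e i) * pr i y else 0)"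
    unfolding B_pr_sum rt_apply by (intro sum.cong) auto
  then show ?thesis using j by simp
qed

lemma B_rt: "j \<le> n \<Longrightarrow> B x (rt j) = of_int (e j) * pr j x"
  by (simp add: B_sym[of x] B_rt_left)

lemma pr_rt: "j \<le> n \<Longrightarrow> pr i (rt j) = of_int (A i j)"
proof -
  assume j: "j \<le> n"
  have "pr i (rt j) = (\<Sum>k\<le>n. if k = j then real_of_int (A i k) else 0)"
    unfolding pr_def rt_apply by (intro sum.cong) auto
  then show ?thesis using j by simp
qed

lemma coroot_eq: "j \<le> n \<Longrightarrow> simple_coroot n A j = (\<lambda>i. rt j i / of_int (e j))"
  by (simp add: simple_coroot_def dd)

lemma form_coroot: "j \<le> n \<Longrightarrow> B x (simple_coroot n A j) = pr j x"
proof -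
  assume j: "j \<le> n"
  have "simple_coroot n A j = lc (\<lambda>_. 0) (1 / of_int (e j)) (rt j)"
    by (simp add: coroot_eq[OF j] lc_def)
  moreover have "B x (\<lambda>_. 0) = 0" by (simp add: B_eq)
  ultimately show ?thesis
    using j e_pos[OF j] by (simp add: B_lc_right B_rt)
qed

lemma s_eq: "j \<le> n \<Longrightarrow> s j x = lc x (- pr j x) (rt j)"
  by (simp add: simple_reflection_def form_coroot lc_def)

lemma trans_eq: "trans \<mu> x = lc x (- B x \<mu>) \<delta>"
  by (simp add: translation_def lc_def)

lemma pr_delta: "j \<le> n \<Longrightarrow> pr j \<delta> = 0"
proof -
  assume j: "j \<le> n"
  have "pr j \<delta> = of_int (\<Sum>k\<le>n. A j k * a k)"
    unfolding pr_def of_int_sum by (intro sum.cong) (auto simp: delta_apply)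
  then show ?thesis using null[OF j] by simp
qed

lemma B_delta: "B x \<delta> = 0" "B \<delta> x = 0"
proof -
  show "B x \<delta> = 0" for x by (simp add: B_pr_sum pr_delta)
  then show "B \<delta> x = 0" by (simp add: B_sym[of \<delta>])
qed

lemma pr_s: "i \<le> n \<Longrightarrow> j \<le> n \<Longrightarrow> pr i (s j x) = pr i x - of_int (A i j) * pr j x"
  by (simp add: s_eq pr_lc pr_rt)

lemma s_s: "j \<le> n \<Longrightarrow> s j (s j x) = x"
  by (simp add: s_eq pr_lc pr_rt diag) (simp add: lc_def fun_eq_iff)

lemma s_s_comp: "j \<le> n \<Longrightarrow> s j \<circ> s j = id" "j \<le> n \<Longrightarrow> s j \<circ> (s j \<circ> f) = f"
  by (simp_all add: fun_eq_iff s_s)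

lemma B_s: "j \<le> n \<Longrightarrow> B (s j x) (s j y) = B x y"
  by (simp add: s_eq lin B_rt B_rt_left pr_rt diag algebra_simps)

lemma s_lc: "j \<le> n \<Longrightarrow> s j (lc x c y) = lc (s j x) c (s j y)"
  by (rule ext) (simp add: s_eq pr_lc, simp add: lc_def algebra_simps)

lemma s_delta: "j \<le> n \<Longrightarrow> s j \<delta> = \<delta>"
  by (simp add: s_eq pr_delta lc_def)

lemma s_rt: "j \<le> n \<Longrightarrow> s j (rt j) = (\<lambda>i. - rt j i)"
  by (simp add: s_eq pr_rt diag lc_def)

section \<open>Semidefiniteness of the form and its radical\<close>

text \<open>The matrix e_j a_{jk} a_j a_k is symmetric with vanishing row sums, so in the rescaled
  coordinates x_j / a_j the form is a weighted graph Laplacian.\<close>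

lemma B_squares:
  "B x x = - (1/2) * (\<Sum>j\<le>n. \<Sum>k\<le>n. of_int (e j * A j k * a j * a k) * (x j / of_int (a j) - x k / of_int (a k))\<^sup>2)"
proof -
  define y where "y j = x j / of_int (a j)" for j
  define b where "b j k = real_of_int (e j * A j k * a j * a k)" for j k
  have x: "x j = y j * of_int (a j)" if "j \<le> n" for j
    using a_pos[OF that] by (simp add: y_def)
  have row: "(\<Sum>k\<le>n. b j k) = 0" if "j \<le> n" for j
  proof -
    have "(\<Sum>k\<le>n. b j k) = of_int (e j * a j * (\<Sum>k\<le>n. A j k * a k))"
      by (simp add: b_def sum_distrib_left mult_ac)
    then show ?thesis by (simp add: null[OF that])
  qed
  have bsym: "b j k = b k j" if "j \<le> n" "k \<le> n" for j k
    using sym[OF that] by (simp add: b_def mult_ac del: of_int_mult)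
  have r1: "(\<Sum>j\<le>n. \<Sum>k\<le>n. b j k * (y j)\<^sup>2) = 0"
    by (simp add: sum_distrib_right[symmetric] row)
  have "(\<Sum>j\<le>n. \<Sum>k\<le>n. b j k * (y k)\<^sup>2) = (\<Sum>k\<le>n. \<Sum>j\<le>n. b k j * (y k)\<^sup>2)"
    by (subst sum.swap) (intro sum.cong HOL.refl, simp add: bsym)
  then have r2: "(\<Sum>j\<le>n. \<Sum>k\<le>n. b j k * (y k)\<^sup>2) = 0"
    by (simp add: sum_distrib_right[symmetric] row)
  have "(\<Sum>j\<le>n. \<Sum>k\<le>n. b j k * (y j - y k)\<^sup>2)
      = (\<Sum>j\<le>n. \<Sum>k\<le>n. b j k * (y j)\<^sup>2) + (\<Sum>j\<le>n. \<Sum>k\<le>n. b j k * (y k)\<^sup>2)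
        - 2 * (\<Sum>j\<le>n. \<Sum>k\<le>n. b j k * (y j * y k))"
    by (simp add: power2_diff algebra_simps sum.distrib sum_subtractf sum_distrib_left)
  also have "(\<Sum>j\<le>n. \<Sum>k\<le>n. b j k * (y j * y k)) = B x x"
    unfolding B_eq by (intro sum.cong HOL.refl) (simp add: x b_def mult_ac)
  finally show ?thesis using r1 r2 by (simp add: b_def y_def)
qed

lemma B_squares_le:
  fixes x :: vec
  shows "j \<le> n \<Longrightarrow> k \<le> n \<Longrightarrow> of_int (e j * A j k * a j * a k) * (x j / of_int (a j) - x k / of_int (a k))\<^sup>2 \<le> 0"
proof (cases "j = k")
  case False
  assume "j \<le> n" "k \<le> n"
  then have "e j * A j k * a j * a k \<le> 0"
    using e_pos a_pos offdiag[of j k] False by (simp add: mult_nonneg_nonpos mult_nonpos_nonneg less_imp_le)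
  then show ?thesis by (intro mult_nonpos_nonneg) (simp_all only: of_int_le_0_iff zero_le_power2)
qed simp

lemma B_nonneg: "B x x \<ge> 0"
proof -
  have "(\<Sum>j\<le>n. \<Sum>k\<le>n. of_int (e j * A j k * a j * a k) * (x j / of_int (a j) - x k / of_int (a k))\<^sup>2) \<le> 0"
    by (intro sum_nonpos) (use B_squares_le in blast)
  then show ?thesis unfolding B_squares by linarith
qed

text \<open>All squares in \<open>B_squares\<close> vanish, so x_j / a_j agrees at adjacent nodes,
  and irreducibility makes it constant.\<close>

lemma B_zero:
  assumes "B x x = 0"
  shows "\<exists>c. \<forall>j\<le>n. x j = c * \<delta> j"
proof -
  define F where "F j k = real_of_int (e j * A j k * a j * a k) * (x j / of_int (a j) - x k / of_int (a k))\<^sup>2" for j k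
  have le: "F j k \<le> 0" if "j \<le> n" "k \<le> n" for j k
    using that B_squares_le unfolding F_def by blast
  have "(\<Sum>j\<le>n. \<Sum>k\<le>n. - F j k) = 0"
    using assms unfolding B_squares F_def[symmetric] by (simp add: sum_negf)
  moreover have nn: "(\<Sum>k\<le>n. - F j k) \<ge> 0" if "j \<le> n" for j
    using le that by (intro sum_nonneg) auto
  ultimately have row: "\<forall>j\<in>{..n}. (\<Sum>k\<le>n. - F j k) = 0"
    by (subst (asm) sum_nonneg_eq_0_iff) auto
  have F0: "F j k = 0" if "j \<le> n" "k \<le> n" for j k
  proof -
    have "\<forall>k\<in>{..n}. - F j k = 0"
      using row that(1) le by (subst sum_nonneg_eq_0_iff[symmetric]) auto
    then show ?thesis using that(2) by auto
  qed
  define I where "I = {j. j \<le> n \<and> x j / of_int (a j) = x 0}"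
  have "I = {..n}"
  proof (rule ccontr)
    assume "I \<noteq> {..n}"
    moreover have "I \<subseteq> {..n}" "0 \<in> I" by (auto simp: I_def a_0)
    ultimately obtain i j where ij: "i \<in> I" "j \<in> {..n} - I" "A i j \<noteq> 0"
      using irr unfolding irreducible_cartan_def by (metis empty_iff)
    then have "i \<le> n" "j \<le> n" by (auto simp: I_def)
    with F0[of i j] ij e_pos[of i] a_pos[of i] a_pos[of j]
    have "x i / of_int (a i) = x j / of_int (a j)" by (simp add: F_def)
    with ij show False by (auto simp: I_def)
  qed
  then have y: "x j / of_int (a j) = x 0" if "j \<le> n" for j using that by (auto simp: I_def set_eq_iff)
  have "x j = x 0 * \<delta> j" if "j \<le> n" for j
    using y[OF that] a_pos[OF that] that by (simp add: delta_apply nonzero_divide_eq_eq)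
  then show ?thesis by blast
qed

section \<open>Real roots\<close>

text \<open>Real roots of the Weyl orbit of \<open>\<alpha>\<^sub>i\<close> are captured by integrality and norm conditions alone:
  \<open>x\<close> lies in the root lattice and \<open>x / e\<^sub>i\<close> in the coroot lattice.\<close>

definition integral_for :: "nat \<Rightarrow> vec \<Rightarrow> bool" where
  "integral_for i x \<longleftrightarrow> (\<forall>k. x k \<in> \<int>) \<and> (\<forall>k\<le>n. of_int (e k) * x k / of_int (e i) \<in> \<int>) \<and> (\<forall>k>n. x k = 0)"

definition root_of :: "nat \<Rightarrow> vec \<Rightarrow> bool" where
  "root_of i x \<longleftrightarrow> integral_for i x \<and> B x x = 2 * of_int (e i)"

definition root :: "vec \<Rightarrow> bool" where
  "root x \<longleftrightarrow> (\<exists>i\<le>n. root_of i x)"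

definition pos :: "vec \<Rightarrow> bool" where
  "pos x \<longleftrightarrow> (\<forall>k. 0 \<le> x k)"

lemma pr_Ints: "\<forall>k. x k \<in> \<int> \<Longrightarrow> pr j x \<in> \<int>"
  unfolding pr_def by (intro Ints_sum Ints_mult) auto

text \<open>With X the coordinates of x in the simple roots and C those of x / e_i in the simple
  coroots, the norm is e_i times the sum of C_j a_{jk} X_k. This array is symmetric with even
  diagonal, hence has an even sum.\<close>

lemma norm_even:
  assumes "integral_for i x" "i \<le> n"
  shows "\<exists>z::int. B x x = 2 * of_int (e i) * of_int z"
proof -
  have "\<forall>k. \<exists>z. x k = of_int z" using assms by (auto simp: integral_for_def Ints_def image_def)
  then obtain X where X: "x k = of_int (X k)" for k by metis
  have "\<forall>k. \<exists>z. k \<le> n \<longrightarrow> of_int (e k) * x k / of_int (e i) = of_int z"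
    using assms(1) unfolding integral_for_def by (metis Ints_cases)
  then obtain C where C: "of_int (e k) * x k / of_int (e i) = of_int (C k)" if "k \<le> n" for k by metis
  have ei: "e i > 0" using e_pos assms by blast
  have C': "e k * X k = e i * C k" if "k \<le> n" for k
  proof -
    have "real_of_int (e k * X k) = of_int (e i * C k)"
      using C[OF that] ei by (simp add: X nonzero_divide_eq_eq mult.commute)
    then show ?thesis by (simp only: of_int_eq_iff)
  qed
  define F where "F j k = C j * X k * A j k" for j k
  have F: "e i * F j k = e j * A j k * (X j * X k)" if "j \<le> n" "k \<le> n" for j k
    using C'[OF that(1)] by (simp add: F_def)
  have "even (\<Sum>j\<le>n. \<Sum>k\<le>n. F j k)"
  proof (rule even_sum_symmetric)
    fix j k assume jk: "j \<le> n" "k \<le> n"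
    have "e i * F j k = e i * F k j" using F[OF jk] F[OF jk(2,1)] sym[OF jk] by (simp add: mult.commute)
    then show "F j k = F k j" using ei by simp
  next
    fix j assume "j \<le> n"
    then show "even (F j j)" by (simp add: F_def diag)
  qed
  then obtain z where z: "(\<Sum>j\<le>n. \<Sum>k\<le>n. F j k) = 2 * z" by (elim evenE)
  have "B x x = (\<Sum>j\<le>n. \<Sum>k\<le>n. of_int (e i * F j k))"
    unfolding B_eq by (intro sum.cong HOL.refl) (simp add: F X)
  also have "\<dots> = of_int (e i * (\<Sum>j\<le>n. \<Sum>k\<le>n. F j k))"
    by (simp add: sum_distrib_left)
  finally have "B x x = 2 * of_int (e i) * of_int z" by (simp add: z)
  then show ?thesis ..
qed

lemma root_of_nonzero: "root_of i x \<Longrightarrow> i \<le> n \<Longrightarrow> B x x > 0"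
  using e_pos by (simp add: root_of_def)

lemma B_zero_vec: "(\<And>k. k \<le> n \<Longrightarrow> x k = 0) \<Longrightarrow> B x y = 0"
  by (simp add: B_eq)

lemma delta_pos: "k \<le> n \<Longrightarrow> \<delta> k > 0"
  by (simp add: delta_apply a_pos)

text \<open>Positive and negative part of a root cannot both have nonzero norm, the norm of either
  being a nonnegative multiple of the norm of the root.\<close>

lemma root_of_coherent:
  assumes x: "root_of i x" and i: "i \<le> n"
  shows "pos x \<or> pos (\<lambda>k. - x k)"
proof -
  define p q where "p = (\<lambda>k. max (x k) 0)" and "q = (\<lambda>k. max (- x k) 0)"
  have xpq: "x = lc p (-1) q" by (auto simp: fun_eq_iff lc_def p_def q_def)
  have ip: "integral_for i p" and iq: "integral_for i q"
    using x by (auto simp: root_of_def integral_for_def p_def q_def max_def)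
  have "B p q \<le> 0"
    unfolding B_eq
  proof (intro sum_nonpos)
    fix j k assume "j \<in> {..n}" "k \<in> {..n}"
    then have jk: "j \<le> n" "k \<le> n" by auto
    show "p j * q k * of_int (e j * A j k) \<le> 0"
    proof (cases "j = k")
      case True then show ?thesis by (auto simp: p_def q_def max_def)
    next
      case False
      have "e j * A j k \<le> 0" using offdiag[OF jk False] e_pos[OF jk(1)] by (simp add: mult_nonneg_nonpos)
      then have "real_of_int (e j * A j k) \<le> 0" by linarith
      then show ?thesis by (intro mult_nonneg_nonpos) (auto simp: p_def q_def)
    qed
  qed
  moreover have "B x x = B p p + B q q - 2 * B p q"
    unfolding xpq lin by (simp add: B_sym[of q p])
  ultimately have le: "B p p + B q q \<le> 2 * of_int (e i)" using x by (simp add: root_of_def)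
  obtain y z where y: "B p p = 2 * of_int (e i) * of_int y" and z: "B q q = 2 * of_int (e i) * of_int z"
    using norm_even[OF ip i] norm_even[OF iq i] by blast
  have ei: "e i > 0" using e_pos i by blast
  have "y \<ge> 0" "z \<ge> 0" using B_nonneg[of p] B_nonneg[of q] ei by (auto simp: y z zero_le_mult_iff)
  moreover have "y + z \<le> 1"
  proof -
    have "2 * real_of_int (e i) * of_int (y + z) \<le> 2 * of_int (e i) * 1"
      using le by (simp add: y z algebra_simps)
    then have "real_of_int (y + z) \<le> 1" using ei by (subst (asm) mult_le_cancel_left_pos) auto
    then show ?thesis by linarith
  qed
  ultimately have "y = 0 \<or> z = 0" by linarith
  then have "B p p = 0 \<or> B q q = 0" by (auto simp: y z)
  \<comment> \<open>A part of norm zero is a multiple of \<delta>: it vanishes or has full support,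
    and either way x has only one sign.\<close>
  moreover have "r = (\<lambda>k. 0) \<or> (\<forall>k\<le>n. r k > 0)"
    if "B r r = 0" "\<And>k. r k \<ge> 0" "\<And>k. k > n \<Longrightarrow> r k = 0" for r :: vec
  proof -
    obtain c where c: "\<forall>j\<le>n. r j = c * \<delta> j" using B_zero[OF \<open>B r r = 0\<close>] by blast
    have "c = r 0" using c by (simp add: delta_apply a_0)
    then have "c \<ge> 0" using that by simp
    show ?thesis
    proof (cases "c = 0")
      case True
      have "r k = 0" for k using c that(3) True by (cases "k \<le> n") auto
      then show ?thesis by auto
    next
      case False then show ?thesis using c delta_pos \<open>c \<ge> 0\<close> by auto
    qed
  qed note * = this
  have sup: "k > n \<Longrightarrow> x k = 0" for k using x by (simp add: root_of_def integral_for_def)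
  ultimately consider "p = (\<lambda>k. 0)" | "q = (\<lambda>k. 0)" | "\<forall>k\<le>n. p k > 0" | "\<forall>k\<le>n. q k > 0"
    using *[of p] *[of q] by (auto simp: p_def q_def)
  then show ?thesis
  proof cases
    case 1 then have "max (x k) 0 = 0" for k by (metis p_def)
    then have "x k \<le> 0" for k by (metis max.cobounded1)
    then show ?thesis by (simp add: pos_def)
  next
    case 2 then have "max (- x k) 0 = 0" for k by (metis q_def)
    then have "- x k \<le> 0" for k by (metis max.cobounded1)
    then show ?thesis by (simp add: pos_def)
  next
    case 3 then have "x k \<ge> 0" for k using sup[of k] by (cases "k \<le> n") (auto simp: p_def max_def split: if_splits)
    then show ?thesis by (simp add: pos_def)
  next
    case 4 then have "x k \<le> 0" for k using sup[of k] by (cases "k \<le> n") (auto simp: q_def max_def split: if_splits)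
    then show ?thesis by (simp add: pos_def)
  qed
qed

lemma coherent: "root x \<Longrightarrow> \<not> pos x \<Longrightarrow> x k \<le> 0"
  using root_of_coherent unfolding root_def pos_def by force

lemma root_of_ex: "root_of i x \<Longrightarrow> i \<le> n \<Longrightarrow> \<exists>k\<le>n. x k \<noteq> 0"
  using root_of_nonzero B_zero_vec by (metis less_irrefl)

lemma root_ex: "root x \<Longrightarrow> \<exists>k\<le>n. x k \<noteq> 0"
  using root_of_ex unfolding root_def by blast

lemma pos_if_coord: "root x \<Longrightarrow> x k > 0 \<Longrightarrow> pos x"
  using coherent[of x k] by fastforce

lemma not_pos_if_coord: "x k < 0 \<Longrightarrow> \<not> pos x"
  unfolding pos_def by (metis not_less)

lemma not_pos_if: "root x \<Longrightarrow> (\<And>k. x k \<le> 0) \<Longrightarrow> \<not> pos x"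
  using root_ex[of x] unfolding pos_def by (meson antisym)

lemma root_of_rt: "i \<le> n \<Longrightarrow> root_of i (rt i)"
  using e_pos[of i] by (auto simp: root_of_def integral_for_def rt_apply B_rt pr_rt diag)

lemma root_rt: "i \<le> n \<Longrightarrow> root (rt i)"
  using root_of_rt root_def by blast

lemma pos_rt: "pos (rt i)"
  by (simp add: pos_def rt_apply)

lemma root_of_uminus: "root_of i x \<Longrightarrow> root_of i (\<lambda>k. - x k)"
  by (auto simp: root_of_def integral_for_def B_eq)

lemma root_uminus: "root x \<Longrightarrow> root (\<lambda>k. - x k)"
  using root_of_uminus root_def by blast

lemma pr_scaled_Ints:
  assumes "integral_for i x" "j \<le> n"
  shows "of_int (e j) * pr j x / of_int (e i) \<in> \<int>"
proof -
  have "of_int (e j) * pr j x / of_int (e i) = (\<Sum>k\<le>n. of_int (e j * A j k) * x k / of_int (e i))"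
    by (simp add: pr_def sum_distrib_left sum_divide_distrib mult_ac)
  also have "\<dots> = (\<Sum>k\<le>n. of_int (A k j) * (of_int (e k) * x k / of_int (e i)))"
    by (intro sum.cong HOL.refl) (simp add: sym[OF \<open>j \<le> n\<close>] del: of_int_mult, simp)
  also have "\<dots> \<in> \<int>"
    using assms by (intro Ints_sum Ints_mult) (auto simp: integral_for_def)
  finally show ?thesis .
qed

lemma integral_for_lc_rt:
  assumes "integral_for i x" "j \<le> n" "c \<in> \<int>" "of_int (e j) * c / of_int (e i) \<in> \<int>"
  shows "integral_for i (lc x c (rt j))"
  using assms unfolding integral_for_def lc_def rt_apply
  by (auto simp: distrib_left add_divide_distrib)

lemma integral_for_s: "integral_for i x \<Longrightarrow> j \<le> n \<Longrightarrow> integral_for i (s j x)"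
  unfolding s_eq
  by (rule integral_for_lc_rt) (use pr_scaled_Ints[of i x j] pr_Ints[of x j] in \<open>auto simp: integral_for_def\<close>)

lemma root_of_s: "root_of i x \<Longrightarrow> j \<le> n \<Longrightarrow> root_of i (s j x)"
  by (simp add: root_of_def integral_for_s B_s)

lemma root_s: "root x \<Longrightarrow> j \<le> n \<Longrightarrow> root (s j x)"
  using root_of_s root_def by blast

lemma integral_for_delta:
  assumes "integral_for i x" "c \<in> \<int>" "c / of_int (e i) \<in> \<int>"
  shows "integral_for i (lc x c \<delta>)"
  unfolding integral_for_def
proof (intro conjI allI impI)
  show "lc x c \<delta> k \<in> \<int>" for k using assms by (auto simp: integral_for_def lc_def delta_apply)
  show "k > n \<Longrightarrow> lc x c \<delta> k = 0" for k using assms by (auto simp: integral_for_def lc_def delta_apply)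
  fix k assume k: "k \<le> n"
  have "of_int (e k) * lc x c \<delta> k / of_int (e i) = of_int (e k) * x k / of_int (e i) + of_int (e k * a k) * (c / of_int (e i))"
    using k by (simp add: lc_def delta_apply algebra_simps add_divide_distrib)
  also have "\<dots> \<in> \<int>" using assms k by (intro Ints_add Ints_mult) (auto simp: integral_for_def)
  finally show "of_int (e k) * lc x c \<delta> k / of_int (e i) \<in> \<int>" .
qed

text \<open>The finite part. The multiple of \<delta> to remove is read off at the affine node,
  where \<delta> has coordinate 1. Translations do not change it, and it governs their effect on
  signs.\<close>

definition fp :: "vec \<Rightarrow> vec" where "fp x = lc x (- x 0) \<delta>"

lemma root_of_fp: "root_of i x \<Longrightarrow> root_of i (fp x)"
  unfolding root_of_def fp_def
  by (auto simp: lin B_delta intro!: integral_for_delta) (auto simp: integral_for_def e_0 dest: spec[of _ 0])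

lemma root_fp: "root x \<Longrightarrow> root (fp x)"
  using root_of_fp root_def by blast

lemma fp_0: "fp x 0 = 0"
  by (simp add: fp_def lc_def delta_apply a_0)

lemma root_of_trans:
  assumes "root_of i x" "\<mu> \<in> Q"
  shows "root_of i (trans \<mu> x)"
proof -
  have ix: "integral_for i x" using assms by (simp add: root_of_def)
  have mu: "\<forall>k. \<mu> k \<in> \<int>" using assms by (auto simp: finite_root_lattice_def)
  have "B x \<mu> \<in> \<int>"
    unfolding B_pr_sum using ix mu by (intro Ints_sum Ints_mult pr_Ints) (auto simp: integral_for_def)
  moreover have "B x \<mu> / of_int (e i) \<in> \<int>"
  proof -
    have "B x \<mu> / of_int (e i) = (\<Sum>j\<le>n. (of_int (e j) * x j / of_int (e i)) * pr j \<mu>)"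
      by (simp add: B_pr_sum sum_divide_distrib mult_ac)
    also have "\<dots> \<in> \<int>" using ix mu by (intro Ints_sum Ints_mult pr_Ints) (auto simp: integral_for_def)
    finally show ?thesis .
  qed
  ultimately have "integral_for i (trans \<mu> x)"
    unfolding trans_eq using ix by (intro integral_for_delta) auto
  then show ?thesis using assms by (simp add: root_of_def trans_eq lin B_delta)
qed

lemma root_trans: "root x \<Longrightarrow> \<mu> \<in> Q \<Longrightarrow> root (trans \<mu> x)"
  using root_of_trans root_def by blast

text \<open>Comparing norms gives c^2 e_j = e_i, so the integers c and e_j c / e_i have product 1.
  The condition \<open>jk\<close> makes k visible at the affine node.\<close>

lemma root_multiple:
  assumes x: "root_of i x" and i: "i \<le> n" and j: "j \<le> n" and eq: "x = lc (\<lambda>l. c * rt j l) k \<delta>"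
    and jk: "j \<noteq> 0 \<or> k = 0"
  shows "(c = 1 \<or> c = -1) \<and> e i = e j \<and> k / of_int (e j) \<in> \<int>"
proof -
  have ix: "\<And>l. x l \<in> \<int>" "\<And>l. l \<le> n \<Longrightarrow> of_int (e l) * x l / of_int (e i) \<in> \<int>"
    using x by (auto simp: root_of_def integral_for_def)
  have k: "k \<in> \<int>" "k / of_int (e i) \<in> \<int>"
    using jk ix(1)[of 0] ix(2)[of 0] by (auto simp: eq lc_def rt_apply delta_apply a_0 e_0)
  have xj: "x j = c + k * of_int (a j)" using j by (simp add: eq lc_def rt_apply delta_apply)
  have "c = x j - k * of_int (a j)" using xj by simp
  then have c: "c \<in> \<int>" using k ix(1)[of j] by (auto intro!: Ints_diff Ints_mult)
  have "of_int (e j) * c / of_int (e i) = of_int (e j) * x j / of_int (e i) - (k / of_int (e i)) * of_int (e j * a j)"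
    by (simp add: xj algebra_simps add_divide_distrib)
  then have c': "of_int (e j) * c / of_int (e i) \<in> \<int>"
    using k ix(2)[OF j] by (metis Ints_diff Ints_mult Ints_of_int)
  have ei: "e i > 0" and ej: "e j > 0" using e_pos i j by auto
  have "(\<lambda>l. c * rt j l) = lc (\<lambda>_. 0) c (rt j)" by (simp add: lc_def)
  then have "B x x = c * c * (2 * of_int (e j))"
    unfolding eq using j by (simp add: lin B_delta B_zero_vec B_rt pr_rt diag) (simp add: B_eq)
  then have "c * c * of_int (e j) = of_int (e i)" using x by (simp add: root_of_def)
  then have 1: "c * (of_int (e j) * c / of_int (e i)) = 1" using ei by (simp add: field_simps)
  obtain y z where "c = of_int y" "of_int (e j) * c / of_int (e i) = of_int z"
    using c c' by (metis Ints_cases)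
  with 1 have "y * z = 1" by (metis of_int_eq_1_iff of_int_mult)
  then have "y = 1 \<or> y = -1" by (auto simp: zmult_eq_1_iff)
  then have "c = 1 \<or> c = -1" using \<open>c = of_int y\<close> by auto
  moreover from this have "e i = e j" using \<open>c * c * of_int (e j) = of_int (e i)\<close> by auto
  ultimately show ?thesis using k by auto
qed

text \<open>Since s_j changes only the coordinate at j, a positive root with another nonzero
  coordinate keeps a positive one. A root supported on j alone is a multiple of \<alpha>_j, which
  \<open>root_multiple\<close> settles.\<close>

lemma s_not_pos_imp:
  assumes "root x" "pos x" "j \<le> n" "\<not> pos (s j x)"
  shows "x = rt j"
proof -
  obtain i where i: "i \<le> n" "root_of i x" using assms root_def by blast
  have "x l = 0" if "l \<noteq> j" for l
  proof (rule ccontr)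
    assume "x l \<noteq> 0"
    then have "x l > 0" using assms(2) by (auto simp: pos_def order_less_le)
    then have "s j x l > 0" using that assms(3) by (simp add: s_eq lc_def rt_apply)
    then show False using pos_if_coord[OF root_s[OF assms(1,3)]] assms(4) by blast
  qed
  then have x: "x = lc (\<lambda>l. x j * rt j l) 0 \<delta>" by (auto simp: fun_eq_iff lc_def rt_apply)
  have "x j = 1 \<or> x j = -1" using root_multiple[OF i(2,1) assms(3) x] by blast
  moreover have "x j \<ge> 0" using assms(2) by (simp add: pos_def)
  ultimately have "x j = 1" by auto
  then show ?thesis using x by (simp add: lc_def)
qed

section \<open>The affine Weyl group\<close>

abbreviation ev :: "nat list \<Rightarrow> vec \<Rightarrow> vec" where "ev \<equiv> weyl_eval n A"
abbreviation iv :: "(vec \<Rightarrow> vec) \<Rightarrow> vec \<Rightarrow> vec" where "iv \<equiv> inv_into UNIV"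
abbreviation red :: "(vec \<Rightarrow> vec) \<Rightarrow> nat list \<Rightarrow> bool" where "red \<equiv> reduced_decomposition n A"

definition W :: "(vec \<Rightarrow> vec) set" where
  "W = {ev js | js. set js \<subseteq> {..n}}"

definition len :: "(vec \<Rightarrow> vec) \<Rightarrow> nat" where
  "len w = (LEAST l. \<exists>js. set js \<subseteq> {..n} \<and> ev js = w \<and> length js = l)"

lemma ev_Nil: "ev [] = id" and ev_Cons: "ev (j # js) = s j \<circ> ev js"
  by (simp_all add: weyl_eval_def)

lemma ev_append: "ev (js @ ks) = ev js \<circ> ev ks"
  by (induction js) (simp_all add: ev_Nil ev_Cons comp_assoc)

lemma W_induct [consumes 1, case_names id step]:
  assumes "w \<in> W" "P id" "\<And>j w. j \<le> n \<Longrightarrow> w \<in> W \<Longrightarrow> P w \<Longrightarrow> P (s j \<circ> w)"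
  shows "P w"
proof -
  obtain js where "set js \<subseteq> {..n}" "w = ev js" using assms(1) by (auto simp: W_def)
  then show ?thesis
  proof (induction js arbitrary: w)
    case Nil then show ?case using assms(2) by (simp add: ev_Nil id_def)
  next
    case (Cons j js)
    then have "ev js \<in> W" "P (ev js)" "j \<le> n" by (auto simp: W_def)
    then have "P (s j \<circ> ev js)" by (intro assms(3))
    then show ?case unfolding Cons.prems(2) ev_Cons .
  qed
qed

lemma W_ev: "set js \<subseteq> {..n} \<Longrightarrow> ev js \<in> W"
  by (auto simp: W_def)

lemma W_id: "id \<in> W"
  using W_ev[of "[]"] by (simp add: ev_Nil)

lemma W_s: "j \<le> n \<Longrightarrow> s j \<in> W"
  using W_ev[of "[j]"] by (simp add: ev_Nil ev_Cons)

lemma W_comp: "u \<in> W \<Longrightarrow> v \<in> W \<Longrightarrow> u \<circ> v \<in> W"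
proof -
  assume "u \<in> W" "v \<in> W"
  then obtain js ks where "set (js @ ks) \<subseteq> {..n}" "u = ev js" "v = ev ks" by (auto simp: W_def)
  then show ?thesis using W_ev[of "js @ ks"] by (simp only: ev_append)
qed

lemma ev_rev: "set js \<subseteq> {..n} \<Longrightarrow> ev (rev js) \<circ> ev js = id"
  by (induction js) (simp_all add: ev_Nil ev_Cons ev_append comp_assoc s_s_comp)

lemma ev_rev': "set js \<subseteq> {..n} \<Longrightarrow> ev js \<circ> ev (rev js) = id"
  using ev_rev[of "rev js"] by simp

lemma inv_ev: "set js \<subseteq> {..n} \<Longrightarrow> iv (ev js) = ev (rev js)"
  using ev_rev ev_rev' by (metis inv_unique_comp)

lemma bij_W: "w \<in> W \<Longrightarrow> bij w"
  using ev_rev ev_rev' o_bij unfolding W_def by blast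

lemma W_inv: "w \<in> W \<Longrightarrow> iv w \<in> W"
  unfolding W_def by (force simp: inv_ev)

lemma W_inv_apply: "w \<in> W \<Longrightarrow> iv w (w x) = x" "w \<in> W \<Longrightarrow> w (iv w x) = x"
  using bij_W by (simp_all add: bij_is_inj bij_is_surj surj_f_inv_f)

lemma inv_comp_W: "u \<in> W \<Longrightarrow> v \<in> W \<Longrightarrow> iv (u \<circ> v) = iv v \<circ> iv u"
  by (simp add: bij_W o_inv_distrib)

lemma inv_s: "j \<le> n \<Longrightarrow> iv (s j) = s j"
  using inv_ev[of "[j]"] by (simp add: ev_Nil ev_Cons)

lemma inv_inv_W: "w \<in> W \<Longrightarrow> iv (iv w) = w"
  by (simp add: bij_W inv_inv_eq)

lemma W_lc: "w \<in> W \<Longrightarrow> w (lc x c y) = lc (w x) c (w y)"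
  by (induction rule: W_induct) (simp_all add: s_lc)

lemma W_root: "w \<in> W \<Longrightarrow> root x \<Longrightarrow> root (w x)"
  by (induction rule: W_induct) (simp_all add: root_s)

lemma W_root_of: "w \<in> W \<Longrightarrow> root_of i x \<Longrightarrow> root_of i (w x)"
  by (induction rule: W_induct) (simp_all add: root_of_s)

lemma W_delta: "w \<in> W \<Longrightarrow> w \<delta> = \<delta>"
  by (induction rule: W_induct) (simp_all add: s_delta)

lemma W_B: "w \<in> W \<Longrightarrow> B (w x) (w y) = B x y"
  by (induction rule: W_induct) (simp_all add: B_s)

lemma W_uminus: "w \<in> W \<Longrightarrow> w (\<lambda>k. - x k) = (\<lambda>k. - w x k)"
proof -
  assume w: "w \<in> W"
  have "(\<lambda>k. - x k) = lc x (-2) x" by (simp add: lc_def)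
  then show ?thesis using w by (simp add: W_lc) (simp add: lc_def)
qed

lemma W_zero: "w \<in> W \<Longrightarrow> w (\<lambda>_. 0) = (\<lambda>_. 0)"
  by (induction rule: W_induct) (simp_all add: s_eq lc_def pr_def)

lemma pos_uminus: "root x \<Longrightarrow> pos (\<lambda>k. - x k) \<longleftrightarrow> \<not> pos x"
  using coherent[of x] not_pos_if[of x] by (auto simp: pos_def)

section \<open>Length and the exchange property\<close>

lemma red_ex: "w \<in> W \<Longrightarrow> \<exists>js. red w js"
proof -
  assume "w \<in> W"
  then obtain js where "set js \<subseteq> {..n} \<and> ev js = w" by (auto simp: W_def)
  from ex_has_least_nat[where P = "\<lambda>js. set js \<subseteq> {..n} \<and> ev js = w" and m = length, OF this]
  show ?thesis unfolding reduced_decomposition_def by blast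
qed

lemma red_len: "red w js \<Longrightarrow> length js = len w"
  unfolding len_def reduced_decomposition_def by (rule Least_equality[symmetric]) auto

lemma red_iff: "red w js \<longleftrightarrow> set js \<subseteq> {..n} \<and> ev js = w \<and> length js = len w"
proof
  assume r: "red w js"
  then show "set js \<subseteq> {..n} \<and> ev js = w \<and> length js = len w"
    using red_len[OF r] by (auto simp: reduced_decomposition_def)
next
  assume r: "set js \<subseteq> {..n} \<and> ev js = w \<and> length js = len w"
  then have "w \<in> W" using W_ev by blast
  then obtain ks where "red w ks" using red_ex by blast
  then show "red w js" using r red_len[of w ks] by (auto simp: reduced_decomposition_def)
qed

lemma len_le: "set js \<subseteq> {..n} \<Longrightarrow> len (ev js) \<le> length js"
  unfolding len_def by (rule Least_le) auto

lemma len_s_le: "w \<in> W \<Longrightarrow> j \<le> n \<Longrightarrow> len (s j \<circ> w) \<le> Suc (len w)"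
proof -
  assume w: "w \<in> W" "j \<le> n"
  then obtain js where "red w js" using red_ex by blast
  then show ?thesis using len_le[of "j # js"] w by (simp add: red_iff ev_Cons)
qed

lemma len_inv_le: "w \<in> W \<Longrightarrow> len (iv w) \<le> len w"
proof -
  assume w: "w \<in> W"
  then obtain js where "red w js" using red_ex by blast
  then show ?thesis using len_le[of "rev js"] inv_ev[of js] by (simp add: red_iff)
qed

lemma len_inv: "w \<in> W \<Longrightarrow> len (iv w) = len w"
  using len_inv_le[of w] len_inv_le[of "iv w"] by (simp add: W_inv inv_inv_W)

lemma red_inv: "red w js \<Longrightarrow> red (iv w) (rev js)"
proof -
  assume r: "red w js"
  then have "w \<in> W" using W_ev by (auto simp: red_iff)
  then show ?thesis using r by (auto simp: red_iff inv_ev len_inv)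
qed

text \<open>Reading the word from the right, the image of \<alpha>_i turns negative at some letter
  j, where the suffix sends \<alpha>_i to \<alpha>_j. Equal norms then give equal coroot pairings,
  the suffix conjugates s_i into s_j, and the letter j cancels.\<close>

lemma exchange:
  assumes "set js \<subseteq> {..n}" "i \<le> n" "\<not> pos (ev js (rt i))"
  shows "\<exists>ks. set ks \<subseteq> {..n} \<and> Suc (length ks) = length js \<and> ev js \<circ> s i = ev ks"
  using assms
proof (induction js)
  case Nil then show ?case using pos_rt by (simp add: ev_Nil)
next
  case (Cons j js)
  have js: "set js \<subseteq> {..n}" and j: "j \<le> n" using Cons.prems by auto
  note W = W_ev[OF js]
  have rj: "root (ev js (rt i))" using W Cons.prems by (simp add: W_root root_rt)
  show ?case
  proof (cases "pos (ev js (rt i))")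
    case False
    then obtain ks where ks: "set ks \<subseteq> {..n}" "Suc (length ks) = length js" "ev js \<circ> s i = ev ks"
      using Cons.IH js Cons.prems by blast
    then have "ev (j # js) \<circ> s i = ev (j # ks)" by (simp only: ev_Cons comp_assoc)
    then show ?thesis
      using j ks by (intro exI[of _ "j # ks"]) simp
  next
    case True
    have eq: "ev js (rt i) = rt j"
      using s_not_pos_imp[OF rj True j] Cons.prems by (simp add: ev_Cons)
    have "root_of i (rt j)" using W_root_of[OF W root_of_rt[OF \<open>i \<le> n\<close>]] by (simp add: eq)
    then have eij: "e i = e j" using j by (simp add: root_of_def B_rt pr_rt diag)
    have pr: "pr j (ev js x) = pr i x" for x
      using W_B[OF W, of x "rt i"] j \<open>i \<le> n\<close> e_pos[OF j] by (simp add: eq B_rt eij)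
    have "ev js \<circ> s i = s j \<circ> ev js"
      using j \<open>i \<le> n\<close> by (simp add: fun_eq_iff[where f="_ \<circ> _"] s_eq W_lc[OF W] eq pr)
    then have "ev (j # js) \<circ> s i = ev js"
      using j by (simp add: ev_Cons comp_assoc s_s_comp)
    then show ?thesis using js by auto
  qed
qed

lemma len_right_less: "w \<in> W \<Longrightarrow> i \<le> n \<Longrightarrow> \<not> pos (w (rt i)) \<Longrightarrow> len (w \<circ> s i) < len w"
proof -
  assume w: "w \<in> W" "i \<le> n" "\<not> pos (w (rt i))"
  obtain js where r: "red w js" using w red_ex by blast
  then obtain ks where "set ks \<subseteq> {..n}" "Suc (length ks) = length js" "ev js \<circ> s i = ev ks"
    using exchange[of js i] w by (auto simp: red_iff)
  then show ?thesis using len_le[of ks] r by (auto simp: red_iff)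
qed

lemma len_left_less:
  assumes "w \<in> W" "i \<le> n" "\<not> pos (iv w (rt i))"
  shows "len (s i \<circ> w) < len w"
proof -
  have "len (iv w \<circ> s i) < len (iv w)" using assms by (simp add: len_right_less W_inv)
  moreover have "iv w \<circ> s i = iv (s i \<circ> w)" using assms by (simp add: inv_comp_W W_s inv_s)
  ultimately show ?thesis using assms by (simp add: len_inv W_comp W_s)
qed

lemma len_left_neg:
  assumes "w \<in> W" "i \<le> n" "\<not> pos (iv w (rt i))"
  shows "len w = Suc (len (s i \<circ> w))"
  using len_left_less[OF assms] len_s_le[of "s i \<circ> w" i] assms
  by (simp add: W_comp W_s s_s_comp)

lemma inv_s_comp: "w \<in> W \<Longrightarrow> i \<le> n \<Longrightarrow> iv (s i \<circ> w) = iv w \<circ> s i"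
  by (simp add: inv_comp_W W_s inv_s)

lemma len_left_pos:
  assumes "w \<in> W" "i \<le> n" "pos (iv w (rt i))"
  shows "len (s i \<circ> w) = Suc (len w)"
proof -
  have "\<not> pos (iv (s i \<circ> w) (rt i))"
    using assms pos_uminus[of "iv w (rt i)"]
    by (simp add: inv_s_comp s_rt W_uminus W_inv W_root root_rt)
  from len_left_neg[OF _ assms(2) this] assms show ?thesis
    by (simp add: W_comp W_s s_s_comp)
qed

lemma red_Cons:
  assumes "red w (k # u)"
  shows "k \<le> n" "w \<in> W" "red (s k \<circ> w) u" "\<not> pos (iv w (rt k))" "w = s k \<circ> ev u"
proof -
  have k: "k \<le> n" and u: "set u \<subseteq> {..n}" and w: "w = s k \<circ> ev u" and l: "len w = Suc (length u)"
    using assms by (auto simp: red_iff ev_Cons)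
  then show "k \<le> n" "w = s k \<circ> ev u" by auto
  have W: "ev u \<in> W" using W_ev u by blast
  then show wW: "w \<in> W" using w k by (simp add: W_comp W_s)
  have sw: "s k \<circ> w = ev u" using w k by (simp add: s_s_comp)
  have le: "len (s k \<circ> w) \<le> length u" using len_le[OF u] sw by simp
  then show np: "\<not> pos (iv w (rt k))" using len_left_pos[OF wW k] l by auto
  show "red (s k \<circ> w) u" using len_left_neg[OF wW k np] l u sw by (simp add: red_iff)
qed

lemma red_Cons_intro:
  assumes "w \<in> W" "k \<le> n" "\<not> pos (iv w (rt k))" "red (s k \<circ> w) u"
  shows "red w (k # u)"
  using assms len_left_neg[OF assms(1-3)] by (auto simp: red_iff ev_Cons s_s_comp)

lemma red_Nil: "red w [] \<longleftrightarrow> w = id"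
  using len_le[of "[]"] by (auto simp: red_iff ev_Nil)

section \<open>Words in two simple reflections\<close>

text \<open>For a reduced word of w this lists the positive roots made negative by the inverse of
  w.\<close>

fun invs :: "nat list \<Rightarrow> vec list" where
  "invs [] = []"
| "invs (k # ks) = rt k # map (s k) (invs ks)"

text \<open>The hypothesis says that each letter in turn is a left descent of what remains of w, so
  it can be split off with the length dropping by one.\<close>

lemma red_prefix:
  assumes "w \<in> W" "set ks \<subseteq> {..n}" "\<forall>x\<in>set (invs ks). \<not> pos (iv w x)"
  shows "\<exists>z. red w (ks @ z)"
  using assms
proof (induction ks arbitrary: w)
  case Nil then show ?case using red_ex by simp
next
  case (Cons k ks)
  have k: "k \<le> n" using Cons.prems by simp
  have "\<exists>z. red (s k \<circ> w) (ks @ z)"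
  proof (rule Cons.IH)
    show "s k \<circ> w \<in> W" using Cons.prems(1) k by (intro W_comp W_s)
    show "set ks \<subseteq> {..n}" using Cons.prems(2) by simp
    show "\<forall>x\<in>set (invs ks). \<not> pos (iv (s k \<circ> w) x)"
      using Cons.prems by (simp add: inv_s_comp)
  qed
  then show ?case using red_Cons_intro[OF Cons.prems(1) k] Cons.prems by auto
qed

lemma pr_zero: "pr i (\<lambda>_. 0) = 0"
  by (simp add: pr_def)

text \<open>In the coordinates (c, d) the reflections s_i and s_j are affine maps, which turns rank
  two computations into arithmetic.\<close>

definition comb :: "vec \<Rightarrow> nat \<Rightarrow> nat \<Rightarrow> real \<Rightarrow> real \<Rightarrow> vec" where
  "comb x i j c d = lc (lc x c (rt i)) d (rt j)"

text \<open>A rule for the simplifier: it supplies the witnesses in \<open>common_descent\<close>,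
  where the coefficients are already computed.\<close>

lemma combI:
  "0 \<le> c \<Longrightarrow> 0 \<le> d \<Longrightarrow> \<exists>c'\<ge>0. \<exists>d'\<ge>0. comb x i j c d = comb x i j c' d'"
  by blast

lemma s_comb:
  assumes "i \<le> n" "j \<le> n"
  shows "s i (comb x i j c d) = comb x i j (- c - of_int (A i j) * d - pr i x) d"
    and "s j (comb x i j c d) = comb x i j c (- d - of_int (A j i) * c - pr j x)"
  using assms by (simp_all add: comb_def s_eq lin pr_rt diag fun_eq_iff) (simp_all add: lc_def algebra_simps)

lemma comb_0: "comb x i j 0 0 = x"
  by (simp add: comb_def lc_def)

lemma rt_comb: "rt i = comb (\<lambda>_. 0) i j 1 0" "rt j = comb (\<lambda>_. 0) i j 0 1"
  by (simp_all add: comb_def lc_def)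

lemma root_invs: "set ks \<subseteq> {..n} \<Longrightarrow> x \<in> set (invs ks) \<Longrightarrow> root x"
  by (induction ks arbitrary: x) (auto simp: root_rt root_s)

lemma neg_comb:
  assumes w: "w \<in> W" and ij: "i \<le> n" "j \<le> n" and neg: "\<not> pos (w (rt i))" "\<not> pos (w (rt j))"
    and cd: "c \<ge> 0" "d \<ge> 0"
  shows "w (comb (\<lambda>_. 0) i j c d) k \<le> 0"
proof -
  have "w (rt i) k \<le> 0" "w (rt j) k \<le> 0"
    using neg w ij by (simp_all add: coherent W_root root_rt)
  then show ?thesis
    using cd w by (simp add: comb_def W_lc W_zero) (simp add: lc_def add_nonpos_nonpos mult_nonneg_nonpos)
qed

lemma neg_comb_root:
  assumes "w \<in> W" "i \<le> n" "j \<le> n" "\<not> pos (w (rt i))" "\<not> pos (w (rt j))"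
    "c \<ge> 0" "d \<ge> 0" "root (comb (\<lambda>_. 0) i j c d)"
  shows "\<not> pos (w (comb (\<lambda>_. 0) i j c d))"
  using neg_comb[OF assms(1-7)] not_pos_if W_root[OF assms(1,8)] by blast

text \<open>With four laces the span of \<open>\<alpha>\<^sub>i\<close>, \<open>\<alpha>\<^sub>j\<close> contains a positive multiple of \<open>\<delta>\<close>, which the Weyl
  group fixes, so that not both simple roots can become negative.\<close>

lemma laces_le_3:
  assumes w: "w \<in> W" and ij: "i \<le> n" "j \<le> n" "i \<noteq> j"
    and neg: "\<not> pos (w (rt i))" "\<not> pos (w (rt j))"
  shows "A i j * A j i < 4"
proof (rule ccontr)
  assume 4: "\<not> A i j * A j i < 4"
  \<comment> \<open>This is the vector 2 \<alpha>_j - a_{ij} \<alpha>_i, orthogonal to \<alpha>_i,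
    of norm 2 e_j (4 - a_{ij} a_{ji}); from four laces on that norm is not positive.\<close>
  define x where "x = comb (\<lambda>_. 0) i j (- of_int (A i j)) 2"
  have c: "- A i j \<ge> 0" using offdiag ij by simp
  have "real_of_int (e i) * of_int (A i j) = of_int (e j) * of_int (A j i)"
    using sym[OF ij(1,2)] by (metis of_int_mult)
  then have "B x x = 2 * of_int (e j * (4 - A i j * A j i))"
    using ij unfolding x_def comb_def
    by (simp add: lin B_rt B_rt_left pr_rt diag B_zero_vec pr_zero algebra_simps)
  moreover have "e j * (4 - A i j * A j i) \<le> 0" using 4 e_pos[OF ij(2)] by (simp add: mult_nonneg_nonpos)
  ultimately have "B x x = 0" using B_nonneg[of x] by linarith
  then obtain q where q: "\<forall>k\<le>n. x k = q * \<delta> k" using B_zero by blast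
  have xk: "x k = 0" if "k > n" for k using that ij by (simp add: x_def comb_def lc_def rt_apply)
  have x: "x = lc (\<lambda>_. 0) q \<delta>"
    using q xk by (auto simp: fun_eq_iff lc_def delta_apply)
  have "x j = 2" using ij by (simp add: x_def comb_def lc_def rt_apply)
  then have "q > 0" using q ij delta_pos[OF ij(2)] by (metis zero_less_mult_pos2 zero_less_numeral)
  then have "w x j > 0" unfolding x W_lc[OF w] W_delta[OF w] W_zero[OF w] using delta_pos[OF ij(2)] by (simp add: lc_def)
  moreover have "w x j \<le> 0" unfolding x_def using c by (intro neg_comb w ij neg) auto
  ultimately show False by simp
qed

fun alt :: "nat \<Rightarrow> nat \<Rightarrow> nat \<Rightarrow> nat list" where
  "alt i j 0 = []"
| "alt i j (Suc m) = i # alt j i m"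

lemma alternating_alt: "alternating i j m = map (\<lambda>j. (Gen_T j, True)) (alt i j m)"
  by (induction m arbitrary: i j) auto

lemma laces_cases:
  assumes "i \<le> n" "j \<le> n" "i \<noteq> j" "A i j * A j i < 4"
  shows "\<exists>m. (A i j * A j i, m) \<in> braid_lengths \<and>
    ((A i j = 0 \<and> A j i = 0 \<and> m = 2) \<or> (A i j = -1 \<and> A j i = -1 \<and> m = 3) \<or>
     (A i j = -1 \<and> A j i = -2 \<and> m = 4) \<or> (A i j = -2 \<and> A j i = -1 \<and> m = 4) \<or>
     (A i j = -1 \<and> A j i = -3 \<and> m = 6) \<or> (A i j = -3 \<and> A j i = -1 \<and> m = 6))"
proof -
  have le: "A i j \<le> 0" "A j i \<le> 0" using offdiag assms by auto
  show ?thesis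
  proof (cases "A i j = 0")
    case True then show ?thesis using zero_iff assms by (auto simp: braid_lengths_def)
  next
    case False
    then have "A j i \<noteq> 0" using zero_iff assms by blast
    then have neg: "A i j \<le> -1" "A j i \<le> -1" using False le by linarith+
    have "A i j > -4"
    proof (rule ccontr)
      assume "\<not> A i j > -4"
      then have "(- A i j) * (- A j i) \<ge> 4 * 1" using neg by (intro mult_mono) auto
      then show False using assms(4) by simp
    qed
    moreover have "A j i > -4"
    proof (rule ccontr)
      assume "\<not> A j i > -4"
      then have "(- A i j) * (- A j i) \<ge> 1 * 4" using neg by (intro mult_mono) auto
      then show False using assms(4) by simp
    qed
    ultimately have "A i j = -1 \<or> A i j = -2 \<or> A i j = -3" "A j i = -1 \<or> A j i = -2 \<or> A j i = -3"
      using neg by linarith+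
    then show ?thesis using assms(4) by (auto simp: braid_lengths_def)
  qed
qed

lemma alt_num:
  "alt i j 2 = [i, j]" "alt i j 3 = [i, j, i]" "alt i j 4 = [i, j, i, j]" "alt i j 6 = [i, j, i, j, i, j]"
  by (simp_all add: numeral_eq_Suc)

lemma set_alt: "set (alt i j m) \<subseteq> {i, j}"
  by (induction m arbitrary: i j) auto

text \<open>The inversions of an alternating word in i and j are nonnegative combinations of
  \<alpha>_i and \<alpha>_j, so the inverse of w makes all of them negative as soon as it does so
  with both simple roots. Hence w begins with the longest element of the dihedral group, in either
  spelling.\<close>

lemma common_descent:
  assumes w: "w \<in> W" and ij: "i \<le> n" "j \<le> n" "i \<noteq> j"
    and neg: "\<not> pos (iv w (rt i))" "\<not> pos (iv w (rt j))"
  shows "\<exists>m z. m > 0 \<and> (A i j * A j i, m) \<in> braid_lengths \<and> red w (alt i j m @ z) \<and> red w (alt j i m @ z)"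
proof -
  have W: "iv w \<in> W" using w by (rule W_inv)
  have lt: "A i j * A j i < 4" using laces_le_3[OF W ij neg] .
  obtain m where m: "(A i j * A j i, m) \<in> braid_lengths" and
    cases: "(A i j = 0 \<and> A j i = 0 \<and> m = 2) \<or> (A i j = -1 \<and> A j i = -1 \<and> m = 3) \<or>
     (A i j = -1 \<and> A j i = -2 \<and> m = 4) \<or> (A i j = -2 \<and> A j i = -1 \<and> m = 4) \<or>
     (A i j = -1 \<and> A j i = -3 \<and> m = 6) \<or> (A i j = -3 \<and> A j i = -1 \<and> m = 6)"
    using laces_cases[OF ij lt] by blast
  have set: "set (alt i j m) \<subseteq> {..n}" using set_alt[of i j m] ij by auto
  have "\<forall>x\<in>set (invs (alt i j m)). \<exists>c d. c \<ge> 0 \<and> d \<ge> 0 \<and> x = comb (\<lambda>_. 0) i j c d"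
    using cases
    by (elim disjE conjE)
       (simp_all add: alt_num rt_comb[where i = i and j = j] s_comb[OF ij(1,2)] pr_zero combI)
  then have "\<forall>x\<in>set (invs (alt i j m)). \<not> pos (iv w x)"
    using neg_comb_root[OF W ij(1,2) neg] root_invs[OF set] by metis
  then obtain z where z: "red w (alt i j m @ z)" using red_prefix[OF w set] by blast
  \<comment> \<open>Any x is taken as the base point with coordinates (0, 0), and both words are
    evaluated in the plane through it.\<close>
  have "ev (alt i j m) x = ev (alt j i m) x" for x
    using cases
    by (subst (1 2) comb_0[of x i j, symmetric]) 
       (elim disjE conjE; simp add: alt_num ev_Cons ev_Nil s_comb[OF ij(1,2)])
  then have "ev (alt i j m) = ev (alt j i m)" by blast
  moreover have "length (alt i j m) = length (alt j i m)" for m by (induction m arbitrary: i j) auto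
  ultimately have "red w (alt j i m @ z)" using z set_alt[of j i m] ij by (auto simp: red_iff ev_append)
  moreover have "m > 0" using cases by auto
  ultimately show ?thesis using m z by blast
qed

end

section \<open>Matsumoto's theorem\<close>

context group
begin

lemma inv_mult_cancel [simp]:
  "x \<in> carrier G \<Longrightarrow> y \<in> carrier G \<Longrightarrow> inv x \<otimes> (x \<otimes> y) = y"
  "x \<in> carrier G \<Longrightarrow> y \<in> carrier G \<Longrightarrow> x \<otimes> (inv x \<otimes> y) = y"
  by (simp_all add: m_assoc[symmetric])

text \<open>Membership in the carrier is included so that the closure rules chain without side
  conditions.\<close>

definition commute :: "'a \<Rightarrow> 'a \<Rightarrow> bool" where
  "commute x y \<longleftrightarrow> x \<in> carrier G \<and> y \<in> carrier G \<and> x \<otimes> y = y \<otimes> x"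

lemma commute_sym: "commute x y \<Longrightarrow> commute y x"
  by (simp add: commute_def)

lemma commute_one: "x \<in> carrier G \<Longrightarrow> commute x \<one>"
  by (simp add: commute_def)

lemma commute_self: "x \<in> carrier G \<Longrightarrow> commute x x"
  by (simp add: commute_def)

lemma commute_mult: "commute x y \<Longrightarrow> commute x z \<Longrightarrow> commute x (y \<otimes> z)"
proof -
  assume xy: "commute x y" and xz: "commute x z"
  then have c: "x \<in> carrier G" "y \<in> carrier G" "z \<in> carrier G" by (auto simp: commute_def)
  have "x \<otimes> (y \<otimes> z) = (y \<otimes> x) \<otimes> z" using xy c by (simp add: commute_def m_assoc[symmetric])
  also have "\<dots> = (y \<otimes> z) \<otimes> x" using xz c by (simp add: commute_def m_assoc)
  finally show ?thesis using c by (simp add: commute_def)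
qed

lemma commute_inv: "commute x y \<Longrightarrow> commute x (inv y)"
proof -
  assume xy: "commute x y"
  then have c: "x \<in> carrier G" "y \<in> carrier G" by (auto simp: commute_def)
  have "x = inv y \<otimes> (x \<otimes> y)" using xy c by (simp add: commute_def)
  then have "x \<otimes> inv y = inv y \<otimes> x" using c by (metis inv_closed m_closed inv_solve_right' m_assoc)
  then show ?thesis using c by (simp add: commute_def)
qed

lemma commute_inv_left: "commute y x \<Longrightarrow> commute (inv y) x"
  using commute_inv commute_sym by blast

lemma commute_eq: "commute x y \<Longrightarrow> x \<otimes> y = y \<otimes> x"
  and commute_eq': "commute x y \<Longrightarrow> z \<in> carrier G \<Longrightarrow> x \<otimes> (y \<otimes> z) = y \<otimes> (x \<otimes> z)"
  by (auto simp: commute_def m_assoc[symmetric])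

lemma commuteI: "x \<in> carrier G \<Longrightarrow> y \<in> carrier G \<Longrightarrow> x \<otimes> y = y \<otimes> x \<Longrightarrow> commute x y"
  by (simp add: commute_def)

end

text \<open>Only the braid relations are assumed, so what follows holds in any group receiving a
  homomorphism from the affine Artin group.\<close>

locale artin_rep = affine_datum n A a e + group G
  for n A a e and G :: "('g, 'm) monoid_scheme" (structure) +
  fixes T :: "nat \<Rightarrow> 'g"
  assumes T_closed [simp, intro]: "i \<le> n \<Longrightarrow> T i \<in> carrier G"
    and T_braid: "i \<le> n \<Longrightarrow> j \<le> n \<Longrightarrow> i \<noteq> j \<Longrightarrow> (A i j * A j i, m) \<in> braid_lengths \<Longrightarrow>
      foldr (\<lambda>j g. T j \<otimes> g) (alt i j m) \<one> = foldr (\<lambda>j g. T j \<otimes> g) (alt j i m) \<one>"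
begin

definition tw :: "nat list \<Rightarrow> 'g" where
  "tw js = foldr (\<lambda>j g. T j \<otimes> g) js \<one>"

lemma tw_Nil [simp]: "tw [] = \<one>" and tw_Cons [simp]: "tw (j # js) = T j \<otimes> tw js"
  by (simp_all add: tw_def)

lemma tw_closed: "set js \<subseteq> {..n} \<Longrightarrow> tw js \<in> carrier G"
  by (induction js) auto

lemma tw_append: "set js \<subseteq> {..n} \<Longrightarrow> set ks \<subseteq> {..n} \<Longrightarrow> tw (js @ ks) = tw js \<otimes> tw ks"
  by (induction js) (auto simp: tw_closed m_assoc)

text \<open>Induction on the length settles two reduced words with the same first letter. Otherwise
  both first letters are descents, and the words are compared through the two reduced words of
  \<open>common_descent\<close>, which differ by one braid relation.\<close>

lemma matsumoto: "red w js \<Longrightarrow> red w ks \<Longrightarrow> tw js = tw ks"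
proof (induction "length js" arbitrary: w js ks)
  case 0
  then show ?case by (auto simp: red_iff)
next
  case (Suc l)
  obtain i u where js: "js = i # u" using Suc by (cases js) auto
  have "length ks = length js" using Suc.prems by (simp add: red_iff)
  then obtain j v where ks: "ks = j # v" using js by (cases ks) auto
  note I = red_Cons[OF Suc.prems(1)[unfolded js]] and J = red_Cons[OF Suc.prems(2)[unfolded ks]]
  have step: "tw (k # x) = tw (k # y)" if "red w (k # x)" "red w (k # y)" for k x y
  proof -
    have "length x = l" using that(1) Suc.prems(1) Suc.hyps(2) by (simp add: red_iff)
    then have "tw x = tw y" using Suc.hyps(1)[of x "s k \<circ> w" y] red_Cons(3)[OF that(1)] red_Cons(3)[OF that(2)] by simp
    then show ?thesis by simp
  qed
  show ?case
  proof (cases "i = j")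
    case True then show ?thesis using step Suc.prems js ks by blast
  next
    case False
    obtain m z where m: "m > 0" "(A i j * A j i, m) \<in> braid_lengths"
      and z: "red w (alt i j m @ z)" "red w (alt j i m @ z)"
      using common_descent[OF I(2,1) J(1) False I(4) J(4)] by blast
    obtain m' where m': "m = Suc m'" using m(1) by (cases m) auto
    have sub: "set (alt i j m) \<subseteq> {..n}" "set (alt j i m) \<subseteq> {..n}" "set z \<subseteq> {..n}"
      using z by (auto simp: red_iff)
    have "tw js = tw (alt i j m @ z)"
      unfolding js m' alt.simps append_Cons by (rule step) (use Suc.prems z js m' in auto)
    also have "\<dots> = tw (alt j i m @ z)"
      using T_braid[OF I(1) J(1) False m(2)] sub by (simp add: tw_append tw_def[symmetric])
    also have "\<dots> = tw ks"
      unfolding ks m' alt.simps append_Cons by (rule step) (use Suc.prems z ks m' in auto)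
    finally show ?thesis .
  qed
qed

definition Tw :: "(vec \<Rightarrow> vec) \<Rightarrow> 'g" where
  "Tw w = tw (SOME js. red w js)"

lemma Tw_red: "red w js \<Longrightarrow> Tw w = tw js"
  unfolding Tw_def using matsumoto someI[of "red w"] by blast

lemma Tw_closed [simp, intro]: "w \<in> W \<Longrightarrow> Tw w \<in> carrier G"
  using red_ex[of w] Tw_red[of w] by (auto simp: red_iff tw_closed)

lemma Tw_id: "Tw id = \<one>"
  using Tw_red[of id "[]"] by (simp add: red_Nil)

lemma Tw_left_neg:
  assumes "w \<in> W" "i \<le> n" "\<not> pos (iv w (rt i))"
  shows "Tw w = T i \<otimes> Tw (s i \<circ> w)"
proof -
  obtain u where u: "red (s i \<circ> w) u" using red_ex[of "s i \<circ> w"] assms by (auto simp: W_comp W_s)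
  show ?thesis using Tw_red[OF u] Tw_red[OF red_Cons_intro[OF assms u]] by simp
qed

lemma Tw_left_pos:
  assumes "w \<in> W" "i \<le> n" "pos (iv w (rt i))"
  shows "Tw (s i \<circ> w) = T i \<otimes> Tw w"
proof -
  have "\<not> pos (iv (s i \<circ> w) (rt i))"
    using assms pos_uminus[of "iv w (rt i)"]
    by (simp add: inv_s_comp s_rt W_uminus W_inv W_root root_rt)
  from Tw_left_neg[OF _ assms(2) this] assms show ?thesis
    by (simp add: W_comp W_s s_s_comp)
qed

lemma Tw_s: "i \<le> n \<Longrightarrow> Tw (s i) = T i"
  using Tw_left_pos[OF W_id, of i] by (simp add: Tw_id pos_rt)

lemma Tw_right_neg:
  assumes "w \<in> W" "i \<le> n" "\<not> pos (w (rt i))"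
  shows "Tw w = Tw (w \<circ> s i) \<otimes> T i"
proof -
  have ws: "w \<circ> s i \<in> W" using assms by (simp add: W_comp W_s)
  obtain u where u: "red (w \<circ> s i) u" using red_ex[OF ws] by blast
  have sub: "set u \<subseteq> {..n}" using u by (simp add: red_iff)
  have ivws: "iv (w \<circ> s i) = s i \<circ> iv w" using assms by (simp add: inv_comp_W W_s inv_s)
  have "len (iv w) = Suc (len (s i \<circ> iv w))"
    using assms by (intro len_left_neg) (simp_all add: W_inv inv_inv_W)
  then have "len w = Suc (len (w \<circ> s i))"
    using len_inv[OF assms(1)] len_inv[OF ws] by (simp add: ivws)
  then have "red w (u @ [i])"
    using u assms by (simp add: red_iff ev_append ev_Cons ev_Nil comp_assoc s_s_comp)
  then show ?thesis using Tw_red[OF u] Tw_red[of w "u @ [i]"] assms sub by (simp add: tw_append)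
qed

lemma Tw_right_pos:
  assumes "w \<in> W" "i \<le> n" "pos (w (rt i))"
  shows "Tw (w \<circ> s i) = Tw w \<otimes> T i"
proof -
  have "\<not> pos ((w \<circ> s i) (rt i))"
    using assms pos_uminus[of "w (rt i)"] by (simp add: s_rt W_uminus W_root root_rt)
  from Tw_right_neg[of "w \<circ> s i", OF _ assms(2) this] assms show ?thesis
    by (simp add: W_comp W_s s_s_comp comp_assoc)
qed

text \<open>The hypothesis on roots amounts to \<open>l(u v) = l(u) + l(v)\<close>.\<close>

lemma Tw_mult:
  assumes "v \<in> W" "u \<in> W" "\<And>x. root x \<Longrightarrow> pos x \<Longrightarrow> \<not> pos (v x) \<Longrightarrow> \<not> pos (u (v x))"
  shows "Tw (u \<circ> v) = Tw u \<otimes> Tw v"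
  using assms
proof (induction "len v" arbitrary: u v)
  case 0
  obtain js where "red v js" using 0 red_ex by blast
  then have v: "v = id" using 0 by (auto simp: red_iff ev_Nil)
  show ?case unfolding v Tw_id comp_id using 0(3) by simp
next
  case (Suc l)
  obtain js where js: "red v js" using Suc red_ex by blast
  then obtain j v0 where "js = j # v0" using Suc by (cases js) (auto simp: red_iff)
  note J = red_Cons[OF js[unfolded this]]
  define v' where "v' = s j \<circ> v"
  have v'W: "v' \<in> W" unfolding v'_def by (intro W_comp W_s J(1,2))
  have v: "v = s j \<circ> v'" by (simp only: v'_def s_s_comp(2)[OF J(1)])
  have l: "len v' = l" using len_left_neg[OF J(2,1,4)] Suc.hyps(2) by (simp add: v'_def)
  note neg = J(4)
  have rj: "root (iv v (rt j))" using J(1,2) by (simp add: W_root W_inv root_rt)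
  \<comment> \<open>This positive root is sent by v to -\<alpha>_j. The hypothesis at this root says
    that u keeps \<alpha>_j positive, so that the letter j can move from v to u.\<close>
  define \<beta> where "\<beta> = (\<lambda>k. - iv v (rt j) k)"
  have b: "root \<beta>" "pos \<beta>" using rj neg by (simp_all add: \<beta>_def root_uminus pos_uminus)
  have vb: "v \<beta> = (\<lambda>k. - rt j k)" unfolding \<beta>_def using J(1,2) by (simp add: W_uminus W_inv_apply)
  have "\<not> pos (v \<beta>)" using pos_uminus[OF root_rt[OF J(1)]] pos_rt by (simp add: vb)
  then have "\<not> pos (u (v \<beta>))" using Suc.prems(3) b by blast
  then have uj: "pos (u (rt j))"
    using Suc.prems(2) J(1) by (simp add: vb W_uminus pos_uminus W_root root_rt)
  have "Tw ((u \<circ> s j) \<circ> v') = Tw (u \<circ> s j) \<otimes> Tw v'"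
  proof (rule Suc.hyps(1))
    show "l = len v'" "v' \<in> W" using l v'W by auto
    show "u \<circ> s j \<in> W" using Suc.prems J(1) by (simp add: W_comp W_s)
    fix x assume x: "root x" "pos x" "\<not> pos (v' x)"
    have vx: "v x = s j (v' x)" by (simp add: v)
    have "\<not> pos (v x)"
    proof
      assume p: "pos (v x)"
      have "s j (v x) = v' x" by (simp add: vx s_s J(1))
      then have "v x = rt j"
        using s_not_pos_imp[of "v x" j] x p J(1,2) by (simp add: W_root)
      then have "x = iv v (rt j)" using J(2) by (metis W_inv_apply(1))
      then show False using neg x by simp
    qed
    then have "\<not> pos (u (v x))" using Suc.prems(3) x by blast
    then show "\<not> pos ((u \<circ> s j) (v' x))" by (simp add: vx)
  qed
  moreover have "(u \<circ> s j) \<circ> v' = u \<circ> v" by (simp add: v comp_assoc)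
  moreover have "Tw v = T j \<otimes> Tw v'" using Tw_left_neg[OF J(2,1,4)] by (simp add: v'_def)
  moreover have "Tw (u \<circ> s j) = Tw u \<otimes> T j" using Tw_right_pos[OF Suc.prems(2) J(1) uj] .
  ultimately show ?case using Suc.prems v'W J(1) by (simp add: m_assoc)
qed

end

section \<open>Short roots and translations\<close>

context affine_datum
begin

definition \<theta> :: vec where "\<theta> = lc \<delta> (-1) (rt 0)"

text \<open>For (\<gamma>, \<gamma>) = 2 the coroot of \<gamma> is \<gamma> itself, and this is the
  reflection in \<gamma>.\<close>

definition sref :: "vec \<Rightarrow> vec \<Rightarrow> vec" where
  "sref \<gamma> x = lc x (- B x \<gamma>) \<gamma>"

text \<open>The norm of \<alpha>_0 is the smallest possible norm of a root. In this norm integrality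
  with respect to the coroots follows from integrality, so membership in the root lattice is
  enough.\<close>

definition short :: "vec \<Rightarrow> bool" where
  "short \<gamma> \<longleftrightarrow> \<gamma> \<in> Q \<and> B \<gamma> \<gamma> = 2"

text \<open>The finite Weyl group, recognized inside \<open>W\<close> by its action on the affine
  coordinate; \<open>W0_red\<close> recovers words in s_1, ..., s_n.\<close>

definition W0 :: "(vec \<Rightarrow> vec) set" where
  "W0 = {w \<in> W. \<forall>x. w x 0 = x 0}"

definition lattice_closed :: "vec set \<Rightarrow> bool" where
  "lattice_closed M \<longleftrightarrow> (\<lambda>_. 0) \<in> M \<and> (\<forall>x\<in>M. \<forall>y\<in>M. lc x 1 y \<in> M \<and> lc x (-1) y \<in> M)"

lemma Q_lc: "x \<in> Q \<Longrightarrow> y \<in> Q \<Longrightarrow> c \<in> \<int> \<Longrightarrow> lc x c y \<in> Q"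
  by (auto simp: finite_root_lattice_def lc_def)

lemma Q_zero: "(\<lambda>_. 0) \<in> Q"
  by (simp add: finite_root_lattice_def)

lemma Q_rt: "j \<in> {1..n} \<Longrightarrow> rt j \<in> Q"
  by (auto simp: finite_root_lattice_def rt_apply)

lemma Q_D: "x \<in> Q \<Longrightarrow> x k \<in> \<int>" "x \<in> Q \<Longrightarrow> x 0 = 0" "x \<in> Q \<Longrightarrow> k > n \<Longrightarrow> x k = 0"
  by (auto simp: finite_root_lattice_def)

lemma Q_pr: "x \<in> Q \<Longrightarrow> pr j x \<in> \<int>"
  by (simp add: pr_Ints Q_D)

lemma Q_s: "x \<in> Q \<Longrightarrow> j \<in> {1..n} \<Longrightarrow> s j x \<in> Q"
  by (simp add: s_eq Q_lc Q_pr Q_rt del: atLeastAtMost_iff) (simp add: s_eq Q_lc Q_pr Q_rt)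

lemma Q_uminus: "x \<in> Q \<Longrightarrow> (\<lambda>k. - x k) \<in> Q"
  by (auto simp: finite_root_lattice_def)

lemma theta_apply: "\<theta> k = (if k \<in> {1..n} then of_int (a k) else 0)"
  by (auto simp: \<theta>_def lc_def delta_apply rt_apply a_0)

lemma Q_theta: "\<theta> \<in> Q"
  by (auto simp: finite_root_lattice_def theta_apply)

lemma pr_theta: "j \<le> n \<Longrightarrow> pr j \<theta> = - of_int (A j 0)"
  by (simp add: \<theta>_def pr_lc pr_delta pr_rt)

lemma B_theta: "B x \<theta> = - pr 0 x"
  by (simp add: \<theta>_def lin B_delta B_rt e_0)

lemma short_theta: "short \<theta>"
  by (simp add: short_def Q_theta B_theta pr_theta diag)

lemma short_root_of: "short x \<Longrightarrow> root_of 0 x"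
  by (auto simp: short_def root_of_def integral_for_def Q_D e_0)

lemma short_root: "short x \<Longrightarrow> root x"
  using short_root_of root_def by blast

lemma short_s: "short x \<Longrightarrow> j \<in> {1..n} \<Longrightarrow> short (s j x)"
  by (auto simp: short_def Q_s B_s)

lemma short_rt: "short (rt k) \<Longrightarrow> k \<in> {1..n} \<Longrightarrow> e k = 1"
  by (simp add: short_def B_rt pr_rt diag)

lemma lattice_closed_mult:
  assumes "lattice_closed M" "x \<in> M" "y \<in> M" "c \<in> \<int>"
  shows "lc x c y \<in> M"
proof -
  obtain z where z: "c = of_int z" using assms by (metis Ints_cases)
  show ?thesis unfolding z
  proof (induction z rule: int_induct[where k = 0])
    case base then show ?case using assms by (simp add: lc_def)
  next
    case (step1 z)
    have "lc x (of_int (z + 1)) y = lc (lc x (of_int z) y) 1 y" by (simp add: lc_def algebra_simps)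
    then show ?case using step1 assms by (simp add: lattice_closed_def)
  next
    case (step2 z)
    have "lc x (of_int (z - 1)) y = lc (lc x (of_int z) y) (-1) y" by (simp add: lc_def algebra_simps)
    then show ?case using step2 assms by (simp add: lattice_closed_def)
  qed
qed

text \<open>The bound m permits partial support: below, all simple roots except \<alpha>_n are
  sometimes known to lie in M before \<alpha>_n is.\<close>

lemma lattice_gen:
  assumes "lattice_closed M" "\<And>j. j \<in> {1..m} \<Longrightarrow> rt j \<in> M" "\<beta> \<in> Q" "\<And>k. k > m \<Longrightarrow> \<beta> k = 0"
  shows "\<beta> \<in> M"
  using assms(2-)
proof (induction m arbitrary: \<beta>)
  case 0
  then have "\<beta> = (\<lambda>_. 0)" by (auto simp: fun_eq_iff) (metis Q_D(2) gr0I)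
  then show ?case using assms(1) by (simp add: lattice_closed_def)
next
  case (Suc m)
  define \<gamma> where "\<gamma> = lc \<beta> (- \<beta> (Suc m)) (rt (Suc m))"
  show ?case
  proof (cases "Suc m \<le> n")
    case True
    have gk: "\<gamma> k = 0" if "k > m" for k
      using that Suc.prems(3)[of k] by (cases "k = Suc m") (simp_all add: \<gamma>_def lc_def rt_apply)
    have "\<gamma> \<in> M" 
      by (rule Suc.IH) (use Suc.prems True gk in \<open>auto simp: \<gamma>_def Q_lc Q_D Q_rt\<close>)
    moreover have "\<beta> = lc \<gamma> (\<beta> (Suc m)) (rt (Suc m))" by (simp add: \<gamma>_def lc_def)
    moreover have "rt (Suc m) \<in> M" using Suc.prems by simp
    ultimately show ?thesis using lattice_closed_mult[OF assms(1)] Suc.prems Q_D by metis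
  next
    case False
    then have "\<beta> k = 0" if "k > m" for k using that Suc.prems Q_D(3)[of \<beta> k] by (cases "k > n") auto
    then show ?thesis using Suc by simp
  qed
qed

text \<open>Otherwise every term \<gamma>_j e_j (\<gamma>, \<alpha>_j^vee) of the norm would be at
  most 0, by integrality of the pairings.\<close>

lemma short_descent:
  assumes "short \<gamma>" "pos \<gamma>"
  shows "\<exists>k\<in>{1..n}. pr k \<gamma> \<ge> 1"
proof (rule ccontr)
  assume *: "\<not> ?thesis"
  have le: "pr k \<gamma> \<le> 0" if "k \<in> {1..n}" for k
  proof -
    obtain z where z: "pr k \<gamma> = of_int z" using Q_pr assms short_def by (metis Ints_cases)
    have "pr k \<gamma> < 1" using * that by force
    then show ?thesis by (simp add: z)
  qed
  have "B \<gamma> \<gamma> \<le> 0"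
    unfolding B_pr_sum
  proof (rule sum_nonpos)
    fix j assume "j \<in> {..n}"
    show "\<gamma> j * of_int (e j) * pr j \<gamma> \<le> 0"
    proof (cases "j = 0")
      case True
      have "\<gamma> 0 = 0" using assms Q_D(2) by (simp add: short_def)
      then show ?thesis using True by simp
    next
      case False
      then have "pr j \<gamma> \<le> 0" using le \<open>j \<in> {..n}\<close> by simp
      moreover have "\<gamma> j \<ge> 0" "e j > 0" using assms e_pos \<open>j \<in> {..n}\<close> by (auto simp: pos_def)
      ultimately show ?thesis by (intro mult_nonneg_nonpos) auto
    qed
  qed
  then show False using assms by (simp add: short_def)
qed

lemma B_bilinear_s: "k \<le> n \<Longrightarrow> B (s k x) y = B x (s k y)"
  using B_s[of k x "s k y"] by (simp add: s_s)

lemma sref_conj: "k \<le> n \<Longrightarrow> sref (s k \<gamma>) = s k \<circ> (sref \<gamma> \<circ> s k)"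
  by (simp add: fun_eq_iff[where f = "sref _"] sref_def s_lc s_s B_bilinear_s)

lemma sref_rt: "k \<le> n \<Longrightarrow> e k = 1 \<Longrightarrow> sref (rt k) = s k"
  by (rule ext) (simp add: sref_def s_eq B_rt)

text \<open>Induction on the height: s_k lowers the sum of coordinates by the pairing with the
  coroot of \<alpha>_k, hence by at least 1. The floor only turns a real sum into a natural
  number.\<close>

lemma short_induct [consumes 2, case_names simple step]:
  assumes "short \<gamma>" "pos \<gamma>"
    and "\<And>k. k \<in> {1..n} \<Longrightarrow> e k = 1 \<Longrightarrow> P (rt k)"
    and "\<And>\<gamma> k. k \<in> {1..n} \<Longrightarrow> short \<gamma> \<Longrightarrow> pos \<gamma> \<Longrightarrow> pr k \<gamma> \<ge> 1 \<Longrightarrow> \<gamma> \<noteq> rt k \<Longrightarrow> short (s k \<gamma>) \<Longrightarrow> pos (s k \<gamma>)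
      \<Longrightarrow> P (s k \<gamma>) \<Longrightarrow> P \<gamma>"
  shows "P \<gamma>"
  using assms(1,2)
proof (induction "nat \<lfloor>\<Sum>k\<le>n. \<gamma> k\<rfloor>" arbitrary: \<gamma> rule: less_induct)
  case less
  obtain k where k: "k \<in> {1..n}" "pr k \<gamma> \<ge> 1" using short_descent less.prems by blast
  then have kn: "k \<le> n" by simp
  show ?case
  proof (cases "\<gamma> = rt k")
    case True then show ?thesis using assms(3) k short_rt less.prems by simp
  next
    case False
    have p: "pos (s k \<gamma>)" using s_not_pos_imp[OF short_root[OF less.prems(1)] less.prems(2) kn] False by blast
    have sh: "short (s k \<gamma>)" using short_s less.prems k by blast
    have "(\<Sum>j\<le>n. s k \<gamma> j) = (\<Sum>j\<le>n. \<gamma> j) - pr k \<gamma> * (\<Sum>j\<le>n. rt k j)"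
      using kn by (simp add: s_eq lc_def sum_subtractf sum_distrib_left)
    also have "(\<Sum>j\<le>n. rt k j) = 1" using kn by (simp add: rt_apply)
    finally have "(\<Sum>j\<le>n. s k \<gamma> j) \<le> (\<Sum>j\<le>n. \<gamma> j) - 1" using k by simp
    moreover have "(\<Sum>j\<le>n. s k \<gamma> j) \<ge> 0" using p by (intro sum_nonneg) (simp add: pos_def)
    ultimately have "nat \<lfloor>\<Sum>j\<le>n. s k \<gamma> j\<rfloor> < nat \<lfloor>\<Sum>j\<le>n. \<gamma> j\<rfloor>" by linarith
    from less.hyps[OF this sh p] show ?thesis using assms(4) k less.prems False sh p by blast
  qed
qed

lemma W0_W: "w \<in> W0 \<Longrightarrow> w \<in> W"
  by (simp add: W0_def)

lemma W0_0: "w \<in> W0 \<Longrightarrow> w x 0 = x 0"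
  by (simp add: W0_def)

lemma W0_s: "k \<in> {1..n} \<Longrightarrow> s k \<in> W0"
  by (auto simp: W0_def W_s s_eq lc_def rt_apply)

lemma W0_comp: "u \<in> W0 \<Longrightarrow> v \<in> W0 \<Longrightarrow> u \<circ> v \<in> W0"
  by (simp add: W0_def W_comp)

lemma W0_inv: "w \<in> W0 \<Longrightarrow> iv w \<in> W0"
  using W0_0[of w "iv w _"] by (auto simp: W0_def W_inv W_inv_apply)

lemma W0_sref: "short \<gamma> \<Longrightarrow> pos \<gamma> \<Longrightarrow> sref \<gamma> \<in> W0"
proof (induction \<gamma> rule: short_induct)
  case (simple k)
  then show ?case using sref_rt[of k] W0_s by simp
next
  case (step \<gamma> k)
  have k: "k \<le> n" using step by simp
  have "sref \<gamma> = s k \<circ> (sref (s k \<gamma>) \<circ> s k)"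
    using sref_conj[OF k, of "s k \<gamma>"] by (simp only: s_s[OF k])
  then show ?case by (simp only:) (intro W0_comp W0_s step)
qed

lemma sref_sref: "short \<gamma> \<Longrightarrow> sref \<gamma> (sref \<gamma> x) = x"
  unfolding sref_def by (simp add: lin short_def) (simp add: lc_def algebra_simps)

lemma iv_sref: "short \<gamma> \<Longrightarrow> iv (sref \<gamma>) = sref \<gamma>"
  by (rule inv_unique_comp) (simp_all add: fun_eq_iff sref_sref)

lemma pos_theta: "pos \<theta>"
  using a_pos by (auto simp: pos_def theta_apply less_imp_le)

text \<open>The inverse of w maps \<alpha>_0 to a root with affine coordinate 1, which is positive,
  so s_0 is not a left descent.\<close>

lemma W0_red_Cons:
  assumes "w \<in> W0" "red w (k # u)"
  shows "k \<in> {1..n}" "s k \<circ> w \<in> W0"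
proof -
  note R = red_Cons[OF assms(2)]
  have "root (iv w (rt 0))" using R by (simp add: W_root W_inv root_rt)
  moreover have "iv w (rt 0) 0 = 1" using W0_0[OF W0_inv[OF assms(1)]] by (simp add: rt_apply)
  ultimately have "pos (iv w (rt 0))" using pos_if_coord[of _ 0] by simp
  then have "k \<noteq> 0" using R(4) by metis
  then show k: "k \<in> {1..n}" using R(1) by simp
  show "s k \<circ> w \<in> W0" using k assms(1) by (intro W0_comp W0_s)
qed

lemma W0_red: "w \<in> W0 \<Longrightarrow> red w js \<Longrightarrow> set js \<subseteq> {1..n}"
proof (induction js arbitrary: w)
  case (Cons k u)
  show ?case using Cons.IH[OF W0_red_Cons(2)[OF Cons.prems] red_Cons(3)[OF Cons.prems(2)]] W0_red_Cons(1)[OF Cons.prems] by simp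
qed simp

section \<open>Translations and the antidominant cone\<close>

lemma trans_comp: "trans (vadd \<mu> \<nu>) = trans \<mu> \<circ> trans \<nu>"
  by (rule ext) (simp add: trans_eq vadd_eq_lc lin B_delta, simp add: lc_def algebra_simps)

lemma trans_zero: "trans (\<lambda>_. 0) = id"
proof
  fix x
  have "B x (\<lambda>_. 0) = 0" by (simp add: B_eq)
  then show "trans (\<lambda>_. 0) x = id x" by (simp add: trans_eq lc_def)
qed

lemma trans_s: "j \<le> n \<Longrightarrow> trans (s j \<mu>) = s j \<circ> (trans \<mu> \<circ> s j)"
  by (simp add: fun_eq_iff[where f = "trans _"] trans_eq s_lc s_s s_delta B_bilinear_s)

lemma trans_theta: "trans (\<lambda>k. - \<theta> k) = sref \<theta> \<circ> s 0"
proof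
  fix x
  have m: "B x (\<lambda>k. - \<theta> k) = - B x \<theta>" by (simp add: B_eq sum_negf)
  have t2: "B \<theta> \<theta> = 2" using short_theta by (simp add: short_def)
  have r: "rt 0 = lc \<delta> (-1) \<theta>" by (simp add: \<theta>_def lc_def)
  show "trans (\<lambda>k. - \<theta> k) x = (sref \<theta> \<circ> s 0) x"
    by (simp add: trans_eq sref_def s_eq m)
       (simp add: r lin B_delta t2 B_theta pr_delta pr_theta diag, simp add: lc_def algebra_simps)
qed

lemma trans_inverse: "trans \<mu> (trans (\<lambda>k. - \<mu> k) x) = x" "trans (\<lambda>k. - \<mu> k) (trans \<mu> x) = x"
proof -
  have *: "trans \<nu> (trans \<mu> x) = x" if "vadd \<nu> \<mu> = (\<lambda>_. 0)" for \<mu> \<nu>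
    using fun_cong[OF trans_comp[of \<nu> \<mu>], of x] unfolding that trans_zero by simp
  show "trans \<mu> (trans (\<lambda>k. - \<mu> k) x) = x" "trans (\<lambda>k. - \<mu> k) (trans \<mu> x) = x"
    by (rule *; simp add: vadd_def)+
qed

lemma iv_trans: "iv (trans \<mu>) = trans (\<lambda>k. - \<mu> k)"
  by (rule inv_unique_comp) (simp_all add: fun_eq_iff trans_inverse)

definition P :: "vec set" where
  "P = {\<mu> \<in> Q. antidominant n A \<mu>}"

lemma P_iff: "\<mu> \<in> P \<longleftrightarrow> \<mu> \<in> Q \<and> (\<forall>i\<in>{1..n}. pr i \<mu> \<le> 0)"
  by (auto simp: P_def antidominant_def form_coroot)

lemma uminus_theta_P: "(\<lambda>l. - \<theta> l) \<in> P"
  unfolding P_iff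
proof (intro conjI ballI Q_uminus Q_theta)
  fix i assume i: "i \<in> {1..n}"
  then have "A i 0 \<le> 0" using offdiag[of i 0] by simp
  then show "pr i (\<lambda>l. - \<theta> l) \<le> 0" using i by (simp add: pr_uminus pr_theta)
qed

lemma P_add: "\<mu> \<in> P \<Longrightarrow> \<nu> \<in> P \<Longrightarrow> vadd \<mu> \<nu> \<in> P"
  by (auto simp: P_iff vadd_eq_lc Q_lc pr_lc add_nonpos_nonpos)

lemma P_B:
  assumes "\<mu> \<in> P" "\<And>k. k \<in> {1..n} \<Longrightarrow> x k \<ge> 0" "x 0 = 0"
  shows "B x \<mu> \<le> 0"
  unfolding B_pr_sum
proof (rule sum_nonpos)
  fix j assume j: "j \<in> {..n}"
  show "x j * of_int (e j) * pr j \<mu> \<le> 0"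
    using assms j e_pos[of j] by (cases "j = 0") (auto simp: P_iff intro!: mult_nonneg_nonpos)
qed

lemma B_fp: "B (fp x) y = B x y"
  by (simp add: fp_def lin B_delta)

text \<open>Since \<delta> is in the radical, only the finite part of x pairs with \<mu>, and
  antidominance reverses its sign.\<close>

lemma P_B_pos: "\<mu> \<in> P \<Longrightarrow> root x \<Longrightarrow> pos (fp x) \<Longrightarrow> B x \<mu> \<le> 0"
  using P_B[of \<mu> "fp x"] by (simp add: B_fp pos_def fp_0)

lemma P_B_neg: "\<mu> \<in> P \<Longrightarrow> root x \<Longrightarrow> \<not> pos (fp x) \<Longrightarrow> B x \<mu> \<ge> 0"
proof -
  assume "\<mu> \<in> P" "root x" "\<not> pos (fp x)"
  then have "B (\<lambda>k. - fp x k) \<mu> \<le> 0"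
    using coherent[OF root_fp] by (intro P_B) (auto simp: fp_0)
  moreover have "B (\<lambda>k. - fp x k) \<mu> = - B x \<mu>" by (simp add: B_fp[of x, symmetric]) (simp add: B_eq sum_negf)
  ultimately show ?thesis by simp
qed

lemma trans_pos: "pos x \<Longrightarrow> B x \<mu> \<le> 0 \<Longrightarrow> pos (trans \<mu> x)"
proof -
  assume p: "pos x" "B x \<mu> \<le> 0"
  have "B x \<mu> * \<delta> k \<le> 0" for k
    using p a_pos by (intro mult_nonpos_nonneg) (auto simp: delta_apply less_imp_le)
  then show ?thesis using p by (simp add: pos_def trans_eq lc_def) (meson order_trans)
qed

lemma trans_neg: "root x \<Longrightarrow> \<mu> \<in> Q \<Longrightarrow> \<not> pos x \<Longrightarrow> B x \<mu> \<ge> 0 \<Longrightarrow> \<not> pos (trans \<mu> x)"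
proof (rule not_pos_if)
  assume r: "root x" "\<mu> \<in> Q" "\<not> pos x" "B x \<mu> \<ge> 0"
  then show "root (trans \<mu> x)" by (simp add: root_trans)
  fix k
  have "x k \<le> 0" using coherent r by blast
  moreover have "\<delta> k \<ge> 0" using a_pos by (auto simp: delta_apply less_imp_le)
  ultimately show "trans \<mu> x k \<le> 0" using r by (simp add: trans_eq lc_def) (smt (verit) mult_nonneg_nonneg)
qed

lemma Q_ge1: "x \<in> Q \<Longrightarrow> pr k x > 0 \<Longrightarrow> pr k x \<ge> 1"
  using Q_pr[of x k] by (auto elim!: Ints_cases)

lemma irrD: "I \<subseteq> {..n} \<Longrightarrow> I \<noteq> {} \<Longrightarrow> I \<noteq> {..n} \<Longrightarrow> \<exists>i\<in>I. \<exists>j\<in>{..n} - I. A i j \<noteq> 0"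
  using irr by (simp add: irreducible_cartan_def)

text \<open>A dominant lattice vector with as many positive pairings as possible is regular. The
  vector \<theta> starts the comparison, being positive at the neighbours of the affine node. If
  some pairings vanished, connectivity would give an edge from a positive node k to a zero node j,
  and 3x - \<alpha>_k would be positive at j as well.\<close>

lemma regular_ex: "\<exists>\<rho>\<in>P. \<forall>k\<in>{1..n}. pr k \<rho> \<le> -1"
proof -
  define dom where "dom x \<longleftrightarrow> x \<in> Q \<and> (\<forall>k\<in>{1..n}. pr k x \<ge> 0 \<and> (A k 0 \<noteq> 0 \<longrightarrow> pr k x > 0))" for x
  define K where "K x = {k\<in>{1..n}. pr k x > 0}" for x
  have "dom \<theta>"
    using offdiag[of _ 0] by (auto simp: dom_def Q_theta pr_theta) (metis Suc_le_eq order_le_less)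
  have "\<exists>x. dom x \<and> (\<forall>y. dom y \<longrightarrow> card (K y) \<le> card (K x))"
  proof (rule ex_has_greatest_nat[where b = "Suc n"])
    show "dom \<theta>" by fact
    show "\<forall>y. dom y \<longrightarrow> card (K y) < Suc n"
    proof (intro allI impI)
      fix y
      have "card (K y) \<le> card {1..n}" by (rule card_mono) (auto simp: K_def)
      then show "card (K y) < Suc n" by simp
    qed
  qed
  then obtain x where x: "dom x" and max: "\<And>y. dom y \<Longrightarrow> card (K y) \<le> card (K x)" by blast
  have "K x = {1..n}"
  proof (rule ccontr)
    assume ne: "K x \<noteq> {1..n}"
    have "insert 0 (K x) \<subseteq> {..n}" by (auto simp: K_def)
    moreover have "insert 0 (K x) \<noteq> {..n}"
    proof
      assume eq: "insert 0 (K x) = {..n}"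
      have "{1..n} \<subseteq> K x"
      proof
        fix k assume "k \<in> {1..n}"
        then have "k \<in> insert 0 (K x)" "k \<noteq> 0" unfolding eq by auto
        then show "k \<in> K x" by simp
      qed
      then show False using ne unfolding K_def by blast
    qed
    ultimately obtain k j where kj: "k \<in> insert 0 (K x)" "j \<in> {..n} - insert 0 (K x)" "A k j \<noteq> 0"
      using irrD[of "insert 0 (K x)"] by blast
    have j: "j \<in> {1..n}" "pr j x \<le> 0" "j \<notin> K x" using kj by (auto simp: K_def Suc_le_eq)
    have "k \<noteq> 0"
    proof
      assume "k = 0"
      then have "A j 0 \<noteq> 0" using kj j zero_iff[of 0 j] by simp
      then show False using x j by (auto simp: dom_def)
    qed
    then have k: "k \<in> {1..n}" "pr k x > 0" using kj by (auto simp: K_def)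
    have k1: "pr k x \<ge> 1" using Q_ge1 k(2) x unfolding dom_def by blast
    \<comment> \<open>The factor 3 absorbs the loss at k: there the new pairing is 3p - 2, which is
      at least p because p is an integer and positive.\<close>
    define y where "y = lc (lc x 2 x) (-1) (rt k)"
    have py: "pr l y = 3 * pr l x - of_int (A l k)" for l
      using k by (simp add: y_def pr_lc pr_rt)
    have ge: "pr l y \<ge> pr l x" if "l \<in> {1..n}" for l
    proof (cases "l = k")
      case True then show ?thesis using k k1 by (simp add: py diag)
    next
      case False
      then have "A l k \<le> 0" using offdiag k that by simp
      then have "real_of_int (A l k) \<le> 0" by simp
      moreover have "pr l x \<ge> 0" using x that by (simp add: dom_def)
      ultimately show ?thesis unfolding py by linarith
    qed
    have "y \<in> Q" using x k by (auto simp: y_def dom_def Q_lc Q_rt)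
    have "dom y"
      unfolding dom_def
    proof (intro conjI ballI impI)
      show "y \<in> Q" by fact
      fix l assume l: "l \<in> {1..n}"
      show "pr l y \<ge> 0" using ge[OF l] x l unfolding dom_def by fastforce
      assume "A l 0 \<noteq> 0"
      then have "pr l x > 0" using x l unfolding dom_def by blast
      then show "pr l y > 0" using ge[OF l] by linarith
    qed
    have "A j k \<noteq> 0" using zero_iff kj j k by auto
    moreover have "j \<noteq> k" using j k by auto
    ultimately have "A j k < 0" using offdiag[of j k] j(1) k(1) by simp
    then have "real_of_int (A j k) < 0" by simp
    moreover have "pr j x \<ge> 0" using x j(1) unfolding dom_def by blast
    ultimately have "pr j y > 0" unfolding py by linarith
    moreover have "pr l y > 0" if "l \<in> K x" for l
    proof -
      have "l \<in> {1..n}" "pr l x > 0" using that unfolding K_def by auto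
      then show ?thesis using ge[of l] by linarith
    qed
    ultimately have "insert j (K x) \<subseteq> K y" using j(1) unfolding K_def by blast
    then have "card (insert j (K x)) \<le> card (K y)" by (intro card_mono) (auto simp: K_def)
    then have "Suc (card (K x)) \<le> card (K y)" using j by (simp add: K_def)
    then show False using max[OF \<open>dom y\<close>] by simp
  qed
  have ge1: "pr k x \<ge> 1" if "k \<in> {1..n}" for k
  proof -
    have "k \<in> K x" using that \<open>K x = {1..n}\<close> by blast
    then have "pr k x > 0" by (simp add: K_def)
    then show ?thesis using Q_ge1 x unfolding dom_def by blast
  qed
  define \<rho> where "\<rho> = (\<lambda>l. - x l)"
  have le: "pr k \<rho> \<le> -1" if "k \<in> {1..n}" for k
    using ge1[OF that] by (simp add: \<rho>_def pr_uminus)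
  moreover have "\<rho> \<in> Q" using x unfolding \<rho>_def dom_def by (intro Q_uminus) blast
  moreover have "pr k \<rho> \<le> 0" if "k \<in> {1..n}" for k using le[OF that] by linarith
  ultimately have "\<rho> \<in> P" "\<forall>k\<in>{1..n}. pr k \<rho> \<le> -1" unfolding P_iff by blast+
  then show ?thesis by blast
qed

text \<open>The sum \<rho> + s_i \<rho> is fixed by s_i, hence orthogonal to \<alpha>_i; elsewhere
  the term -a_{ki} (\<rho>, \<alpha>_i^vee) is not positive, so the pairings stay at most
  -1.\<close>

lemma subregular_ex:
  assumes i: "i \<in> {1..n}"
  shows "\<exists>\<sigma>\<in>P. pr i \<sigma> = 0 \<and> (\<forall>k\<in>{1..n}. k \<noteq> i \<longrightarrow> pr k \<sigma> \<le> -1)"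
proof -
  obtain \<rho> where r: "\<rho> \<in> P" "\<forall>k\<in>{1..n}. pr k \<rho> \<le> -1" using regular_ex by blast
  define \<sigma> where "\<sigma> = vadd \<rho> (s i \<rho>)"
  have p: "pr k \<sigma> = 2 * pr k \<rho> - of_int (A k i) * pr i \<rho>" for k
    using i by (simp add: \<sigma>_def vadd_eq_lc pr_lc s_eq pr_rt)
  have pi: "pr i \<sigma> = 0" using i by (simp add: p diag)
  have le: "pr k \<sigma> \<le> -1" if "k \<in> {1..n}" "k \<noteq> i" for k
  proof -
    have "pr i \<rho> \<le> 0" using r(2) i by force
    moreover have "real_of_int (A k i) \<le> 0" using offdiag[of k i] that i by simp
    ultimately have "real_of_int (A k i) * pr i \<rho> \<ge> 0" by (intro mult_nonpos_nonpos)
    moreover have "pr k \<rho> \<le> -1" using r that by blast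
    ultimately show ?thesis unfolding p by linarith
  qed
  have "s i \<rho> \<in> Q" "\<rho> \<in> Q" using r(1) i Q_s unfolding P_iff by blast+
  then have "\<sigma> \<in> Q" by (simp add: \<sigma>_def vadd_eq_lc Q_lc)
  moreover have "pr k \<sigma> \<le> 0" if "k \<in> {1..n}" for k
    using le[OF that] pi by (cases "k = i") auto
  ultimately have "\<sigma> \<in> P" unfolding P_iff by blast
  then show ?thesis using pi le by blast
qed

lemma pr_bound_ex: "\<exists>N::nat. \<forall>k\<in>{1..n}. pr k \<beta> \<le> real N"
proof -
  obtain N where N: "Max ((\<lambda>k. pr k \<beta>) ` {..n}) \<le> real N" using real_arch_simple by blast
  have "pr k \<beta> \<le> real N" if "k \<le> n" for k
    using that N by (intro order_trans[OF _ N] Max_ge) auto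
  then show ?thesis by (intro exI[of _ N]) simp
qed

text \<open>The three ways in which the affine node is joined to the others: \<open>D\<^sub>n\<^sub>+\<^sub>1\<^sup>(\<^sup>2\<^sup>)\<close> is doubly laced at
  the affine node, \<open>A\<^sub>1\<^sup>(\<^sup>1\<^sup>)\<close> is quadruply laced, and all other types with short affine root, except
  \<open>A\<^sub>2\<^sub>n\<^sup>(\<^sup>2\<^sup>)\<close>, are simply laced there.\<close>

definition simply_laced_at_0 :: bool where
  "simply_laced_at_0 \<longleftrightarrow> (\<forall>k\<in>{1..n}. A 0 k = 0 \<or> A 0 k = -1) \<and>
    (\<forall>J. J \<subseteq> {1..n} \<and> (\<forall>k\<in>{1..n}. A k 0 = -1 \<longrightarrow> k \<in> J) \<and>
      (\<forall>i\<in>J. \<forall>j\<in>{1..n}. A j i = -1 \<longrightarrow> j \<in> J) \<longrightarrow> J = {1..n})"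

definition doubly_laced_at_0 :: bool where
  "doubly_laced_at_0 \<longleftrightarrow> n \<ge> 2 \<and> A 0 1 = -2 \<and> A 1 0 = -1 \<and> (\<forall>k\<in>{2..n}. A 0 k = 0) \<and> a n = 1 \<and>
    (\<forall>k. 1 \<le> k \<and> k + 1 < n \<longrightarrow> A (k + 1) k = -1)"

definition quadruply_laced_at_0 :: bool where
  "quadruply_laced_at_0 \<longleftrightarrow> n = 1 \<and> A 0 1 = -2 \<and> A 1 0 = -2"

end

section \<open>Generating the lattice from \<theta>\<close>

locale affine_short = affine_datum +
  assumes n_pos: "n \<ge> 1" and kinds: "simply_laced_at_0 \<or> doubly_laced_at_0 \<or> quadruply_laced_at_0"
begin

text \<open>An entry a_{ji} = -1 is what makes s_j \<alpha>_i = \<alpha>_i + \<alpha>_j. In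
  D_{n+1}^{(2)} the last bond has a_{n,n-1} = -2 and cannot be crossed, but then a_n = 1, and
  \<alpha>_n can be split off from \<theta>.\<close>

lemma reach:
  assumes J: "J \<subseteq> {1..n}" "\<And>k. k \<in> {1..n} \<Longrightarrow> A k 0 = -1 \<Longrightarrow> k \<in> J"
    "\<And>i j. i \<in> J \<Longrightarrow> j \<in> {1..n} \<Longrightarrow> A j i = -1 \<Longrightarrow> j \<in> J"
  shows "J = {1..n} \<or> (a n = 1 \<and> {1..n} - {n} \<subseteq> J)"
  using kinds
proof (elim disjE)
  assume simply_laced_at_0
  then have "J = {1..n}" using J unfolding simply_laced_at_0_def by blast
  then show ?thesis ..
next
  assume k2: doubly_laced_at_0
  have step: "j \<in> J" if "1 \<le> j" "j < n" for j
    using that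
  proof (induction j rule: nat_induct_at_least)
    case base
    then show ?case using J(2)[of 1] k2 by (simp add: doubly_laced_at_0_def)
  next
    case (Suc j)
    then show ?case using J(3)[of j "Suc j"] k2 by (simp add: doubly_laced_at_0_def)
  qed
  have "{1..n} - {n} \<subseteq> J" by (intro subsetI step) auto
  then show ?thesis using k2 by (simp add: doubly_laced_at_0_def)
next
  assume k3: quadruply_laced_at_0
  then have n: "n = 1" and A10: "A 1 0 = -2" by (simp_all add: quadruply_laced_at_0_def)
  have "A 1 0 * a 0 + A 1 1 * a 1 = 0" using null[of 1] n by simp
  then have "a 1 = 1" using A10 diag[of 1] n by (simp add: a_0)
  then show ?thesis using n by simp
qed

lemma lattice_closed_diff: "lattice_closed M \<Longrightarrow> x \<in> M \<Longrightarrow> lc x 1 y \<in> M \<Longrightarrow> y \<in> M"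
proof -
  assume "lattice_closed M" "x \<in> M" "lc x 1 y \<in> M"
  then have "lc (lc x 1 y) (-1) x \<in> M" by (simp add: lattice_closed_def)
  then show ?thesis by (simp add: lc_def)
qed

lemma lattice_closed_uminus: "lattice_closed M \<Longrightarrow> x \<in> M \<Longrightarrow> (\<lambda>k. - x k) \<in> M"
proof -
  assume "lattice_closed M" "x \<in> M"
  then have "lc (\<lambda>_. 0) (-1) x \<in> M" by (simp add: lattice_closed_def)
  then show ?thesis by (simp add: lc_def)
qed

text \<open>The steps allowed here are those that the reflection relations of the double affine
  Artin group can follow.\<close>

lemma lattice_from_theta:
  assumes M: "lattice_closed M" "\<theta> \<in> M"
    and step: "\<And>x j. x \<in> M \<Longrightarrow> x \<in> Q \<Longrightarrow> j \<in> {1..n} \<Longrightarrow> pr j x = -1 \<Longrightarrow> s j x \<in> M"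
  shows "Q \<subseteq> M"
proof -
  define J where "J = {j\<in>{1..n}. rt j \<in> M}"
  note diff = lattice_closed_diff[OF M(1)]
  have "J = {1..n} \<or> (a n = 1 \<and> {1..n} - {n} \<subseteq> J)"
  proof (rule reach)
    show "J \<subseteq> {1..n}" by (auto simp: J_def)
  next
    fix k assume k: "k \<in> {1..n}" "A k 0 = -1"
    have m: "(\<lambda>k. - \<theta> k) \<in> M" "(\<lambda>k. - \<theta> k) \<in> Q" using M lattice_closed_uminus Q_uminus Q_theta by auto
    have p: "pr k (\<lambda>k. - \<theta> k) = -1" using k by (simp add: pr_uminus pr_theta)
    have kn: "k \<le> n" using k by simp
    have "lc (\<lambda>k. - \<theta> k) 1 (rt k) \<in> M" using step[OF m k(1) p] unfolding s_eq[OF kn] p by simp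
    from diff[OF m(1) this] show "k \<in> J" using k(1) by (simp add: J_def)
  next
    fix i j assume ij: "i \<in> J" "j \<in> {1..n}" "A j i = -1"
    then have i: "rt i \<in> M" "i \<in> {1..n}" by (auto simp: J_def)
    then have p: "pr j (rt i) = -1" using ij by (simp add: pr_rt)
    have jn: "j \<le> n" using ij by simp
    have "lc (rt i) 1 (rt j) \<in> M" using step[OF i(1) Q_rt[OF i(2)] ij(2) p] unfolding s_eq[OF jn] p by simp
    from diff[OF i(1) this] show "j \<in> J" using ij(2) by (simp add: J_def)
  qed
  then have "\<forall>j\<in>{1..n}. rt j \<in> M"
  proof
    assume "J = {1..n}" then show ?thesis by (auto simp: J_def)
  next
    assume J: "a n = 1 \<and> {1..n} - {n} \<subseteq> J"
    \<comment> \<open>Because a_n = 1, this vector is supported on the nodes 1, ..., n - 1, whose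
      simple roots are already in M.\<close>
    define \<beta> where "\<beta> = lc \<theta> (-1) (rt n)"
    have "\<beta> \<in> M"
    proof (rule lattice_gen[OF M(1), of "n - 1"])
      show "rt j \<in> M" if "j \<in> {1..n - 1}" for j
      proof -
        have "j \<in> {1..n} - {n}" using that by auto
        then have "j \<in> J" using J by blast
        then show ?thesis by (simp add: J_def)
      qed
      show "\<beta> \<in> Q" using n_pos by (simp add: \<beta>_def Q_lc Q_theta Q_rt)
      show "\<beta> k = 0" if "k > n - 1" for k using that J n_pos by (auto simp: \<beta>_def lc_def theta_apply rt_apply)
    qed
    moreover have "\<theta> = lc \<beta> 1 (rt n)" by (simp add: \<beta>_def lc_def)
    ultimately have "rt n \<in> M" using diff[of \<beta> "rt n"] M(2) by simp
    then show ?thesis using J by (auto simp: J_def)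
  qed
  then show ?thesis using lattice_gen[OF M(1), of n] Q_D(3) by blast
qed

text \<open>The vectors whose translation lies in \<open>W\<close> form a lattice. It contains
  \<theta> because the translation by -\<theta> is s_\<theta> s_0, and conjugation makes it stable
  under s_1, ..., s_n.\<close>

lemma trans_W: "\<mu> \<in> Q \<Longrightarrow> trans \<mu> \<in> W"
proof -
  have "Q \<subseteq> {\<mu> \<in> Q. trans \<mu> \<in> W}"
  proof (rule lattice_from_theta)
    have plus: "trans (lc x 1 y) \<in> W" if "trans x \<in> W" "trans y \<in> W" for x y
      using that unfolding vadd_eq_lc[symmetric] trans_comp by (rule W_comp)
    have minus: "trans (\<lambda>k. - y k) \<in> W" if "trans y \<in> W" for y
      unfolding iv_trans[symmetric] using that by (rule W_inv)
    have "lc x (-1) y = lc x 1 (\<lambda>k. - y k)" for x y by (simp add: lc_def)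
    then show "lattice_closed {\<mu> \<in> Q. trans \<mu> \<in> W}"
      using plus minus W_id by (auto simp: lattice_closed_def Q_zero trans_zero Q_lc Q_uminus)
    have "trans (\<lambda>k. - \<theta> k) \<in> W"
      unfolding trans_theta by (intro W_comp W_s W0_W W0_sref short_theta pos_theta) simp
    then show "\<theta> \<in> {\<mu> \<in> Q. trans \<mu> \<in> W}"
      using minus[of "\<lambda>k. - \<theta> k"] by (simp add: Q_theta)
  next
    fix x j assume x: "x \<in> {\<mu> \<in> Q. trans \<mu> \<in> W}" and j: "j \<in> {1..n}"
    then have "j \<le> n" "trans x \<in> W" by auto
    then have "trans (s j x) \<in> W" unfolding trans_s[OF \<open>j \<le> n\<close>] by (intro W_comp W_s)
    then show "s j x \<in> {\<mu> \<in> Q. trans \<mu> \<in> W}" using Q_s x j by blast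
  qed
  then show "\<mu> \<in> Q \<Longrightarrow> trans \<mu> \<in> W" by blast
qed

end

section \<open>Lusztig's relations\<close>

locale artin_short = artin_rep n A a e G T + affine_short n A a e
  for n A a e and G :: "('g, 'm) monoid_scheme" (structure) and T
begin

lemma P_Q: "\<mu> \<in> P \<Longrightarrow> \<mu> \<in> Q"
  by (simp add: P_def)

section \<open>The commutative family Y\<close>

definition L :: "vec \<Rightarrow> 'g" where "L \<mu> = Tw (trans \<mu>)"

lemma L_closed [simp, intro]: "\<mu> \<in> Q \<Longrightarrow> L \<mu> \<in> carrier G"
  by (simp add: L_def trans_W)

text \<open>A positive root made negative by an antidominant translation has negative finite part,
  and any further antidominant translation only lowers it; so the lengths add.\<close>

lemma L_add: "\<mu> \<in> P \<Longrightarrow> \<nu> \<in> P \<Longrightarrow> L (vadd \<mu> \<nu>) = L \<mu> \<otimes> L \<nu>"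
  unfolding L_def trans_comp
proof (rule Tw_mult)
  assume mn: "\<mu> \<in> P" "\<nu> \<in> P"
  then show "trans \<nu> \<in> W" "trans \<mu> \<in> W" by (simp_all add: trans_W P_Q)
  fix x assume x: "root x" "pos x" "\<not> pos (trans \<nu> x)"
  have "\<not> pos (fp x)" using P_B_pos[OF mn(2) x(1)] trans_pos[OF x(2)] x(3) by blast
  then have "B x \<mu> \<ge> 0" using P_B_neg mn x by blast
  then have "B (trans \<nu> x) \<mu> \<ge> 0" by (simp add: trans_eq lin B_delta)
  then show "\<not> pos (trans \<mu> (trans \<nu> x))" using trans_neg x mn by (simp add: root_trans P_Q)
qed

lemma L_commute: "\<mu> \<in> P \<Longrightarrow> \<nu> \<in> P \<Longrightarrow> L \<mu> \<otimes> L \<nu> = L \<nu> \<otimes> L \<mu>"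
  using L_add[of \<mu> \<nu>] L_add[of \<nu> \<mu>] by (simp add: vadd_def add.commute)

lemma P_diff_ex:
  assumes "\<beta> \<in> Q"
  shows "\<exists>\<mu>\<in>P. \<exists>\<nu>\<in>P. \<beta> = lc \<mu> (-1) \<nu>"
proof -
  obtain \<rho> where r: "\<rho> \<in> P" "\<forall>k\<in>{1..n}. pr k \<rho> \<le> -1" using regular_ex by blast
  obtain N :: nat where N: "\<forall>k\<in>{1..n}. pr k \<beta> \<le> real N" using pr_bound_ex by blast
  define \<nu> where "\<nu> = lc (\<lambda>_. 0) (real N) \<rho>"
  have pn: "pr k \<nu> = real N * pr k \<rho>" for k by (simp add: \<nu>_def pr_lc pr_zero)
  have le: "pr k \<nu> \<le> - real N" if "k \<in> {1..n}" for k
    using mult_left_mono[of "pr k \<rho>" "-1" "real N"] r that by (simp add: pn)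
  have "\<nu> \<in> P" using r le by (auto simp: P_iff \<nu>_def Q_lc Q_zero pr_lc pr_zero mult_nonneg_nonpos)
  moreover have "pr k (vadd \<beta> \<nu>) \<le> 0" if "k \<in> {1..n}" for k
  proof -
    have "pr k \<beta> \<le> real N" using N that by blast
    then show ?thesis using le[OF that] by (simp add: vadd_eq_lc pr_lc)
  qed
  then have "vadd \<beta> \<nu> \<in> P" using \<open>\<nu> \<in> P\<close> assms by (simp add: P_iff vadd_eq_lc Q_lc)
  moreover have "\<beta> = lc (vadd \<beta> \<nu>) (-1) \<nu>" by (simp add: lc_def vadd_def)
  ultimately show ?thesis by blast
qed

text \<open>Formal differences over the antidominant cone. \<open>Y_eq\<close> shows that the choice
  is immaterial, because \<open>L\<close> is multiplicative and commutative there.\<close>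

definition Y :: "vec \<Rightarrow> 'g" where
  "Y \<beta> = (SOME g. \<exists>\<mu>\<in>P. \<exists>\<nu>\<in>P. \<beta> = lc \<mu> (-1) \<nu> \<and> g = L \<mu> \<otimes> inv L \<nu>)"

lemma Y_eq:
  assumes "\<mu> \<in> P" "\<nu> \<in> P"
  shows "Y (lc \<mu> (-1) \<nu>) = L \<mu> \<otimes> inv L \<nu>"
proof -
  have "\<exists>g. \<exists>\<mu>'\<in>P. \<exists>\<nu>'\<in>P. lc \<mu> (-1) \<nu> = lc \<mu>' (-1) \<nu>' \<and> g = L \<mu>' \<otimes> inv L \<nu>'"
    using assms by blast
  from someI_ex[OF this] obtain \<mu>' \<nu>' where o: "\<mu>' \<in> P" "\<nu>' \<in> P" "lc \<mu> (-1) \<nu> = lc \<mu>' (-1) \<nu>'"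
    "Y (lc \<mu> (-1) \<nu>) = L \<mu>' \<otimes> inv L \<nu>'" unfolding Y_def by blast
  have "\<mu> k + \<nu>' k = \<mu>' k + \<nu> k" for k using fun_cong[OF o(3), of k] by (simp add: lc_def)
  then have "vadd \<mu> \<nu>' = vadd \<mu>' \<nu>" by (simp add: vadd_def)
  then have eq: "L \<mu> \<otimes> L \<nu>' = L \<mu>' \<otimes> L \<nu>"
    using L_add[OF assms(1) o(2)] L_add[OF o(1) assms(2)] by simp
  have c: "L \<mu> \<in> carrier G" "L \<nu> \<in> carrier G" "L \<mu>' \<in> carrier G" "L \<nu>' \<in> carrier G"
    using assms o by (auto simp: P_Q)
  have cm: "commute (L \<nu>) (L \<nu>')" using L_commute assms o c by (simp add: commute_def)
  have "L \<mu> = L \<mu>' \<otimes> L \<nu> \<otimes> inv L \<nu>'" using eq c inv_solve_right[of "L \<mu>" _ "L \<nu>'"] by simp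
  then have "L \<mu> \<otimes> inv L \<nu> = L \<mu>' \<otimes> (L \<nu> \<otimes> (inv L \<nu>' \<otimes> inv L \<nu>))"
    using c by (simp add: m_assoc)
  also have "inv L \<nu>' \<otimes> inv L \<nu> = inv L \<nu> \<otimes> inv L \<nu>'"
    using commute_eq[OF commute_inv_left[OF commute_inv[OF cm]]] by simp
  finally show ?thesis using o(4) c by simp
qed

lemma Y_ex: "\<beta> \<in> Q \<Longrightarrow> \<exists>\<mu>\<in>P. \<exists>\<nu>\<in>P. \<beta> = lc \<mu> (-1) \<nu> \<and> Y \<beta> = L \<mu> \<otimes> inv L \<nu>"
  using P_diff_ex[of \<beta>] Y_eq by blast

lemma Y_closed [simp, intro]: "\<beta> \<in> Q \<Longrightarrow> Y \<beta> \<in> carrier G"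
  using Y_ex[of \<beta>] by (auto simp: P_Q)

lemma Y_add: "\<beta> \<in> Q \<Longrightarrow> \<gamma> \<in> Q \<Longrightarrow> Y (vadd \<beta> \<gamma>) = Y \<beta> \<otimes> Y \<gamma>"
proof -
  assume "\<beta> \<in> Q" "\<gamma> \<in> Q"
  then obtain \<mu> \<nu> \<mu>' \<nu>' where o: "\<mu> \<in> P" "\<nu> \<in> P" "\<mu>' \<in> P" "\<nu>' \<in> P" "\<beta> = lc \<mu> (-1) \<nu>" "\<gamma> = lc \<mu>' (-1) \<nu>'"
    "Y \<beta> = L \<mu> \<otimes> inv L \<nu>" "Y \<gamma> = L \<mu>' \<otimes> inv L \<nu>'"
    using Y_ex by blast
  have c: "L \<mu> \<in> carrier G" "L \<nu> \<in> carrier G" "L \<mu>' \<in> carrier G" "L \<nu>' \<in> carrier G"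
    using o by (auto simp: P_Q)
  have cm: "commute (inv L \<nu>) (L \<mu>')" "commute (inv L \<nu>') (inv L \<nu>)"
    using L_commute o(1-4) c by (intro commute_inv_left commute_inv commuteI; simp)+
  have "vadd \<beta> \<gamma> = lc (vadd \<mu> \<mu>') (-1) (vadd \<nu> \<nu>')"
    by (simp add: o vadd_def lc_def algebra_simps)
  then have "Y (vadd \<beta> \<gamma>) = (L \<mu> \<otimes> L \<mu>') \<otimes> inv (L \<nu> \<otimes> L \<nu>')"
    using Y_eq[of "vadd \<mu> \<mu>'" "vadd \<nu> \<nu>'"] o(1-4) by (simp add: P_add L_add)
  also have "\<dots> = L \<mu> \<otimes> (inv L \<nu> \<otimes> (L \<mu>' \<otimes> inv L \<nu>'))"
    using c commute_eq[OF cm(2)] commute_eq'[OF cm(1)] by (simp add: m_assoc inv_mult_group)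
  finally show ?thesis using o c by (simp add: m_assoc)
qed

lemma Y_zero: "Y (\<lambda>_. 0) = \<one>"
proof -
  obtain \<rho> where "\<rho> \<in> P" using regular_ex by blast
  then show ?thesis using Y_eq[of \<rho> \<rho>] by (simp add: P_Q) (simp add: lc_def)
qed

lemma Y_P: "\<mu> \<in> P \<Longrightarrow> Y \<mu> = L \<mu>"
proof -
  assume m: "\<mu> \<in> P"
  have "lc (vadd \<mu> \<mu>) (-1) \<mu> = \<mu>" by (simp add: lc_def vadd_def)
  then show ?thesis using Y_eq[OF P_add[OF m m] m] m by (simp add: L_add m_assoc P_Q)
qed

lemma Y_unique:
  assumes "\<And>\<beta> \<gamma>. \<beta> \<in> Q \<Longrightarrow> \<gamma> \<in> Q \<Longrightarrow> F (vadd \<beta> \<gamma>) = F \<beta> \<otimes> F \<gamma>" "\<And>\<mu>. \<mu> \<in> P \<Longrightarrow> F \<mu> = L \<mu>"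
    "\<And>\<beta>. \<beta> \<in> Q \<Longrightarrow> F \<beta> \<in> carrier G" and b: "\<beta> \<in> Q"
  shows "F \<beta> = Y \<beta>"
proof -
  obtain \<mu> \<nu> where o: "\<mu> \<in> P" "\<nu> \<in> P" "\<beta> = lc \<mu> (-1) \<nu>" "Y \<beta> = L \<mu> \<otimes> inv L \<nu>" using Y_ex[OF b] by blast
  have "\<mu> = vadd \<beta> \<nu>" by (simp add: o(3) lc_def vadd_def)
  then have "L \<mu> = F \<beta> \<otimes> L \<nu>"
    using assms(1)[OF b P_Q[OF o(2)]] assms(2)[OF o(1)] assms(2)[OF o(2)] by simp
  then show ?thesis using o assms(3)[OF b] by (simp add: m_assoc P_Q)
qed

section \<open>Relations of the finite generators with Y\<close>

text \<open>Adding a large multiple of a subregular vector leaves the pairing with \<alpha>_i alone;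
  this reduces the relations of T_i with Y to antidominant weights.\<close>

lemma shift_ex:
  assumes "\<beta> \<in> Q" "i \<in> {1..n}" "pr i \<beta> \<le> 0"
  shows "\<exists>\<nu>\<in>P. pr i \<nu> = 0 \<and> vadd \<beta> \<nu> \<in> P"
proof -
  obtain \<sigma> where r: "\<sigma> \<in> P" "pr i \<sigma> = 0" "\<forall>k\<in>{1..n}. k \<noteq> i \<longrightarrow> pr k \<sigma> \<le> -1" using subregular_ex assms(2) by blast
  obtain N :: nat where N: "\<forall>k\<in>{1..n}. pr k \<beta> \<le> real N" using pr_bound_ex by blast
  define \<nu> where "\<nu> = lc (\<lambda>_. 0) (real N) \<sigma>"
  have pn: "pr k \<nu> = real N * pr k \<sigma>" for k by (simp add: \<nu>_def pr_lc pr_zero)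
  have le: "pr k \<nu> \<le> - real N" if "k \<in> {1..n}" "k \<noteq> i" for k
    using mult_left_mono[of "pr k \<sigma>" "-1" "real N"] r that by (simp add: pn)
  have "\<nu> \<in> P" using r by (auto simp: P_iff \<nu>_def Q_lc Q_zero pr_lc pr_zero mult_nonneg_nonpos)
  moreover have "pr i \<nu> = 0" using r by (simp add: pn)
  moreover have "pr k (vadd \<beta> \<nu>) \<le> 0" if "k \<in> {1..n}" for k
  proof (cases "k = i")
    case True then show ?thesis using assms \<open>pr i \<nu> = 0\<close> by (simp add: vadd_eq_lc pr_lc)
  next
    case False
    have "pr k \<beta> \<le> real N" using N that by blast
    then show ?thesis using le[OF that False] by (simp add: vadd_eq_lc pr_lc)
  qed
  then have "vadd \<beta> \<nu> \<in> P" using \<open>\<nu> \<in> P\<close> assms by (simp add: P_iff vadd_eq_lc Q_lc)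
  ultimately show ?thesis by blast
qed

lemma trans_rt: "i \<le> n \<Longrightarrow> trans \<beta> (rt i) = lc (rt i) (- of_int (e i) * pr i \<beta>) \<delta>"
  by (simp add: trans_eq B_rt_left)

lemma iv_trans_rt: "i \<le> n \<Longrightarrow> iv (trans \<beta>) (rt i) = lc (rt i) (of_int (e i) * pr i \<beta>) \<delta>"
proof -
  assume "i \<le> n"
  then show ?thesis unfolding iv_trans by (simp add: trans_rt pr_uminus)
qed

text \<open>The translation by \<beta> commutes with s_i and fixes \<alpha>_i, so multiplying by s_i
  on either side raises the length.\<close>

lemma L_comm_T:
  assumes b: "\<beta> \<in> P" and i: "i \<in> {1..n}" and p: "pr i \<beta> = 0"
  shows "T i \<otimes> L \<beta> = L \<beta> \<otimes> T i"
proof -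
  have i': "i \<le> n" using i by simp
  have "s i \<beta> = \<beta>" using i' p by (simp add: s_eq lc_def)
  then have "trans \<beta> = s i \<circ> (trans \<beta> \<circ> s i)" using trans_s[OF i', of \<beta>] by simp
  then have c: "s i \<circ> trans \<beta> = trans \<beta> \<circ> s i" using s_s_comp(2)[OF i'] by (metis (no_types))
  have w: "trans \<beta> \<in> W" using b by (simp add: trans_W P_Q)
  have "trans \<beta> (rt i) = rt i" "iv (trans \<beta>) (rt i) = rt i"
    using i' p by (simp_all add: trans_rt iv_trans_rt) (simp_all add: lc_def)
  then have "Tw (s i \<circ> trans \<beta>) = T i \<otimes> L \<beta>" "Tw (trans \<beta> \<circ> s i) = L \<beta> \<otimes> T i"
    unfolding L_def using w i' by (simp_all add: Tw_left_pos Tw_right_pos pos_rt)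
  then show ?thesis unfolding c by simp
qed

lemma Y_comm_T:
  assumes b: "\<beta> \<in> Q" and i: "i \<in> {1..n}" and p: "pr i \<beta> = 0"
  shows "commute (T i) (Y \<beta>)"
proof -
  obtain \<nu> where n: "\<nu> \<in> P" "pr i \<nu> = 0" "vadd \<beta> \<nu> \<in> P" using shift_ex[OF b i] p by auto
  have eq: "\<beta> = lc (vadd \<beta> \<nu>) (-1) \<nu>" by (simp add: lc_def vadd_def)
  have "pr i (vadd \<beta> \<nu>) = 0" using p n by (simp add: vadd_eq_lc pr_lc)
  then have "commute (T i) (L (vadd \<beta> \<nu>))" "commute (T i) (L \<nu>)"
    using n i L_comm_T by (auto intro!: commuteI simp: P_Q)
  then have "commute (T i) (L (vadd \<beta> \<nu>) \<otimes> inv L \<nu>)" by (intro commute_mult commute_inv)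
  then show ?thesis using Y_eq[OF n(3,1)] eq by simp
qed

text \<open>With \<open>\<nu> = \<beta> + s\<^sub>i \<beta>\<close>, orthogonal to \<open>\<alpha>\<^sub>i\<close>, one has
  \<open>\<lambda>\<^sub>\<beta> (s\<^sub>i \<lambda>\<^sub>\<beta>) = \<lambda>\<^sub>\<nu> s\<^sub>i\<close> with lengths adding on both sides.\<close>

lemma L_refl:
  assumes b: "\<beta> \<in> P" and i: "i \<in> {1..n}" and p: "pr i \<beta> = -1"
  shows "L (vadd \<beta> (s i \<beta>)) \<otimes> T i = L \<beta> \<otimes> (inv T i \<otimes> L \<beta>)" and "vadd \<beta> (s i \<beta>) \<in> P"
    and "pr i (vadd \<beta> (s i \<beta>)) = 0"
proof -
  define \<nu> where "\<nu> = vadd \<beta> (s i \<beta>)"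
  have i': "i \<le> n" using i by simp
  have sb: "s i \<beta> = lc \<beta> 1 (rt i)" using i' p by (simp add: s_eq)
  have pn: "pr k \<nu> = 2 * pr k \<beta> + of_int (A k i)" for k
    using i' by (simp add: \<nu>_def vadd_eq_lc sb pr_lc pr_rt)
  show p0: "pr i (vadd \<beta> (s i \<beta>)) = 0" using p i' pn[of i] by (simp add: diag \<nu>_def)
  have bQ: "\<beta> \<in> Q" using b by (rule P_Q)
  have nQ: "\<nu> \<in> Q" using bQ i by (simp add: \<nu>_def vadd_eq_lc Q_lc Q_s)
  have "pr k \<nu> \<le> 0" if k: "k \<in> {1..n}" for k
  proof (cases "k = i")
    case True then show ?thesis using p0 by (simp add: \<nu>_def)
  next
    case False
    have "A k i \<le> 0" using offdiag[of k i] k i False by simp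
    then have "real_of_int (A k i) \<le> 0" by simp
    moreover have "pr k \<beta> \<le> 0" using b k unfolding P_iff by blast
    ultimately show ?thesis unfolding pn by linarith
  qed
  then have nP: "\<nu> \<in> P" using nQ unfolding P_iff by blast
  then show "vadd \<beta> (s i \<beta>) \<in> P" by (simp add: \<nu>_def)
  have w: "trans \<beta> \<in> W" "trans \<nu> \<in> W" using bQ nQ by (simp_all add: trans_W)
  define v where "v = s i \<circ> trans \<beta>"
  have v: "v \<in> W" unfolding v_def by (intro W_comp W_s w i')
  have "trans \<nu> = trans \<beta> \<circ> (s i \<circ> (trans \<beta> \<circ> s i))"
    unfolding \<nu>_def trans_comp trans_s[OF i'] ..
  then have uv: "trans \<beta> \<circ> v = trans \<nu> \<circ> s i"
    unfolding v_def by (simp only: comp_assoc s_s_comp[OF i'] comp_id)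
  have ei: "e i > 0" using e_pos i' .
  have ivr: "iv (trans \<beta>) (rt i) = lc (rt i) (- of_int (e i)) \<delta>" using iv_trans_rt[OF i', of \<beta>] p by simp
  have "\<not> pos (iv (trans \<beta>) (rt i))"
    by (rule not_pos_if_coord[of _ 0]) (use i ei in \<open>simp add: ivr lc_def rt_apply delta_apply a_0\<close>)
  then have Lb: "L \<beta> = T i \<otimes> Tw v"
    unfolding L_def v_def using w i' by (intro Tw_left_neg)
  then have Tv: "inv T i \<otimes> L \<beta> = Tw v" using i' v by simp
  have "trans \<nu> (rt i) = rt i" using i' p0 by (simp add: trans_rt \<nu>_def) (simp add: lc_def)
  then have 1: "Tw (trans \<nu> \<circ> s i) = L \<nu> \<otimes> T i"
    unfolding L_def using w i' by (intro Tw_right_pos) (simp_all add: pos_rt)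
  have "Tw (trans \<beta> \<circ> v) = Tw (trans \<beta>) \<otimes> Tw v"
  proof (rule Tw_mult[OF v w(1)])
    \<comment> \<open>It suffices that the finite part of v x is negative, since the translation by
      \<beta> then keeps v x negative.\<close>
    fix x assume x: "root x" "pos x" "\<not> pos (v x)"
    define y where "y = trans \<beta> x"
    have ry: "root y" using x bQ by (simp add: y_def root_trans)
    have vx: "v x = s i y" by (simp add: v_def y_def)
    have xy: "x = iv (trans \<beta>) y" using w by (simp add: y_def W_inv_apply)
    have npy: "\<not> pos y"
    proof
      assume "pos y"
      then have "y = rt i" using s_not_pos_imp[OF ry _ i'] x vx by simp
      then have "x = lc (rt i) (- of_int (e i)) \<delta>" using xy ivr by simp
      then have "x 0 < 0" using i ei by (simp add: lc_def rt_apply delta_apply a_0)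
      then show False using x(2) by (simp add: pos_def not_less[symmetric])
    qed
    have nfx: "\<not> pos (fp x)"
      using P_B_pos[OF b x(1)] trans_pos[OF x(2), of \<beta>] npy unfolding y_def by blast
    have fpy: "fp y = fp x"
      by (simp add: y_def fp_def trans_eq, simp add: lc_def delta_apply a_0 algebra_simps)
    \<comment> \<open>The finite part of y is negative, and s_i can make it positive only if it
      equals -\<alpha>_i.\<close>
    have nfsy: "\<not> pos (fp (s i y))"
    proof
      assume ps: "pos (fp (s i y))"
      have fs: "fp (s i y) = s i (fp y)"
      proof -
        have "s i y 0 = y 0" using i by (simp add: s_eq lc_def rt_apply)
        then show ?thesis using i' by (simp add: fp_def s_lc s_delta)
      qed
      have "s i (fp (s i y)) = fp y" unfolding fs by (rule s_s[OF i'])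
      then have "fp (s i y) = rt i"
        using s_not_pos_imp[OF root_fp[OF root_s[OF ry i']] ps i'] nfx fpy by simp
      then have fy: "fp y = (\<lambda>k. - rt i k)" using fs s_s[OF i', of "fp y"] s_rt[OF i'] by metis
      then have yk: "y = lc (\<lambda>k. (-1) * rt i k) (y 0) \<delta>"
        by (simp add: fp_def lc_def fun_eq_iff algebra_simps)
      obtain m where m: "m \<le> n" "root_of m y" using ry root_def by blast
      \<comment> \<open>Divisibility of y_0 by e_i rules out values strictly between -e_i and 0. As
        x_0 = y_0 + e_i, either y = -\<alpha>_i and v x would be \<alpha>_i, or x would have a
        negative coordinate at i.\<close>
      have "y 0 / of_int (e i) \<in> \<int>" using root_multiple[OF m(2,1) i' yk] i by auto
      then obtain z where z: "y 0 / of_int (e i) = of_int z" by (metis Ints_cases)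
      then have y0: "y 0 = of_int (e i) * of_int z" using ei by (simp add: field_simps)
      have "y 0 \<le> 0" using coherent[OF ry npy] .
      then have z0: "z \<le> 0" using ei by (simp add: y0 mult_le_0_iff)
      have "B y \<beta> = B (fp y) \<beta>" by (simp add: B_fp)
      also have "\<dots> = - B (rt i) \<beta>" unfolding fy by (simp add: B_eq sum_negf)
      also have "\<dots> = of_int (e i)" using i' p by (simp add: B_rt_left)
      finally have By: "B y \<beta> = of_int (e i)" .
      then have Bx: "B x \<beta> = of_int (e i)" using B_fp[of x \<beta>] B_fp[of y \<beta>] fpy by simp
      have "y 0 = x 0 - of_int (e i)" using Bx by (simp add: y_def trans_eq lc_def delta_apply a_0)
      then have x0: "x 0 = of_int (e i) * (of_int z + 1)" by (simp add: y0 algebra_simps)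
      show False
      proof (cases "z = 0")
        case True
        then have "y = (\<lambda>k. - rt i k)" using yk y0 by (simp add: lc_def)
        then have "v x = rt i" unfolding vx using s_rt[OF i'] s_s[OF i', of "rt i"] by metis
        then show False using x(3) pos_rt by simp
      next
        case False
        have "x i = - 1 + x 0 * \<delta> i"
        proof -
          have "fp x i = - rt i i" using fpy fy by metis
          then show ?thesis by (simp add: fp_def lc_def rt_apply)
        qed
        moreover have "x 0 \<le> 0"
          unfolding x0 using False z0 ei by (intro mult_nonneg_nonpos) auto
        then have "x 0 * \<delta> i \<le> 0" using delta_pos[OF i'] by (intro mult_nonpos_nonneg) auto
        ultimately have "x i < 0" by linarith
        then show False using x(2) unfolding pos_def by (meson not_less)
      qed
    qed
    have rv: "root (v x)" using x v by (simp add: W_root)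
    have "B (s i y) \<beta> \<ge> 0" using P_B_neg[OF b _ nfsy] ry i' by (simp add: root_s)
    then show "\<not> pos (trans \<beta> (v x))" using trans_neg[OF rv bQ x(3)] vx by simp
  qed
  then show "L (vadd \<beta> (s i \<beta>)) \<otimes> T i = L \<beta> \<otimes> (inv T i \<otimes> L \<beta>)"
    unfolding uv 1 Tv by (simp add: L_def[of \<beta>] \<nu>_def)
qed

text \<open>For antidominant \<mu> the element L_{\<mu> + s_i \<mu>} is the product of Y_{s_i \<mu>}
  and L_\<mu>, and it commutes with T_i; cancelling L_\<mu> in \<open>L_refl\<close> gives the
  relation. A general \<beta> is shifted into the cone by a vector orthogonal to \<alpha>_i.\<close>

lemma Y_refl:
  assumes b: "\<beta> \<in> Q" and i: "i \<in> {1..n}" and p: "pr i \<beta> = -1"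
  shows "inv T i \<otimes> (Y \<beta> \<otimes> inv T i) = Y (s i \<beta>)"
proof -
  have i': "i \<le> n" using i by simp
  have base: "inv T i \<otimes> (L \<mu> \<otimes> inv T i) = Y (s i \<mu>)" if m: "\<mu> \<in> P" and pm: "pr i \<mu> = -1" for \<mu>
  proof -
    note R = L_refl[OF m i pm]
    have mQ: "\<mu> \<in> Q" "s i \<mu> \<in> Q" using m P_Q Q_s i by blast+
    have c: "L \<mu> \<in> carrier G" "T i \<in> carrier G" "Y (s i \<mu>) \<in> carrier G" using mQ i' by auto
    have "L (vadd \<mu> (s i \<mu>)) = L \<mu> \<otimes> Y (s i \<mu>)" using Y_add[OF mQ] Y_P[OF R(2)] Y_P[OF m] by simp
    moreover have "L (vadd \<mu> (s i \<mu>)) = Y (s i \<mu>) \<otimes> L \<mu>"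
      using Y_add[OF mQ(2,1)] Y_P[OF R(2)] Y_P[OF m] by (simp add: vadd_def add.commute)
    moreover have "T i \<otimes> L (vadd \<mu> (s i \<mu>)) = L (vadd \<mu> (s i \<mu>)) \<otimes> T i"
      using L_comm_T[OF R(2) i R(3)] .
    ultimately have "T i \<otimes> Y (s i \<mu>) \<otimes> L \<mu> = L \<mu> \<otimes> inv T i \<otimes> L \<mu>"
      using R(1) c by (simp add: m_assoc)
    then have "T i \<otimes> Y (s i \<mu>) = L \<mu> \<otimes> inv T i" using c by simp
    then have "inv T i \<otimes> (T i \<otimes> Y (s i \<mu>)) = inv T i \<otimes> (L \<mu> \<otimes> inv T i)" by simp
    then show ?thesis using c by simp
  qed
  obtain \<nu> where n: "\<nu> \<in> P" "pr i \<nu> = 0" "vadd \<beta> \<nu> \<in> P" using shift_ex[OF b i] p by auto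
  have nQ: "\<nu> \<in> Q" using n P_Q by blast
  have "pr i (vadd \<beta> \<nu>) = -1" using p n by (simp add: vadd_eq_lc pr_lc)
  then have "inv T i \<otimes> (Y (vadd \<beta> \<nu>) \<otimes> inv T i) = Y (s i (vadd \<beta> \<nu>))"
    using base[OF n(3)] Y_P[OF n(3)] by simp
  also have "s i (vadd \<beta> \<nu>) = vadd (s i \<beta>) \<nu>"
    using n i' by (simp add: s_eq vadd_eq_lc pr_lc) (simp add: lc_def algebra_simps)
  finally have eq: "inv T i \<otimes> (Y \<beta> \<otimes> Y \<nu> \<otimes> inv T i) = Y (s i \<beta>) \<otimes> Y \<nu>"
    using b nQ Q_s i by (simp only: Y_add)
  have cm: "commute (inv T i) (Y \<nu>)" using Y_comm_T[OF nQ i n(2)] by (rule commute_inv_left)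
  have c: "Y \<beta> \<in> carrier G" "T i \<in> carrier G" "Y (s i \<beta>) \<in> carrier G" "Y \<nu> \<in> carrier G"
    using b nQ i Q_s by auto
  have "(inv T i \<otimes> (Y \<beta> \<otimes> inv T i)) \<otimes> Y \<nu> = Y (s i \<beta>) \<otimes> Y \<nu>"
    using eq c commute_eq[OF cm] by (simp add: m_assoc)
  then show ?thesis using c by simp
qed

end

section \<open>Braid elements of reflections in short roots\<close>

context group
begin

text \<open>The equations r t = t u = u r are the dual, or Birman-Ko-Lee, presentation of the braid
  group on three strands.\<close>

lemma braid_of_conjugates:
  assumes c: "r \<in> carrier G" "t \<in> carrier G" "u \<in> carrier G"
    and 1: "t \<otimes> u = r \<otimes> t" and 2: "u \<otimes> r = r \<otimes> t"
  shows "u \<otimes> (t \<otimes> u) = t \<otimes> (u \<otimes> t)"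
proof -
  have "u \<otimes> (t \<otimes> u) = (u \<otimes> r) \<otimes> t" using c by (simp add: 1 m_assoc)
  also have "\<dots> = (t \<otimes> u) \<otimes> t" by (simp add: 1 2)
  finally show ?thesis using c by (simp add: m_assoc)
qed

end

context artin_short
begin

text \<open>The decomposition s_\<gamma> = s_k s_{s_k \<gamma>} s_k is length additive: s_\<gamma>
  makes \<alpha>_k negative, whereas s_{s_k \<gamma>} keeps it positive.\<close>

lemma Tw_sref_step:
  assumes g: "short \<gamma>" "pos \<gamma>" and k: "k \<in> {1..n}" and p: "pr k \<gamma> \<ge> 1" and ne: "\<gamma> \<noteq> rt k"
  shows "Tw (sref \<gamma>) = T k \<otimes> (Tw (sref (s k \<gamma>)) \<otimes> T k)" "short (s k \<gamma>)" "pos (s k \<gamma>)"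
proof -
  have k': "k \<le> n" using k by simp
  have rg: "root \<gamma>" using g short_root by blast
  show sh: "short (s k \<gamma>)" using short_s g k by blast
  show ps: "pos (s k \<gamma>)" using s_not_pos_imp[OF rg g(2) k'] ne by blast
  have w: "sref \<gamma> \<in> W" "sref (s k \<gamma>) \<in> W" using W0_sref g sh ps W0_W by blast+
  have eq: "sref \<gamma> = s k \<circ> (sref (s k \<gamma>) \<circ> s k)"
    using sref_conj[OF k', of "s k \<gamma>"] by (simp only: s_s[OF k'])
  have eq': "sref (s k \<gamma>) \<circ> s k = s k \<circ> sref \<gamma>" unfolding eq by (simp only: s_s_comp(2)[OF k'])
  \<comment> \<open>A coordinate of \<gamma> away from k is unaffected by s_k and shows the sign of
    both images of \<alpha>_k.\<close>
  obtain l where l: "l \<noteq> k" "\<gamma> l > 0"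
  proof -
    have "\<exists>l. l \<noteq> k \<and> \<gamma> l \<noteq> 0"
    proof (rule ccontr)
      assume "\<not> ?thesis"
      then have ml: "\<gamma> = lc (\<lambda>l. \<gamma> k * rt k l) 0 \<delta>" by (auto simp: fun_eq_iff lc_def rt_apply)
      have "\<gamma> k = 1 \<or> \<gamma> k = -1" using root_multiple[OF short_root_of[OF g(1)] _ k' ml] by auto
      then have "\<gamma> k = 1" using g(2) unfolding pos_def by (metis not_one_le_zero neg_0_le_iff_le)
      then show False using ml ne by (simp add: lc_def)
    qed
    then show thesis using that g(2) unfolding pos_def by (metis order_less_le)
  qed
  have Bk: "B (rt k) \<gamma> > 0" using p e_pos[OF k'] by (simp add: B_rt_left[OF k'])
  have "\<not> pos (sref \<gamma> (rt k))"
    by (rule not_pos_if_coord[of _ l]) (use l Bk in \<open>simp add: sref_def lc_def rt_apply\<close>)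
  then have n1: "\<not> pos (iv (sref \<gamma>) (rt k))" using iv_sref[OF g(1)] by simp
  have sl: "s k \<gamma> l = \<gamma> l" using l k' by (simp add: s_eq lc_def rt_apply)
  have Bsk: "B (rt k) (s k \<gamma>) < 0" using p e_pos[OF k'] k' by (simp add: B_rt_left pr_s diag)
  have "B (rt k) (s k \<gamma>) * \<gamma> l < 0" using l Bsk by (intro mult_neg_pos)
  then have "sref (s k \<gamma>) (rt k) l > 0"
    unfolding sref_def lc_def sl using l(1) by (simp add: rt_apply)
  then have p2: "pos (sref (s k \<gamma>) (rt k))" by (rule pos_if_coord[OF W_root[OF w(2) root_rt[OF k']]])
  have "Tw (sref \<gamma>) = T k \<otimes> Tw (s k \<circ> sref \<gamma>)" by (rule Tw_left_neg[OF w(1) k' n1])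
  also have "Tw (s k \<circ> sref \<gamma>) = Tw (sref (s k \<gamma>)) \<otimes> T k"
    unfolding eq'[symmetric] by (rule Tw_right_pos[OF w(2) k' p2])
  finally show "Tw (sref \<gamma>) = T k \<otimes> (Tw (sref (s k \<gamma>)) \<otimes> T k)" .
qed

lemma Tw_sref_comm:
  assumes g: "short \<gamma>" "pos \<gamma>" and k: "k \<in> {1..n}" and p: "pr k \<gamma> = 0"
  shows "commute (T k) (Tw (sref \<gamma>))"
proof -
  have k': "k \<le> n" using k by simp
  have w: "sref \<gamma> \<in> W" using W0_sref g W0_W by blast
  have fx: "sref \<gamma> (rt k) = rt k" using p k' by (simp add: sref_def B_rt_left) (simp add: lc_def)
  have "s k \<gamma> = \<gamma>" using k' p by (simp add: s_eq lc_def)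
  then have "sref \<gamma> = s k \<circ> (sref \<gamma> \<circ> s k)" using sref_conj[OF k', of \<gamma>] by simp
  then have c: "s k \<circ> sref \<gamma> = sref \<gamma> \<circ> s k" using s_s_comp(2)[OF k'] by (metis (no_types))
  have "Tw (s k \<circ> sref \<gamma>) = T k \<otimes> Tw (sref \<gamma>)"
    by (rule Tw_left_pos[OF w k']) (simp add: iv_sref[OF g(1)] fx pos_rt)
  moreover have "Tw (sref \<gamma> \<circ> s k) = Tw (sref \<gamma>) \<otimes> T k"
    by (rule Tw_right_pos[OF w k']) (simp add: fx pos_rt)
  ultimately show ?thesis using w k' unfolding c by (intro commuteI) auto
qed

text \<open>If k is a left descent of w, the inverse image of \<alpha>_k is a negative root, so its
  pairing with the dominant vector \<theta> is at most 0. As w fixes \<theta>, this pairing is that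
  of \<alpha>_k with \<theta>, so a_{k0} = 0. Thus T_w is a product of T_k with k not joined to the
  affine node.\<close>

lemma commute_stabilizer:
  assumes "w \<in> W0" "w \<theta> = \<theta>" and g: "g \<in> carrier G" "\<And>k. k \<in> {1..n} \<Longrightarrow> A k 0 = 0 \<Longrightarrow> commute g (T k)"
  shows "commute g (Tw w)"
proof -
  obtain js where "red w js" using red_ex W0_W assms(1) by blast
  then show ?thesis using assms(1,2)
  proof (induction js arbitrary: w)
    case Nil
    then have "w = id" by (simp only: red_Nil)
    then show ?case unfolding \<open>w = id\<close> Tw_id using g(1) by (rule_tac commute_one)
  next
    case (Cons k u)
    note R = red_Cons[OF Cons.prems(1)] and R0 = W0_red_Cons[OF Cons.prems(2,1)]
    have r: "root (iv w (rt k))" using R(1,2) by (simp add: W_root W_inv root_rt)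
    have "B (iv w (rt k)) \<theta> = B (rt k) \<theta>" using W_B[OF R(2), of "iv w (rt k)" \<theta>] R(2) Cons.prems(3) by (simp add: W_inv_apply)
    also have "\<dots> = - of_int (e k * A k 0)" using R(1) by (simp add: B_rt_left pr_theta)
    finally have B1: "B (iv w (rt k)) \<theta> = - of_int (e k * A k 0)" .
    have "B (\<lambda>l. - iv w (rt k) l) (\<lambda>l. - \<theta> l) \<le> 0"
    proof (rule P_B[OF uminus_theta_P])
      show "0 \<le> - iv w (rt k) l" for l using coherent[OF r R(4), of l] by simp
      show "- iv w (rt k) 0 = 0" using W0_0[OF W0_inv[OF Cons.prems(2)], of "rt k"] R0(1) by (simp add: rt_apply)
    qed
    moreover have "B (\<lambda>l. - iv w (rt k) l) (\<lambda>l. - \<theta> l) = B (iv w (rt k)) \<theta>" by (simp add: B_eq)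
    ultimately have "real_of_int (e k * A k 0) \<ge> 0" using B1 by linarith
    then have "e k * A k 0 \<ge> 0" by (simp only: of_int_0_le_iff)
    then have "A k 0 \<ge> 0" using e_pos[OF R(1)] by (simp add: zero_le_mult_iff)
    then have Ak: "A k 0 = 0" using offdiag[of k 0] R0(1) by simp
    have "s k \<theta> = \<theta>" using R(1) by (simp add: s_eq pr_theta Ak) (simp add: lc_def)
    then have "(s k \<circ> w) \<theta> = \<theta>" using Cons.prems(3) by simp
    then have "commute g (Tw (s k \<circ> w))" using Cons.IH[OF R(3) R0(2)] by blast
    moreover have "Tw w = T k \<otimes> Tw (s k \<circ> w)" by (rule Tw_left_neg[OF R(2,1,4)])
    ultimately show ?case using g(2)[OF R0(1) Ak] commute_mult by simp
  qed
qed

lemma Y_theta: "Y (\<lambda>k. - \<theta> k) = Tw (sref \<theta>) \<otimes> T 0"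
proof -
  have w: "sref \<theta> \<in> W" using W0_W W0_sref short_theta pos_theta by blast
  have "pos (sref \<theta> (rt 0))"
  proof (rule pos_if_coord[of _ 0])
    show "root (sref \<theta> (rt 0))" using w by (simp add: W_root root_rt)
    show "sref \<theta> (rt 0) 0 > 0" by (simp add: sref_def lc_def theta_apply rt_apply)
  qed
  then show ?thesis
    unfolding Y_P[OF uminus_theta_P] L_def trans_theta using w by (intro Tw_right_pos) auto
qed

end

section \<open>The image of the affine generator\<close>

text \<open>The reflection relations are split: for i > 0 the vector s_i \<beta> stays in the
  lattice, while s_0 \<beta> = \<beta> + \<alpha>_0 = \<beta> - \<theta> + \<delta>, whence the
  factor \<open>Z\<close>, which stands for X_\<delta>.\<close>

locale daag_rep = artin_short n A a e G T
  for n A a e and G :: "('g, 'm) monoid_scheme" (structure) and T +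
  fixes X :: "vec \<Rightarrow> 'g" and Z :: 'g
  assumes X_closed [simp, intro]: "\<beta> \<in> Q \<Longrightarrow> X \<beta> \<in> carrier G"
    and Z_closed [simp, intro]: "Z \<in> carrier G"
    and X_add: "\<beta> \<in> Q \<Longrightarrow> \<gamma> \<in> Q \<Longrightarrow> X (vadd \<beta> \<gamma>) = X \<beta> \<otimes> X \<gamma>"
    and Z_T: "i \<le> n \<Longrightarrow> Z \<otimes> T i = T i \<otimes> Z"
    and Z_X: "\<beta> \<in> Q \<Longrightarrow> Z \<otimes> X \<beta> = X \<beta> \<otimes> Z"
    and X_comm: "i \<le> n \<Longrightarrow> \<beta> \<in> Q \<Longrightarrow> pr i \<beta> = 0 \<Longrightarrow> T i \<otimes> X \<beta> = X \<beta> \<otimes> T i"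
    and X_refl: "i \<in> {1..n} \<Longrightarrow> \<beta> \<in> Q \<Longrightarrow> pr i \<beta> = -1 \<Longrightarrow> T i \<otimes> (X \<beta> \<otimes> T i) = X (s i \<beta>)"
    and X_refl0: "\<beta> \<in> Q \<Longrightarrow> pr 0 \<beta> = -1 \<Longrightarrow> T 0 \<otimes> (X \<beta> \<otimes> T 0) = X (lc \<beta> (-1) \<theta>) \<otimes> Z"
begin

lemma X_zero: "X (\<lambda>_. 0) = \<one>"
proof -
  have "X (\<lambda>_. 0) \<otimes> X (\<lambda>_. 0) = X (\<lambda>_. 0) \<otimes> \<one>"
    using X_add[OF Q_zero Q_zero] Q_zero by (simp add: vadd_def)
  then show ?thesis using Q_zero by simp
qed

lemma X_uminus: "\<beta> \<in> Q \<Longrightarrow> X (\<lambda>k. - \<beta> k) = inv X \<beta>"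
proof -
  assume b: "\<beta> \<in> Q"
  have "X (\<lambda>k. - \<beta> k) \<otimes> X \<beta> = \<one>"
    using X_add[OF Q_uminus[OF b] b] by (simp add: vadd_def X_zero)
  then show ?thesis using b inv_equality by (simp add: Q_uminus)
qed

lemma X_commute: "\<beta> \<in> Q \<Longrightarrow> \<gamma> \<in> Q \<Longrightarrow> commute (X \<beta>) (X \<gamma>)"
  using X_add[of \<beta> \<gamma>] X_add[of \<gamma> \<beta>] by (intro commuteI) (auto simp: vadd_def add.commute)

lemma X_comm': "i \<le> n \<Longrightarrow> \<beta> \<in> Q \<Longrightarrow> pr i \<beta> = 0 \<Longrightarrow> commute (T i) (X \<beta>)"
  using X_comm by (simp add: commute_def)

lemma s_uminus: "i \<le> n \<Longrightarrow> s i (\<lambda>k. - x k) = (\<lambda>k. - s i x k)"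
  using W_uminus[OF W_s] .

section \<open>Conjugation of the candidates for the affine generator\<close>

text \<open>The expression for the image of T_0 is formed for every short positive root, so that it
  can be carried from \<theta> down to a simple root, where it is T_k X_{-\<alpha>_k}.\<close>

definition R :: "vec \<Rightarrow> 'g" where
  "R \<gamma> = Tw (sref \<gamma>) \<otimes> X (\<lambda>k. - \<gamma> k)"

abbreviation S :: 'g where "S \<equiv> R \<theta>"

lemma short_D: "short \<gamma> \<Longrightarrow> \<gamma> \<in> Q"
  by (simp add: short_def)

lemma short_pos_Tw: "short \<gamma> \<Longrightarrow> pos \<gamma> \<Longrightarrow> Tw (sref \<gamma>) \<in> carrier G"
  using W0_sref W0_W by blast

lemma R_closed: "short \<gamma> \<Longrightarrow> pos \<gamma> \<Longrightarrow> R \<gamma> \<in> carrier G"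
  unfolding R_def using short_pos_Tw short_D Q_uminus by blast

text \<open>The right factor T_k of T_{s_\<gamma>} enters T_k X_{-\<gamma>} T_k, which the
  reflection relation turns into X_{-s_k \<gamma>}.\<close>

lemma R_step:
  assumes g: "short \<gamma>" "pos \<gamma>" and k: "k \<in> {1..n}" and p: "pr k \<gamma> = 1" and ne: "\<gamma> \<noteq> rt k"
  shows "R \<gamma> \<otimes> T k = T k \<otimes> R (s k \<gamma>)"
proof -
  have k': "k \<le> n" using k by simp
  have "pr k \<gamma> \<ge> 1" using p by simp
  note st = Tw_sref_step[OF g k this ne]
  have q: "(\<lambda>k. - \<gamma> k) \<in> Q" "(\<lambda>l. - s k \<gamma> l) \<in> Q" using g st short_D Q_uminus by blast+
  have "T k \<otimes> (X (\<lambda>k. - \<gamma> k) \<otimes> T k) = X (\<lambda>l. - s k \<gamma> l)"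
    using X_refl[OF k q(1)] p k' by (simp add: pr_uminus s_uminus)
  then show ?thesis
    unfolding R_def st(1) using q k' short_pos_Tw[OF st(2,3)] by (simp add: m_assoc)
qed

lemma R_comm:
  assumes g: "short \<gamma>" "pos \<gamma>" and k: "k \<in> {1..n}" and p: "pr k \<gamma> = 0"
  shows "commute (T k) (R \<gamma>)"
  unfolding R_def using assms Q_uminus short_D
  by (intro commute_mult Tw_sref_comm X_comm') (auto simp: pr_uminus)

lemma R_rt: "k \<in> {1..n} \<Longrightarrow> e k = 1 \<Longrightarrow> R (rt k) = T k \<otimes> X (\<lambda>l. - rt k l)"
  by (simp add: R_def sref_rt Tw_s)

text \<open>The hypothesis says that \<gamma> pairs to 0 or 1 with the coroots of the relevant
  inversions. Along a reduced word each letter therefore meets the current root with pairing 0,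
  where \<open>R_comm\<close> applies, or 1, where \<open>R_step\<close> applies.\<close>

lemma R_conj:
  assumes "w \<in> W0" "short \<gamma>" "pos \<gamma>"
    and "\<And>\<eta>. root \<eta> \<Longrightarrow> \<eta> 0 = 0 \<Longrightarrow> pos \<eta> \<Longrightarrow> \<not> pos (iv w \<eta>) \<Longrightarrow> \<eta> \<noteq> \<gamma> \<and> (B \<gamma> \<eta> = 0 \<or> 2 * B \<gamma> \<eta> = B \<eta> \<eta>)"
  shows "R \<gamma> \<otimes> Tw w = Tw w \<otimes> R (iv w \<gamma>) \<and> short (iv w \<gamma>) \<and> pos (iv w \<gamma>)"
proof -
  obtain js where "red w js" using red_ex W0_W assms(1) by blast
  then show ?thesis using assms
  proof (induction js arbitrary: w \<gamma>)
    case Nil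
    have w: "w = id" using Nil(1) by (simp only: red_Nil)
    show ?case unfolding w Tw_id using R_closed[OF Nil(3,4)] Nil(3,4) by simp
  next
    case (Cons k u)
    note R = red_Cons[OF Cons.prems(1)] and R0 = W0_red_Cons[OF Cons.prems(2,1)]
    have k: "k \<le> n" by fact
    have ek: "e k > 0" using e_pos[OF k] .
    define w' where "w' = s k \<circ> w"
    have w'W: "w' \<in> W" unfolding w'_def using R(1,2) by (intro W_comp W_s)
    have w: "w = s k \<circ> w'" unfolding w'_def by (simp only: s_s_comp(2)[OF k])
    have ivw: "iv w x = iv w' (s k x)" for x using inv_s_comp[OF w'W k] w by simp
    have Bk: "B \<gamma> (rt k) = of_int (e k) * pr k \<gamma>" "B (rt k) (rt k) = 2 * of_int (e k)"
      using k by (simp_all add: B_rt pr_rt diag)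
    have "rt k 0 = 0" using R0(1) by (simp add: rt_apply)
    then have ne: "rt k \<noteq> \<gamma>" and "B \<gamma> (rt k) = 0 \<or> 2 * B \<gamma> (rt k) = B (rt k) (rt k)"
      using Cons.prems(5)[OF root_rt[OF k] _ pos_rt R(4)] by blast+
    then have prk: "pr k \<gamma> = 0 \<or> pr k \<gamma> = 1" unfolding Bk using ek by auto
    have rg: "root \<gamma>" using Cons.prems short_root by blast
    have ps: "pos (s k \<gamma>)" using s_not_pos_imp[OF rg Cons.prems(4) k] ne by blast
    have sh: "short (s k \<gamma>)" using short_s Cons.prems R0 by blast
    have "R (s k \<gamma>) \<otimes> Tw w' = Tw w' \<otimes> R (iv w' (s k \<gamma>)) \<and> short (iv w' (s k \<gamma>)) \<and> pos (iv w' (s k \<gamma>))"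
    proof (rule Cons.IH)
      show "red w' u" "w' \<in> W0" unfolding w'_def using R(3) R0(2) by auto
      show "short (s k \<gamma>)" "pos (s k \<gamma>)" by fact+
      fix \<eta> assume h: "root \<eta>" "\<eta> 0 = 0" "pos \<eta>" "\<not> pos (iv w' \<eta>)"
      have "\<eta> \<noteq> rt k"
      proof
        assume "\<eta> = rt k"
        then have "iv w' \<eta> = (\<lambda>l. - iv w (rt k) l)"
          using ivw[of "rt k"] s_rt[OF k] W_uminus[OF W_inv[OF w'W], of "rt k"] by simp
        then have "pos (iv w' \<eta>)" using R(2,4) k by (simp add: pos_uminus W_root W_inv root_rt)
        then show False using h by simp
      qed
      \<comment> \<open>Reflecting by s_k turns the inversions for w' into inversions for w, so the
        hypothesis transfers.\<close>
      then have "pos (s k \<eta>)" using s_not_pos_imp[OF h(1,3) k] by blast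
      moreover have "root (s k \<eta>)" using h k by (simp add: root_s)
      moreover have "s k \<eta> 0 = 0" using h R0(1) by (simp add: s_eq lc_def rt_apply)
      moreover have "\<not> pos (iv w (s k \<eta>))" using h by (simp add: ivw s_s k)
      ultimately have "s k \<eta> \<noteq> \<gamma> \<and> (B \<gamma> (s k \<eta>) = 0 \<or> 2 * B \<gamma> (s k \<eta>) = B (s k \<eta>) (s k \<eta>))"
        using Cons.prems(5) by blast
      then show "\<eta> \<noteq> s k \<gamma> \<and> (B (s k \<gamma>) \<eta> = 0 \<or> 2 * B (s k \<gamma>) \<eta> = B \<eta> \<eta>)"
        using k by (auto simp: B_bilinear_s B_s s_s)
    qed
    then have IH: "R (s k \<gamma>) \<otimes> Tw w' = Tw w' \<otimes> R (iv w \<gamma>)" "short (iv w \<gamma>)" "pos (iv w \<gamma>)"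
      by (simp_all add: ivw)
    have Rk: "R \<gamma> \<otimes> T k = T k \<otimes> R (s k \<gamma>)"
    proof (cases "pr k \<gamma> = 1")
      case True then show ?thesis using R_step Cons.prems R0 ne by blast
    next
      case False
      then have p0: "pr k \<gamma> = 0" using prk by blast
      then have "s k \<gamma> = \<gamma>" using k by (simp add: s_eq lc_def)
      then show ?thesis using commute_eq[OF R_comm[OF Cons.prems(3,4) R0(1) p0]] by simp
    qed
    have c: "R \<gamma> \<in> carrier G" "R (s k \<gamma>) \<in> carrier G" "R (iv w \<gamma>) \<in> carrier G" "T k \<in> carrier G" "Tw w' \<in> carrier G"
      using R_closed Cons.prems sh ps IH k w'W by auto
    have "Tw w = T k \<otimes> Tw w'" unfolding w'_def by (rule Tw_left_neg[OF R(2,1,4)])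
    then have "R \<gamma> \<otimes> Tw w = (R \<gamma> \<otimes> T k) \<otimes> Tw w'" using c by (simp add: m_assoc)
    also have "\<dots> = T k \<otimes> (R (s k \<gamma>) \<otimes> Tw w')" unfolding Rk using c by (simp add: m_assoc)
    also have "\<dots> = Tw w \<otimes> R (iv w \<gamma>)" unfolding IH(1) \<open>Tw w = _\<close> using c by (simp add: m_assoc)
    finally show ?case using IH by simp
  qed
qed

lemma S_closed [simp, intro]: "S \<in> carrier G"
  using R_closed short_theta pos_theta .

lemma S_comm_T: "k \<in> {1..n} \<Longrightarrow> A k 0 = 0 \<Longrightarrow> commute S (T k)"
  using commute_sym[OF R_comm[OF short_theta pos_theta, of k]] by (simp add: pr_theta)

section \<open>Relations of S along a simple bond\<close>

definition \<theta>' :: "nat \<Rightarrow> vec" where "\<theta>' k = s k \<theta>"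

lemma sym0: "k \<le> n \<Longrightarrow> A 0 k = e k * A k 0"
  using sym[of 0 k] by (simp add: e_0)

context
  fixes k assumes k: "k \<in> {1..n}" and Ak0: "A k 0 = -1"
begin

lemma kn: "k \<le> n"
  using k by simp

lemma pr_k: "pr k \<theta> = 1"
  using kn by (simp add: pr_theta Ak0)

lemma theta'_eq: "\<theta>' k = lc \<theta> (-1) (rt k)"
  by (simp add: \<theta>'_def s_eq kn pr_k)

lemma B_theta_rt: "B \<theta> (rt k) = of_int (e k)"
  by (simp add: B_rt kn pr_k)

lemma B_theta_theta': "B \<theta> (\<theta>' k) = 2 - of_int (e k)"
  using short_theta by (simp add: theta'_eq lin B_theta_rt short_def)

lemma theta_ne: "\<theta> \<noteq> rt k"
proof
  assume "\<theta> = rt k"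
  then have "pr k \<theta> = 2" using kn by (simp add: pr_rt diag)
  then show False using pr_k by simp
qed

lemma Tw_theta: "Tw (sref \<theta>) = T k \<otimes> (Tw (sref (\<theta>' k)) \<otimes> T k)"
  and short': "short (\<theta>' k)" and pos': "pos (\<theta>' k)"
  using Tw_sref_step[OF short_theta pos_theta k _ theta_ne] pr_k by (simp_all add: \<theta>'_def)

lemma Q': "\<theta>' k \<in> Q" "(\<lambda>l. - \<theta>' k l) \<in> Q" "(\<lambda>l. - \<theta> l) \<in> Q"
  using short' Q_theta Q_uminus by (auto simp: short_def)

lemma Tw_closed': "Tw (sref (\<theta>' k)) \<in> carrier G" "Tw (sref \<theta>) \<in> carrier G"
  using short_pos_Tw short' pos' short_theta pos_theta by auto

lemma T_X_theta: "T k \<otimes> (X (\<lambda>l. - \<theta> l) \<otimes> T k) = X (\<lambda>l. - \<theta>' k l)"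
  using X_refl[OF k Q'(3)] by (simp add: pr_uminus pr_k s_uminus[OF kn] \<theta>'_def)

lemma T_X_theta': "T k \<otimes> X (\<lambda>l. - \<theta> l) = X (\<lambda>l. - \<theta>' k l) \<otimes> inv T k"
  using T_X_theta Q' kn by (intro inv_solve_right[THEN iffD2]) (auto simp: m_assoc)

lemma S_step: "S \<otimes> T k = T k \<otimes> R (\<theta>' k)"
  unfolding \<theta>'_def by (rule R_step[OF short_theta pos_theta k pr_k theta_ne])

lemma Y_theta': "Y (\<lambda>l. - \<theta>' k l) = inv T k \<otimes> (Y (\<lambda>l. - \<theta> l) \<otimes> inv T k)"
  using Y_refl[OF Q'(3) k] by (simp add: pr_uminus pr_k s_uminus[OF kn] \<theta>'_def)

text \<open>Of the two factors T_k in T_{s_\<theta>}, the left one cancels in T_k^{-1} Y_{-\<theta>}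
  T_k^{-1} and the right one remains to conjugate T_0.\<close>

lemma Y_theta'_eq: "Y (\<lambda>l. - \<theta>' k l) = Tw (sref (\<theta>' k)) \<otimes> (T k \<otimes> (T 0 \<otimes> inv T k))"
  unfolding Y_theta' Y_theta Tw_theta using kn Tw_closed' by (simp add: m_assoc)

end

text \<open>The pairings of \<open>\<theta>\<close> with the coroots of the inversions of \<open>s\<^bsub>\<theta>'\<^esub>\<close> are \<open>0\<close> or \<open>1\<close>
  because \<open>\<theta>\<close> is short and dominant.\<close>

lemma S_conj:
  assumes k: "k \<in> {1..n}" and Ak0: "A k 0 = -1" and A0k: "A 0 k = -1"
  shows "S \<otimes> Tw (sref (\<theta>' k)) = Tw (sref (\<theta>' k)) \<otimes> (T k \<otimes> X (\<lambda>l. - rt k l))" and "e k = 1"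
proof -
  have kn: "k \<le> n" using k by simp
  show ek: "e k = 1" using sym0[OF kn] Ak0 A0k by simp
  define w where "w = sref (\<theta>' k)"
  have w0: "w \<in> W0" unfolding w_def using W0_sref short' pos' k Ak0 by blast
  have ivw: "iv w = w" unfolding w_def using iv_sref short' k Ak0 by blast
  have Btt: "B \<theta> (\<theta>' k) = 1" using B_theta_theta'[OF k Ak0] ek by simp
  \<comment> \<open>Since (\<theta>, \<theta>') = 1, the reflection takes \<theta> to \<theta> -
    \<theta>', and the conjugation ends at a simple root.\<close>
  have wt: "w \<theta> = rt k" unfolding w_def sref_def Btt by (simp add: theta'_eq[OF k Ak0]) (simp add: lc_def)
  have "S \<otimes> Tw w = Tw w \<otimes> R (iv w \<theta>) \<and> short (iv w \<theta>) \<and> pos (iv w \<theta>)"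
  proof (rule R_conj[OF w0 short_theta pos_theta])
    fix \<eta> assume h: "root \<eta>" "\<eta> 0 = 0" "pos \<eta>" "\<not> pos (iv w \<eta>)"
    have ne: "\<eta> \<noteq> \<theta>" using h(4) wt pos_rt unfolding ivw by metis
    obtain i where i: "i \<le> n" "root_of i \<eta>" using h root_def by blast
    have ei: "e i > 0" using e_pos i by blast
    have Bh: "B \<eta> \<eta> = 2 * of_int (e i)" using i by (simp add: root_of_def)
    have "B \<theta> \<eta> / of_int (e i) = - (of_int (e 0) * pr 0 \<eta> / of_int (e i))" by (simp add: B_sym[of \<theta>] B_theta e_0)
    then have "B \<theta> \<eta> / of_int (e i) \<in> \<int>"
      using pr_scaled_Ints[of i \<eta> 0] i by (simp add: root_of_def)
    then obtain z where z: "B \<theta> \<eta> / of_int (e i) = of_int z" by (metis Ints_cases)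
    then have Bz: "B \<theta> \<eta> = of_int (e i) * of_int z" using ei by (simp add: field_simps)
    have "B \<theta> \<eta> = (\<Sum>j\<le>n. \<eta> j * of_int (e j) * pr j \<theta>)" by (subst B_sym) (rule B_pr_sum)
    also have "\<dots> \<ge> 0"
    proof (rule sum_nonneg)
      fix j assume j: "j \<in> {..n}"
      show "0 \<le> \<eta> j * of_int (e j) * pr j \<theta>"
      proof (cases "j = 0")
        case True then show ?thesis using h by simp
      next
        case False
        then have "A j 0 \<le> 0" using offdiag[of j 0] j by simp
        then have "pr j \<theta> \<ge> 0" using j by (simp add: pr_theta)
        moreover have "\<eta> j \<ge> 0" using h by (simp add: pos_def)
        moreover have "real_of_int (e j) \<ge> 0" using e_pos[of j] j by simp
        ultimately show ?thesis by simp
      qed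
    qed
    finally have "z \<ge> 0" using ei Bz by (simp add: zero_le_mult_iff)
    \<comment> \<open>Semidefiniteness bounds the pairing z. If z were at least 2, the norm 2 + 2
      e_i - 2 e_i z of \<theta> - \<eta> would have to be 0, and this difference, vanishing at the
      affine node, would be 0.\<close>
    define d where "d = lc \<theta> (-1) \<eta>"
    have "B d d = 2 + 2 * of_int (e i) - 2 * B \<theta> \<eta>"
      using short_theta Bh by (simp add: d_def lin short_def B_sym[of \<eta> \<theta>])
    then have Bd: "B d d = of_int (2 + 2 * e i - 2 * (e i * z))" by (simp add: Bz)
    have "z < 2"
    proof (rule ccontr)
      assume "\<not> z < 2"
      then have "e i * z \<ge> e i * 2" using ei by simp
      moreover have "2 + 2 * e i - 2 * (e i * z) \<ge> 0" using B_nonneg[of d] Bd by linarith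
      ultimately have "e i = 1" "2 + 2 * e i - 2 * (e i * z) = 0" using ei by linarith+
      then have "B d d = 0" using Bd by simp
      then obtain c where c: "\<forall>j\<le>n. d j = c * \<delta> j" using B_zero by blast
      have "d 0 = 0" using h by (simp add: d_def lc_def theta_apply)
      then have "c = 0" using c by (simp add: delta_apply a_0)
      then have "d j = 0" if "j \<le> n" for j using c that by simp
      moreover have "d j = 0" if "j > n" for j
        using that i by (simp add: d_def lc_def theta_apply root_of_def integral_for_def)
      ultimately have "d j = 0" for j by (cases "j \<le> n") auto
      then have "\<theta> = \<eta>" by (simp add: d_def lc_def fun_eq_iff)
      then show False using ne by simp
    qed
    then have "z = 0 \<or> z = 1" using \<open>z \<ge> 0\<close> by linarith
    then show "\<eta> \<noteq> \<theta> \<and> (B \<theta> \<eta> = 0 \<or> 2 * B \<theta> \<eta> = B \<eta> \<eta>)" using ne Bz Bh by auto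
  qed
  then show "S \<otimes> Tw (sref (\<theta>' k)) = Tw (sref (\<theta>' k)) \<otimes> (T k \<otimes> X (\<lambda>l. - rt k l))"
    using R_rt[OF k ek] unfolding ivw wt unfolding w_def by simp
qed

text \<open>\<open>braid_of_conjugates\<close> applies with r = R_{\<theta>'}, t = T_k^{-1} and u =
  S. One equation is \<open>S_step\<close>; the other comes from \<open>S_conj\<close> on splitting
  X_{-\<alpha>_k} into X_{-\<theta>} X_{\<theta>'}.\<close>

lemma S_braid3:
  assumes k: "k \<in> {1..n}" and Ak0: "A k 0 = -1" and A0k: "A 0 k = -1"
  shows "S \<otimes> (inv T k \<otimes> S) = inv T k \<otimes> (S \<otimes> inv T k)"
proof -
  have kn: "k \<le> n" using k by simp
  let ?q = "Tw (sref (\<theta>' k))" and ?x' = "X (\<lambda>l. - \<theta>' k l)"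
  have R': "R (\<theta>' k) = ?q \<otimes> ?x'" by (simp add: R_def)
  have q: "?q \<in> carrier G" and Q: "\<theta>' k \<in> Q" "(\<lambda>l. - \<theta>' k l) \<in> Q" "(\<lambda>l. - \<theta> l) \<in> Q" "(\<lambda>l. - rt k l) \<in> Q"
    using Tw_closed'[OF k Ak0] Q'[OF k Ak0] Q_uminus[OF Q_rt[OF k]] by auto
  have "(\<lambda>l. - rt k l) = vadd (\<lambda>l. - \<theta> l) (\<theta>' k)" by (simp add: theta'_eq[OF k Ak0] vadd_def lc_def)
  then have "T k \<otimes> X (\<lambda>l. - rt k l) = (T k \<otimes> X (\<lambda>l. - \<theta> l)) \<otimes> X (\<theta>' k)"
    using Q kn by (simp add: X_add m_assoc)
  also have "\<dots> = ?x' \<otimes> (inv T k \<otimes> X (\<theta>' k))" unfolding T_X_theta'[OF k Ak0] using Q kn by (simp add: m_assoc)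
  finally have Rk: "T k \<otimes> X (\<lambda>l. - rt k l) = ?x' \<otimes> (inv T k \<otimes> X (\<theta>' k))" .
  have inv': "X (\<theta>' k) \<otimes> ?x' = \<one>" using Q by (simp add: X_uminus)
  have "S \<otimes> R (\<theta>' k) = (S \<otimes> ?q) \<otimes> ?x'" unfolding R' using q Q by (simp add: m_assoc)
  also have "\<dots> = ?q \<otimes> (?x' \<otimes> (inv T k \<otimes> (X (\<theta>' k) \<otimes> ?x')))"
    unfolding S_conj(1)[OF assms] Rk using q Q kn by (simp add: m_assoc)
  also have "\<dots> = R (\<theta>' k) \<otimes> inv T k" unfolding inv' R' using q Q kn by (simp add: m_assoc)
  finally have 2: "S \<otimes> R (\<theta>' k) = R (\<theta>' k) \<otimes> inv T k" .
  have Rc: "R (\<theta>' k) \<in> carrier G" unfolding R' using q Q by simp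
  have "inv T k \<otimes> S = inv T k \<otimes> (S \<otimes> T k) \<otimes> inv T k" using kn by (simp add: m_assoc)
  also have "\<dots> = R (\<theta>' k) \<otimes> inv T k" unfolding S_step[OF k Ak0] using kn Rc by (simp add: m_assoc)
  finally have 1: "inv T k \<otimes> S = R (\<theta>' k) \<otimes> inv T k" .
  show ?thesis by (rule braid_of_conjugates[OF Rc _ _ 1 2]) (use kn in auto)
qed

text \<open>Writing Y_{\<alpha>_k} as Y_{-\<theta>'} times the inverse of Y_{-\<theta>} lets
  T_{s_\<theta>} cancel against that of the right factor S. The braid relation of T_0 and T_k
  shortens what remains, and \<open>S_conj\<close> removes the left S.\<close>

lemma S_Y_base:
  assumes k: "k \<in> {1..n}" and Ak0: "A k 0 = -1" and A0k: "A 0 k = -1"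
  shows "S \<otimes> (Y (rt k) \<otimes> S) = Y (\<lambda>l. - \<theta>' k l) \<otimes> inv Z"
proof -
  have kn: "k \<le> n" using k by simp
  let ?q = "Tw (sref (\<theta>' k))" and ?t = "Tw (sref \<theta>)" and ?x' = "X (\<lambda>l. - \<theta>' k l)" and ?xm = "X (\<lambda>l. - \<theta> l)"
    and ?p = "Y (\<lambda>l. - \<theta> l)" and ?y' = "Y (\<lambda>l. - \<theta>' k l)"
  have Q: "\<theta>' k \<in> Q" "(\<lambda>l. - \<theta>' k l) \<in> Q" "(\<lambda>l. - \<theta> l) \<in> Q" "rt k \<in> Q"
    using Q'[OF k Ak0] Q_rt[OF k] by auto
  have c [simp]: "?q \<in> carrier G" "?t \<in> carrier G" "?x' \<in> carrier G" "?xm \<in> carrier G" "?p \<in> carrier G"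
    "?y' \<in> carrier G" "Y (rt k) \<in> carrier G" "X (rt k) \<in> carrier G" "T k \<in> carrier G"
    using Tw_closed'[OF k Ak0] Q kn by auto
  have "(\<lambda>l. - \<theta>' k l) = vadd (rt k) (\<lambda>l. - \<theta> l)" by (simp add: theta'_eq[OF k Ak0] vadd_def lc_def)
  then have "?y' = Y (rt k) \<otimes> ?p" using Q Y_add by simp
  then have Yk: "Y (rt k) = ?y' \<otimes> inv ?p" by (simp add: m_assoc)
  have S: "S = ?t \<otimes> ?xm" by (simp add: R_def)
  have "inv ?p \<otimes> S = inv (T 0) \<otimes> ?xm"
    unfolding S Y_theta by (simp add: inv_mult_group m_assoc)
  then have "S \<otimes> (Y (rt k) \<otimes> S) = S \<otimes> (?y' \<otimes> (inv (T 0) \<otimes> ?xm))"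
    unfolding Yk by (simp add: m_assoc)
  also have "\<dots> = S \<otimes> (?q \<otimes> ((T k \<otimes> (T 0 \<otimes> (inv T k \<otimes> inv (T 0)))) \<otimes> ?xm))"
    unfolding Y_theta'_eq[OF k Ak0] by (simp add: m_assoc)
  also have "T k \<otimes> (T 0 \<otimes> (inv T k \<otimes> inv (T 0))) = inv (T 0) \<otimes> T k"
  proof -
    have "T 0 \<otimes> (T k \<otimes> T 0) = T k \<otimes> (T 0 \<otimes> T k)"
      using T_braid[of 0 k 3] kn k Ak0 A0k by (simp add: alt_num braid_lengths_def)
    then have "T k \<otimes> T 0 = inv (T 0) \<otimes> (T k \<otimes> (T 0 \<otimes> T k))" by (metis T_closed c(9) inv_mult_cancel(1) le0 m_closed)
    then have "(T k \<otimes> T 0) \<otimes> (inv T k \<otimes> inv (T 0)) = inv (T 0) \<otimes> (T k \<otimes> (T 0 \<otimes> T k)) \<otimes> (inv T k \<otimes> inv (T 0))" by simp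
    then show ?thesis by (simp add: m_assoc)
  qed
  also have "inv (T 0) \<otimes> T k \<otimes> ?xm = inv (T 0) \<otimes> (?x' \<otimes> inv T k)"
    using T_X_theta'[OF k Ak0] by (simp add: m_assoc)
  \<comment> \<open>The affine reflection relation at \<alpha>_k brings in X_\<delta> here, and it
    appears inverted.\<close>
  also have "\<dots> = X (rt k) \<otimes> (T 0 \<otimes> (inv Z \<otimes> inv T k))"
  proof -
    have p0: "pr 0 (rt k) = -1" using kn A0k by (simp add: pr_rt)
    have "lc (rt k) (-1) \<theta> = (\<lambda>l. - \<theta>' k l)" by (simp add: theta'_eq[OF k Ak0] lc_def)
    then have "T 0 \<otimes> (X (rt k) \<otimes> T 0) = ?x' \<otimes> Z" using X_refl0[OF Q(4) p0] by simp
    then have "?x' = T 0 \<otimes> (X (rt k) \<otimes> T 0) \<otimes> inv Z" by (simp add: m_assoc)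
    then show ?thesis by (simp add: m_assoc)
  qed
  also have "S \<otimes> (?q \<otimes> (X (rt k) \<otimes> (T 0 \<otimes> (inv Z \<otimes> inv T k))))
      = (S \<otimes> ?q) \<otimes> (X (rt k) \<otimes> (T 0 \<otimes> (inv Z \<otimes> inv T k)))" by (simp add: m_assoc)
  also have "\<dots> = ?q \<otimes> (T k \<otimes> (T 0 \<otimes> (inv Z \<otimes> inv T k)))"
    unfolding S_conj(1)[OF assms] using Q X_uminus[OF Q(4)] by (simp add: m_assoc)
  also have "inv Z \<otimes> inv T k = inv T k \<otimes> inv Z"
    using commute_eq[OF commute_inv_left[OF commute_inv[OF commuteI[OF Z_closed _ Z_T[OF kn]]]]] by simp
  finally show ?thesis unfolding Y_theta'_eq[OF k Ak0] by (simp add: m_assoc)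
qed

section \<open>Relations of S with the elements Y\<close>

text \<open>\<open>M0\<close> and \<open>M1\<close> collect the weights for which the images of the
  relations between T_0 and X hold. \<open>M0\<close> is a lattice and \<open>M1\<close> is empty or
  a coset of it, so few weights have to be treated by hand.\<close>

definition M0 :: "vec set" where
  "M0 = {\<beta> \<in> Q. pr 0 \<beta> = 0 \<and> commute S (Y \<beta>)}"

definition M1 :: "vec set" where
  "M1 = {\<beta> \<in> Q. pr 0 \<beta> = -1 \<and> S \<otimes> (Y \<beta> \<otimes> S) = Y (lc \<beta> (-1) \<theta>) \<otimes> inv Z}"

lemma Y_uminus: "\<beta> \<in> Q \<Longrightarrow> Y (\<lambda>k. - \<beta> k) = inv Y \<beta>"
proof -
  assume b: "\<beta> \<in> Q"
  have "Y (\<lambda>k. - \<beta> k) \<otimes> Y \<beta> = \<one>"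
    using Y_add[OF Q_uminus[OF b] b] by (simp add: vadd_def Y_zero)
  then show ?thesis using b inv_equality by (simp add: Q_uminus)
qed

lemma Y_diff: "\<beta> \<in> Q \<Longrightarrow> \<gamma> \<in> Q \<Longrightarrow> Y (lc \<beta> (-1) \<gamma>) = Y \<beta> \<otimes> inv Y \<gamma>"
proof -
  assume b: "\<beta> \<in> Q" "\<gamma> \<in> Q"
  have "lc \<beta> (-1) \<gamma> = vadd \<beta> (\<lambda>k. - \<gamma> k)" by (simp add: lc_def vadd_def)
  then show ?thesis using b by (simp add: Y_add Q_uminus Y_uminus)
qed

lemma M0_closed: "lattice_closed M0"
  unfolding lattice_closed_def
proof (intro conjI ballI)
  show "(\<lambda>_. 0) \<in> M0" by (simp add: M0_def Q_zero pr_zero Y_zero commute_one)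
  fix x y assume "x \<in> M0" "y \<in> M0"
  then have xy: "x \<in> Q" "y \<in> Q" "pr 0 x = 0" "pr 0 y = 0" "commute S (Y x)" "commute S (Y y)" by (auto simp: M0_def)
  have "commute S (Y (lc x 1 y))"
    unfolding vadd_eq_lc[symmetric] Y_add[OF xy(1,2)] using xy by (intro commute_mult)
  then show "lc x 1 y \<in> M0" using xy by (simp add: M0_def Q_lc pr_lc)
  show "lc x (-1) y \<in> M0" using xy by (simp add: M0_def Q_lc pr_lc Y_diff commute_mult commute_inv)
qed

lemma M1_diff: "\<beta> \<in> M1 \<Longrightarrow> \<gamma> \<in> M1 \<Longrightarrow> lc \<beta> (-1) \<gamma> \<in> M0"
proof -
  assume "\<beta> \<in> M1" "\<gamma> \<in> M1"
  then have q: "\<beta> \<in> Q" "\<gamma> \<in> Q" "lc \<beta> (-1) \<theta> \<in> Q" "lc \<gamma> (-1) \<theta> \<in> Q" "pr 0 \<beta> = -1" "pr 0 \<gamma> = -1"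
    and b: "S \<otimes> (Y \<beta> \<otimes> S) = Y (lc \<beta> (-1) \<theta>) \<otimes> inv Z" and g: "S \<otimes> (Y \<gamma> \<otimes> S) = Y (lc \<gamma> (-1) \<theta>) \<otimes> inv Z"
    by (auto simp: M1_def Q_lc Q_theta)
  have c [simp]: "Y \<beta> \<in> carrier G" "Y \<gamma> \<in> carrier G" using q by auto
  have eq: "lc \<beta> (-1) \<gamma> = lc (lc \<beta> (-1) \<theta>) (-1) (lc \<gamma> (-1) \<theta>)" by (simp add: lc_def)
  have "S \<otimes> (Y (lc \<beta> (-1) \<gamma>) \<otimes> inv S) = (S \<otimes> (Y \<beta> \<otimes> S)) \<otimes> inv (S \<otimes> (Y \<gamma> \<otimes> S))"
    using q by (simp add: Y_diff inv_mult_group m_assoc)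
  also have "\<dots> = Y (lc \<beta> (-1) \<gamma>)"
    unfolding b g eq Y_diff[OF q(3,4)] using q by (simp add: inv_mult_group m_assoc)
  finally have "S \<otimes> (Y (lc \<beta> (-1) \<gamma>) \<otimes> inv S) \<otimes> S = Y (lc \<beta> (-1) \<gamma>) \<otimes> S" by simp
  moreover have d: "lc \<beta> (-1) \<gamma> \<in> Q" using q by (simp add: Q_lc)
  ultimately have "commute S (Y (lc \<beta> (-1) \<gamma>))" by (intro commuteI) (auto simp: m_assoc)
  then show ?thesis using q d by (simp add: M0_def pr_lc)
qed

lemma M1_add: "\<beta> \<in> M1 \<Longrightarrow> \<gamma> \<in> M0 \<Longrightarrow> lc \<beta> 1 \<gamma> \<in> M1"
proof -
  assume "\<beta> \<in> M1" "\<gamma> \<in> M0"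
  then have q: "\<beta> \<in> Q" "\<gamma> \<in> Q" "lc \<beta> (-1) \<theta> \<in> Q" "pr 0 \<beta> = -1" "pr 0 \<gamma> = 0"
    and b: "S \<otimes> (Y \<beta> \<otimes> S) = Y (lc \<beta> (-1) \<theta>) \<otimes> inv Z" and g: "commute S (Y \<gamma>)"
    by (auto simp: M1_def M0_def Q_lc Q_theta)
  have c [simp]: "Y \<beta> \<in> carrier G" "Y \<gamma> \<in> carrier G" using q by auto
  have eq: "lc \<beta> 1 \<gamma> = vadd \<gamma> \<beta>" "lc (lc \<beta> 1 \<gamma>) (-1) \<theta> = vadd \<gamma> (lc \<beta> (-1) \<theta>)"
    by (simp_all add: lc_def vadd_def algebra_simps)
  have "S \<otimes> (Y (lc \<beta> 1 \<gamma>) \<otimes> S) = Y \<gamma> \<otimes> (S \<otimes> (Y \<beta> \<otimes> S))"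
    unfolding eq(1) using q commute_eq'[OF g, of "Y \<beta> \<otimes> S"] by (simp add: Y_add m_assoc)
  also have "\<dots> = Y (lc (lc \<beta> 1 \<gamma>) (-1) \<theta>) \<otimes> inv Z"
    unfolding b eq(2) using q by (simp add: Y_add m_assoc)
  finally show ?thesis using q by (simp add: M1_def Q_lc pr_lc)
qed

text \<open>For a_{j0} = 0 the element T_j commutes with S, so Lusztig's relation carries the
  commutation from \<beta> to s_j \<beta>.\<close>

lemma M0_s: "\<beta> \<in> M0 \<Longrightarrow> j \<in> {1..n} \<Longrightarrow> A j 0 = 0 \<Longrightarrow> pr j \<beta> = -1 \<Longrightarrow> s j \<beta> \<in> M0"
proof -
  assume b: "\<beta> \<in> M0" and j: "j \<in> {1..n}" "A j 0 = 0" and p: "pr j \<beta> = -1"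
  then have q: "\<beta> \<in> Q" "pr 0 \<beta> = 0" "commute S (Y \<beta>)" by (auto simp: M0_def)
  have "commute S (inv T j)" using S_comm_T[OF j] by (rule commute_inv)
  then have "commute S (inv T j \<otimes> (Y \<beta> \<otimes> inv T j))" using q by (intro commute_mult)
  then have "commute S (Y (s j \<beta>))" unfolding Y_refl[OF q(1) j(1) p] .
  moreover have "A 0 j = 0" using zero_iff j by auto
  ultimately show ?thesis using q j Q_s p by (simp add: M0_def pr_s)
qed

lemma M1_s: "\<beta> \<in> M1 \<Longrightarrow> j \<in> {1..n} \<Longrightarrow> A j 0 = 0 \<Longrightarrow> pr j \<beta> = -1 \<Longrightarrow> s j \<beta> \<in> M1"
proof -
  assume "\<beta> \<in> M1" and j: "j \<in> {1..n}" "A j 0 = 0" and p: "pr j \<beta> = -1"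
  then have q: "\<beta> \<in> Q" "lc \<beta> (-1) \<theta> \<in> Q" "pr 0 \<beta> = -1" and b: "S \<otimes> (Y \<beta> \<otimes> S) = Y (lc \<beta> (-1) \<theta>) \<otimes> inv Z"
    by (auto simp: M1_def Q_lc Q_theta)
  have jn: "j \<le> n" using j by simp
  have c [simp]: "Y \<beta> \<in> carrier G" "T j \<in> carrier G" "Y (lc \<beta> (-1) \<theta>) \<in> carrier G" using q jn by auto
  have cS: "commute S (inv T j)" using S_comm_T[OF j] by (rule commute_inv)
  have p': "pr j (lc \<beta> (-1) \<theta>) = -1" using p j jn by (simp add: pr_lc pr_theta)
  have "s j \<theta> = \<theta>" using jn j by (simp add: s_eq pr_theta) (simp add: lc_def)
  then have s': "s j (lc \<beta> (-1) \<theta>) = lc (s j \<beta>) (-1) \<theta>" using jn by (simp add: s_lc)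
  have "S \<otimes> (Y (s j \<beta>) \<otimes> S) = S \<otimes> (inv T j \<otimes> (Y \<beta> \<otimes> (inv T j \<otimes> S)))"
    unfolding Y_refl[OF q(1) j(1) p, symmetric] by (simp add: m_assoc)
  also have "\<dots> = inv T j \<otimes> ((S \<otimes> (Y \<beta> \<otimes> S)) \<otimes> inv T j)"
    using commute_eq'[OF cS] commute_eq[OF cS, symmetric] by (simp add: m_assoc)
  also have "\<dots> = inv T j \<otimes> (Y (lc \<beta> (-1) \<theta>) \<otimes> inv T j) \<otimes> inv Z"
    unfolding b using commute_eq[OF commute_inv_left[OF commute_inv[OF commuteI[OF Z_closed _ Z_T[OF jn]]]]]
    by (simp add: m_assoc)
  also have "\<dots> = Y (lc (s j \<beta>) (-1) \<theta>) \<otimes> inv Z"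
    unfolding Y_refl[OF q(2) j(1) p'] s' ..
  finally have "S \<otimes> (Y (s j \<beta>) \<otimes> S) = Y (lc (s j \<beta>) (-1) \<theta>) \<otimes> inv Z" .
  moreover have "A 0 j = 0" using zero_iff j by auto
  ultimately show ?thesis using q j Q_s p by (simp add: M1_def pr_s)
qed

lemma simply_laced_adj:
  assumes simply_laced_at_0 "k \<in> {1..n}" "A 0 k \<noteq> 0"
  shows "A 0 k = -1" "A k 0 = -1"
proof -
  show "A 0 k = -1" using assms unfolding simply_laced_at_0_def by blast
  then have "e k * A k 0 = -1" using sym0 assms by simp
  then show "A k 0 = -1" using e_pos[of k] assms(2) by (auto simp: zmult_eq_neg1_iff)
qed

lemma simply_laced_ex: "simply_laced_at_0 \<Longrightarrow> \<exists>k\<in>{1..n}. A 0 k = -1 \<and> A k 0 = -1"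
proof -
  assume k1: simply_laced_at_0
  have "{0} \<noteq> {..n}" using n_pos by (metis atMost_iff order_refl singletonD not_one_le_zero)
  then obtain j where "j \<in> {..n} - {0}" "A 0 j \<noteq> 0" using irrD[of "{0}"] by auto
  then show ?thesis using simply_laced_adj[OF k1, of j] by auto
qed

text \<open>The neighbours of the affine node come from \<open>S_Y_base\<close>. From there one
  passes from i to j by s_j \<alpha>_i = \<alpha>_i + \<alpha>_j; even when \<alpha>_i lies in
  \<open>M1\<close>, the difference of the two vectors lies in \<open>M0\<close>.\<close>

lemma simply_laced_M:
  assumes k1: simply_laced_at_0 and j: "j \<in> {1..n}"
  shows "(A 0 j = -1 \<longrightarrow> rt j \<in> M1) \<and> (A 0 j = 0 \<longrightarrow> rt j \<in> M0)"
proof -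
  have adj: "rt k \<in> M1" if k: "k \<in> {1..n}" "A 0 k = -1" for k
  proof -
    have Ak: "A k 0 = -1" using simply_laced_adj[OF k1 k(1)] k by simp
    have "lc (rt k) (-1) \<theta> = (\<lambda>l. - \<theta>' k l)" by (simp add: theta'_eq[OF k(1) Ak] lc_def)
    then show ?thesis using S_Y_base[OF k(1) Ak k(2)] k by (simp add: M1_def Q_rt pr_rt)
  qed
  define J where "J = {j\<in>{1..n}. (A 0 j = -1 \<longrightarrow> rt j \<in> M1) \<and> (A 0 j = 0 \<longrightarrow> rt j \<in> M0)}"
  have "J \<subseteq> {1..n} \<and> (\<forall>k\<in>{1..n}. A k 0 = -1 \<longrightarrow> k \<in> J) \<and>
      (\<forall>i\<in>J. \<forall>j\<in>{1..n}. A j i = -1 \<longrightarrow> j \<in> J)"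
  proof (intro conjI ballI impI)
    show "J \<subseteq> {1..n}" by (auto simp: J_def)
  next
    fix k assume k: "k \<in> {1..n}" "A k 0 = -1"
    then have "A 0 k \<noteq> 0" using zero_iff[of 0 k] by simp
    then show "k \<in> J" using adj k by (simp add: J_def)
  next
    fix i j assume i: "i \<in> J" and j: "j \<in> {1..n}" and Aji: "A j i = -1"
    have i': "i \<in> {1..n}" using i by (simp add: J_def)
    show "j \<in> J"
    proof (cases "A 0 j = 0")
      case False
      then show ?thesis using adj j by (simp add: J_def)
    next
      case True
      have Aj0: "A j 0 = 0" using True zero_iff[of 0 j] j by simp
      have jn: "j \<le> n" using j by simp
      have p: "pr j (rt i) = -1" using Aji i' by (simp add: pr_rt)
      have sj: "s j (rt i) = lc (rt i) 1 (rt j)" unfolding s_eq[OF jn] p by simp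
      have "rt j \<in> M0"
      proof (cases "A 0 i = 0")
        case True
        then have m: "rt i \<in> M0" using i by (simp add: J_def)
        then have "lc (rt i) 1 (rt j) \<in> M0" using M0_s[OF m j Aj0 p] unfolding sj by simp
        then show ?thesis using lattice_closed_diff[OF M0_closed m] by blast
      next
        case False
        then have m: "rt i \<in> M1" using i i' simply_laced_adj[OF k1 i'] by (simp add: J_def)
        then have "lc (rt i) 1 (rt j) \<in> M1" using M1_s[OF m j Aj0 p] unfolding sj by simp
        from M1_diff[OF this m] show ?thesis by (simp add: lc_def)
      qed
      then show ?thesis using True j by (simp add: J_def)
    qed
  qed
  then have "J = {1..n}" using k1 unfolding simply_laced_at_0_def by blast
  then have "j \<in> J" using j by simp
  then show ?thesis by (simp add: J_def)
qed

text \<open>A neighbour \<alpha>_k of the affine node has pairing -1, so x + (x, \<alpha>_0^vee)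
  \<alpha>_k has pairing 0. That this corrected vector lies in \<open>M0\<close> is a condition
  closed under sums and differences, which can be checked on simple roots.\<close>

lemma simply_laced_final:
  assumes k1: simply_laced_at_0 and b: "\<beta> \<in> Q"
  shows "pr 0 \<beta> = 0 \<Longrightarrow> \<beta> \<in> M0" and "pr 0 \<beta> = -1 \<Longrightarrow> \<beta> \<in> M1"
proof -
  obtain k where k: "k \<in> {1..n}" "A 0 k = -1" using simply_laced_ex[OF k1] by blast
  have kM: "rt k \<in> M1" using simply_laced_M[OF k1 k(1)] k by blast
  define M where "M = {x. lc x (pr 0 x) (rt k) \<in> M0}"
  have "lattice_closed M"
    unfolding lattice_closed_def
  proof (intro conjI ballI)
    have "lc (\<lambda>_. 0) (pr 0 (\<lambda>_. 0)) (rt k) = (\<lambda>_. 0)" by (simp add: pr_zero lc_def)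
    then show "(\<lambda>_. 0) \<in> M" using M0_closed by (simp add: M_def lattice_closed_def)
    fix x y assume "x \<in> M" "y \<in> M"
    then have m: "lc x (pr 0 x) (rt k) \<in> M0" "lc y (pr 0 y) (rt k) \<in> M0" by (auto simp: M_def)
    have 1: "lc (lc x (pr 0 x) (rt k)) c (lc y (pr 0 y) (rt k)) = lc (lc x c y) (pr 0 (lc x c y)) (rt k)" for c
      by (simp add: pr_lc) (simp add: lc_def algebra_simps)
    show "lc x 1 y \<in> M" "lc x (-1) y \<in> M"
      using M0_closed m unfolding M_def mem_Collect_eq 1[symmetric] lattice_closed_def by blast+
  qed
  moreover have "rt j \<in> M" if j: "j \<in> {1..n}" for j
  proof (cases "A 0 j = 0")
    case True
    then have "pr 0 (rt j) = 0" using j by (simp add: pr_rt)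
    moreover have "rt j \<in> M0" using simply_laced_M[OF k1 j] True by blast
    ultimately show ?thesis by (simp add: M_def lc_def)
  next
    case False
    then have A: "A 0 j = -1" using simply_laced_adj[OF k1 j] by blast
    then have "pr 0 (rt j) = -1" using j by (simp add: pr_rt)
    moreover have "rt j \<in> M1" using simply_laced_M[OF k1 j] A by blast
    ultimately show ?thesis using M1_diff kM by (simp add: M_def)
  qed
  ultimately have bM: "\<beta> \<in> M" using lattice_gen[of M n \<beta>] b Q_D(3) by blast
  show "\<beta> \<in> M0" if "pr 0 \<beta> = 0" using bM that by (simp add: M_def lc_def)
  show "\<beta> \<in> M1" if "pr 0 \<beta> = -1"
  proof -
    have "lc \<beta> (-1) (rt k) \<in> M0" using bM that by (simp add: M_def)
    from M1_add[OF kM this] show ?thesis by (simp add: lc_def)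
  qed
qed

section \<open>The double bond at the affine node\<close>

lemma doubly_laced_facts:
  assumes doubly_laced_at_0
  shows "1 \<in> {1..n}" "1 \<le> n" "A 1 0 = -1" "A 0 1 = -2" "e 1 = 2" "k \<in> {2..n} \<Longrightarrow> A k 0 = 0"
proof -
  show 1: "1 \<in> {1..n}" "1 \<le> n" "A 1 0 = -1" "A 0 1 = -2" using assms by (auto simp: doubly_laced_at_0_def)
  then show "e 1 = 2" using sym0[of 1] by simp
  show "k \<in> {2..n} \<Longrightarrow> A k 0 = 0" using assms zero_iff[of 0 k] by (auto simp: doubly_laced_at_0_def)
qed

text \<open>Here (\<theta>, \<theta>') = 2 - e_1 = 0, so s_{\<theta>'} lies in the stabilizer of
  \<theta>.\<close>

lemma doubly_laced_comm:
  assumes k2: doubly_laced_at_0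
  shows "g \<in> carrier G \<Longrightarrow> (\<And>k. k \<in> {1..n} \<Longrightarrow> A k 0 = 0 \<Longrightarrow> commute g (T k)) \<Longrightarrow> commute g (Tw (sref (\<theta>' 1)))"
proof (rule commute_stabilizer)
  note F = doubly_laced_facts[OF k2]
  show "sref (\<theta>' 1) \<in> W0" using W0_sref short' pos' F by blast
  have "B \<theta> (\<theta>' 1) = 0" using B_theta_theta'[OF F(1,3)] F(5) by simp
  then show "sref (\<theta>' 1) \<theta> = \<theta>" by (simp add: sref_def lc_def)
qed

lemma X_theta_comm_T: "k \<in> {1..n} \<Longrightarrow> A k 0 = 0 \<Longrightarrow> commute (X (\<lambda>l. - \<theta> l)) (T k)"
  using X_comm'[of k "\<lambda>l. - \<theta> l"] Q_uminus[OF Q_theta] by (simp add: commute_sym pr_uminus pr_theta)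

lemma T0_comm_T: "k \<in> {1..n} \<Longrightarrow> A k 0 = 0 \<Longrightarrow> commute (T 0) (T k)"
  using T_braid[of 0 k 2] by (intro commuteI) (auto simp: braid_lengths_def alt_num)

text \<open>The relation says that S commutes with T_1^{-1} S T_1^{-1}, which equals
  T_{s_{\<theta>'}} X_{-\<theta>'} T_1^{-2}. This follows from three commutations: of
  T_{s_{\<theta>'}} with T_{s_\<theta>}, of T_{s_{\<theta>'}} with X_{-\<theta>}, and of T_1 with
  X_{-\<theta>} X_{-\<theta>'}, whose weight is orthogonal to \<alpha>_1.\<close>

lemma S_braid4:
  assumes k2: doubly_laced_at_0
  shows "S \<otimes> (inv T 1 \<otimes> (S \<otimes> inv T 1)) = inv T 1 \<otimes> (S \<otimes> (inv T 1 \<otimes> S))"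
proof -
  note F = doubly_laced_facts[OF k2]
  note K = F(1,3)
  define q t p xm x' u where "q = Tw (sref (\<theta>' 1))" and "t = Tw (sref \<theta>)" and "p = T 1"
    and "xm = X (\<lambda>l. - \<theta> l)" and "x' = X (\<lambda>l. - \<theta>' 1 l)" and "u = inv T 1"
  note defs = q_def t_def p_def xm_def x'_def u_def
  have Q: "(\<lambda>l. - \<theta>' 1 l) \<in> Q" "(\<lambda>l. - \<theta> l) \<in> Q" using Q'[OF K] by auto
  have c [simp]: "q \<in> carrier G" "t \<in> carrier G" "p \<in> carrier G" "xm \<in> carrier G" "x' \<in> carrier G" "u \<in> carrier G"
    unfolding defs using Tw_closed'[OF K] Q F(2) by auto
  have up [simp]: "u \<otimes> p = \<one>" "p \<otimes> u = \<one>" using F(2) by (simp_all add: defs)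
  have up' [simp]: "u \<otimes> (p \<otimes> y) = y" "p \<otimes> (u \<otimes> y) = y" if "y \<in> carrier G" for y
    using that by (simp_all add: m_assoc[symmetric])
  have S: "S = t \<otimes> xm" by (simp add: R_def defs)
  have t: "t = p \<otimes> (q \<otimes> p)" using Tw_theta[OF K] by (simp add: defs)
  have px: "p \<otimes> xm = x' \<otimes> u" using T_X_theta'[OF K] by (simp add: defs)
  have xp: "xm \<otimes> p = u \<otimes> x'"
  proof -
    have "u \<otimes> (p \<otimes> (xm \<otimes> p)) = u \<otimes> x'" using T_X_theta[OF K] by (simp add: defs)
    then show ?thesis by simp
  qed
  have qt: "commute t q"
    unfolding defs
  proof (rule doubly_laced_comm[OF k2])
    fix k assume k: "k \<in> {1..n}" "A k 0 = 0"
    show "commute (Tw (sref \<theta>)) (T k)"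
      using commute_sym[OF Tw_sref_comm[OF short_theta pos_theta k(1)]] k by (simp add: pr_theta)
  qed (use Tw_closed'[OF K] in simp)
  have qx: "commute xm q"
    unfolding defs by (rule doubly_laced_comm[OF k2]) (use Q X_theta_comm_T in auto)
  have xx: "commute xm x'" unfolding defs by (rule X_commute[OF Q(2,1)])
  have pxx: "commute (xm \<otimes> x') u"
  proof -
    have "xm \<otimes> x' = X (vadd (\<lambda>l. - \<theta> l) (\<lambda>l. - \<theta>' 1 l))" using Q by (simp add: defs X_add)
    moreover have "pr 1 (vadd (\<lambda>l. - \<theta> l) (\<lambda>l. - \<theta>' 1 l)) = 0"
      using pr_k[OF K] F(2) by (simp add: vadd_eq_lc pr_lc pr_uminus theta'_eq[OF K] pr_rt diag del: One_nat_def)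
    ultimately have "commute (T 1) (xm \<otimes> x')" using X_comm'[of 1] Q F(2) by (simp add: vadd_eq_lc Q_lc)
    then show ?thesis unfolding u_def by (rule commute_inv[OF commute_sym])
  qed
  have uSu: "u \<otimes> (S \<otimes> u) = q \<otimes> (x' \<otimes> (u \<otimes> u))"
  proof -
    have "u \<otimes> (S \<otimes> u) = q \<otimes> ((p \<otimes> xm) \<otimes> u)" unfolding S t by (simp add: m_assoc)
    then show ?thesis unfolding px by (simp add: m_assoc)
  qed
  have "S \<otimes> (u \<otimes> (S \<otimes> u)) = t \<otimes> ((xm \<otimes> q) \<otimes> (x' \<otimes> (u \<otimes> u)))" unfolding uSu unfolding S by (simp add: m_assoc)
  also have "\<dots> = (t \<otimes> q) \<otimes> ((xm \<otimes> x') \<otimes> (u \<otimes> u))" unfolding commute_eq[OF qx] by (simp add: m_assoc)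
  also have "\<dots> = q \<otimes> (t \<otimes> ((u \<otimes> u) \<otimes> (xm \<otimes> x')))"
    unfolding commute_eq[OF qt] commute_eq[OF commute_mult[OF pxx pxx]] by (simp add: m_assoc)
  also have "\<dots> = q \<otimes> (p \<otimes> (q \<otimes> (u \<otimes> (xm \<otimes> x'))))" unfolding t by (simp add: m_assoc)
  also have "\<dots> = q \<otimes> (p \<otimes> (q \<otimes> ((u \<otimes> x') \<otimes> xm)))" unfolding commute_eq[OF xx] by (simp add: m_assoc)
  also have "\<dots> = q \<otimes> (p \<otimes> ((q \<otimes> xm) \<otimes> (p \<otimes> xm)))" unfolding xp[symmetric] by (simp add: m_assoc)
  also have "\<dots> = q \<otimes> ((p \<otimes> xm) \<otimes> (q \<otimes> (p \<otimes> xm)))" unfolding commute_eq[OF qx, symmetric] by (simp add: m_assoc)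
  also have "\<dots> = (q \<otimes> (x' \<otimes> (u \<otimes> u))) \<otimes> (p \<otimes> (q \<otimes> (p \<otimes> xm)))" unfolding px by (simp add: m_assoc)
  also have "\<dots> = (u \<otimes> (S \<otimes> u)) \<otimes> S" unfolding uSu unfolding S t by (simp add: m_assoc)
  finally have "S \<otimes> (u \<otimes> (S \<otimes> u)) = u \<otimes> (S \<otimes> (u \<otimes> S))" by (simp add: m_assoc)
  then show ?thesis by (simp add: u_def)
qed

text \<open>Conjugation by T_1 relates S to R_{\<theta>'} and the right factor of Y_{-\<theta>'} to
  T_0, so commutation with that factor reduces to T_0 commuting with R_{\<theta>'}, whose weight is
  orthogonal to \<alpha>_0. The left factor T_{s_{\<theta>'}} commutes with S directly.\<close>

lemma doubly_laced_theta': 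
  assumes k2: doubly_laced_at_0
  shows "(\<lambda>l. - \<theta>' 1 l) \<in> M0"
proof -
  note F = doubly_laced_facts[OF k2]
  note K = F(1,3)
  define q x' where "q = Tw (sref (\<theta>' 1))" and "x' = X (\<lambda>l. - \<theta>' 1 l)"
  have Q: "(\<lambda>l. - \<theta>' 1 l) \<in> Q" "(\<lambda>l. - \<theta> l) \<in> Q" "\<theta>' 1 \<in> Q" using Q'[OF K] by auto
  have c [simp]: "q \<in> carrier G" "x' \<in> carrier G" "T 1 \<in> carrier G"
    unfolding q_def x'_def using Tw_closed'[OF K] Q F(2) by auto
  have S: "S = T 1 \<otimes> ((q \<otimes> x') \<otimes> inv T 1)"
  proof -
    have "S = (S \<otimes> T 1) \<otimes> inv T 1" using c(3) by (simp add: m_assoc)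
    also have "\<dots> = (T 1 \<otimes> R (\<theta>' 1)) \<otimes> inv T 1" unfolding S_step[OF K] ..
    also have "R (\<theta>' 1) = q \<otimes> x'" by (simp add: R_def q_def x'_def)
    also have "(T 1 \<otimes> (q \<otimes> x')) \<otimes> inv T 1 = T 1 \<otimes> ((q \<otimes> x') \<otimes> inv T 1)" using c by (simp add: m_assoc)
    finally show ?thesis .
  qed
  have p0: "pr 0 (\<lambda>l. - \<theta>' 1 l) = 0"
    using B_theta[of "\<theta>' 1"] B_theta_theta'[OF K] F(5) by (simp add: pr_uminus B_sym[of \<theta>])
  have 1: "commute (T 0) (q \<otimes> x')"
    unfolding q_def x'_def
    by (intro commute_mult doubly_laced_comm[OF k2] X_comm' T0_comm_T Q p0) auto
  have 2: "commute S (T 1 \<otimes> (T 0 \<otimes> inv T 1))"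
  proof (rule commuteI)
    show "S \<otimes> (T 1 \<otimes> (T 0 \<otimes> inv T 1)) = T 1 \<otimes> (T 0 \<otimes> inv T 1) \<otimes> S"
      unfolding S using c commute_eq'[OF 1, of "inv T 1"] by (simp add: m_assoc)
  qed (use c in auto)
  have "commute S q" unfolding q_def by (intro doubly_laced_comm[OF k2] S_comm_T) auto
  then have "commute S (Y (\<lambda>l. - \<theta>' 1 l))"
    using commute_mult 2 unfolding Y_theta'_eq[OF K] q_def by blast
  then show ?thesis using Q p0 by (simp add: M0_def)
qed

lemma even_laced_pr0: "doubly_laced_at_0 \<or> quadruply_laced_at_0 \<Longrightarrow> \<beta> \<in> Q \<Longrightarrow> pr 0 \<beta> = -2 * \<beta> 1"
proof -
  assume k: "doubly_laced_at_0 \<or> quadruply_laced_at_0" and b: "\<beta> \<in> Q"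
  have n1: "1 \<in> {..n}" using k by (auto simp: doubly_laced_at_0_def quadruply_laced_at_0_def)
  have "pr 0 \<beta> = (\<Sum>j\<in>{..n}. if j = 1 then -2 * \<beta> 1 else 0)"
    unfolding pr_def
  proof (rule sum.cong)
    fix j assume j: "j \<in> {..n}"
    consider "j = 0" | "j = 1" | "j \<in> {2..n}" using j by force
    then show "real_of_int (A 0 j) * \<beta> j = (if j = 1 then -2 * \<beta> 1 else 0)"
    proof cases
      case 1 then show ?thesis using Q_D(2)[OF b] by simp
    next
      case 2 then show ?thesis using k by (auto simp: doubly_laced_at_0_def quadruply_laced_at_0_def)
    next
      case 3 then show ?thesis using k by (auto simp: doubly_laced_at_0_def quadruply_laced_at_0_def)
    qed
  qed simp
  then show ?thesis using n1 by simp
qed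

text \<open>For these types the reflection relations at the affine node are therefore
  vacuous.\<close>

lemma even_laced_pr0_ne: "doubly_laced_at_0 \<or> quadruply_laced_at_0 \<Longrightarrow> \<beta> \<in> Q \<Longrightarrow> pr 0 \<beta> \<noteq> -1"
proof
  assume k: "doubly_laced_at_0 \<or> quadruply_laced_at_0" and b: "\<beta> \<in> Q" and p: "pr 0 \<beta> = -1"
  obtain z where "\<beta> 1 = of_int z" using Q_D(1)[OF b] by (metis Ints_cases)
  then have "real_of_int (2 * z) = of_int 1" using even_laced_pr0[OF k b] p by simp
  then have "2 * z = 1" by (simp only: of_int_eq_iff)
  then show False by presburger
qed

text \<open>Orthogonality to \<alpha>_0 means that the coordinate at 1 vanishes, so \<alpha>_2, ...,
  \<alpha>_n are needed. The chain is entered from -\<theta>'; its last root, beyond the other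
  double bond, is split off from \<theta>' because a_n = 1.\<close>

lemma doubly_laced_final:
  assumes k2: doubly_laced_at_0 and b: "\<beta> \<in> Q" and p: "pr 0 \<beta> = 0"
  shows "\<beta> \<in> M0"
proof -
  note F = doubly_laced_facts[OF k2]
  note K = F(1,3)
  have th: "(\<lambda>l. - \<theta>' 1 l) \<in> M0" by (rule doubly_laced_theta'[OF k2])
  have th': "\<theta>' 1 \<in> M0"
  proof -
    have "lc (\<lambda>_. 0) (-1) (\<lambda>l. - \<theta>' 1 l) \<in> M0" using M0_closed th by (simp add: lattice_closed_def)
    then show ?thesis by (simp add: lc_def)
  qed
  have Astep: "A (k + 1) k = -1" if "1 \<le> k" "k + 1 < n" for k using k2 that by (auto simp: doubly_laced_at_0_def)
  have mid: "rt j \<in> M0" if "2 \<le> j" "j < n" for j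
    using that
  proof (induction j rule: nat_induct_at_least)
    case base
    have Q: "(\<lambda>l. - \<theta>' 1 l) \<in> Q" using th by (simp add: M0_def)
    have A2: "A 2 0 = 0" using F(6)[of 2] base by simp
    have A21: "A 2 1 = -1" using Astep[of 1] base by (simp add: numeral_2_eq_2)
    have pm: "pr 2 (\<lambda>l. - \<theta>' 1 l) = -1"
      using base F(2) A2 A21 by (simp add: pr_uminus theta'_eq[OF K] pr_lc pr_theta pr_rt del: One_nat_def)
    have j2: "2 \<in> {1..n}" "2 \<le> n" using base by auto
    have "lc (\<lambda>l. - \<theta>' 1 l) 1 (rt 2) \<in> M0"
      using M0_s[OF th j2(1) A2 pm] unfolding s_eq[OF j2(2)] pm by simp
    then show ?case using lattice_closed_diff[OF M0_closed th] by blast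
  next
    case (Suc j)
    have m: "rt j \<in> M0" using Suc by simp
    have j2: "Suc j \<in> {1..n}" "Suc j \<le> n" "j \<le> n" using Suc by auto
    have A2: "A (Suc j) 0 = 0" using F(6)[of "Suc j"] Suc by simp
    have pm: "pr (Suc j) (rt j) = -1" using Astep[of j] Suc j2 by (simp add: pr_rt)
    have "lc (rt j) 1 (rt (Suc j)) \<in> M0"
      using M0_s[OF m j2(1) A2 pm] unfolding s_eq[OF j2(2)] pm by simp
    then show ?case using lattice_closed_diff[OF M0_closed m] by blast
  qed
  \<comment> \<open>Subtracting the component along \<alpha>_1 puts \<alpha>_1 itself into M, so
    \<open>lattice_gen\<close> can be used although \<alpha>_1 does not pair to 0 with
    \<alpha>_0.\<close>
  define M where "M = {x. lc x (- x 1) (rt 1) \<in> M0}"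
  have Mc: "lattice_closed M"
    unfolding lattice_closed_def
  proof (intro conjI ballI)
    show "(\<lambda>_. 0) \<in> M" using M0_closed by (simp add: M_def lattice_closed_def) (simp add: lc_def)
    fix x y assume "x \<in> M" "y \<in> M"
    then have m: "lc x (- x 1) (rt 1) \<in> M0" "lc y (- y 1) (rt 1) \<in> M0" by (auto simp: M_def)
    have 1: "lc (lc x (- x 1) (rt 1)) c (lc y (- y 1) (rt 1)) = lc (lc x c y) (- lc x c y 1) (rt 1)" for c
      by (simp add: lc_def algebra_simps)
    show "lc x 1 y \<in> M" "lc x (-1) y \<in> M"
      using M0_closed m unfolding M_def mem_Collect_eq 1[symmetric] lattice_closed_def by blast+
  qed
  have M1: "rt 1 \<in> M" using M0_closed by (simp add: M_def lattice_closed_def lc_def rt_apply)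
  have Mj: "rt j \<in> M" if "rt j \<in> M0" "j \<noteq> 1" for j
  proof -
    have "rt j 1 = 0" using that(2) by (simp add: rt_apply)
    then have "lc (rt j) (- rt j 1) (rt 1) = rt j" by (simp only: lc_def) simp
    then show ?thesis using that(1) unfolding M_def by simp
  qed
  have an: "a n = 1" and n2: "n \<ge> 2" using k2 by (auto simp: doubly_laced_at_0_def)
  define \<beta>' where "\<beta>' = lc (\<theta>' 1) (-1) (rt n)"
  have th1: "\<theta>' 1 1 = 0"
  proof -
    have "pr 0 (\<theta>' 1) = -2 * \<theta>' 1 1" using even_laced_pr0 k2 th' unfolding M0_def by blast
    moreover have "pr 0 (\<theta>' 1) = 0" using th' unfolding M0_def by blast
    ultimately show ?thesis by simp
  qed
  have "\<beta>' \<in> M"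
  proof (rule lattice_gen[OF Mc, of "n - 1"])
    fix j assume j: "j \<in> {1..n - 1}"
    show "rt j \<in> M"
    proof (cases "j = 1")
      case True then show ?thesis using M1 by simp
    next
      case False
      then have "2 \<le> j" "j < n" using j by auto
      then show ?thesis using Mj[OF mid] False by blast
    qed
  next
    show "\<beta>' \<in> Q" using th' n2 by (simp add: \<beta>'_def Q_lc Q_rt M0_def)
    have "\<theta>' 1 k = \<theta> k - rt 1 k" for k by (simp add: theta'_eq[OF K] lc_def del: One_nat_def)
    then show "\<beta>' k = 0" if "k > n - 1" for k
      using that an n2 by (auto simp: \<beta>'_def lc_def theta_apply rt_apply)
  qed
  moreover have "\<beta>' 1 = 0" using th1 n2 by (simp add: \<beta>'_def lc_def rt_apply)
  ultimately have b': "\<beta>' \<in> M0" by (simp add: M_def lc_def)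
  have "lc (\<theta>' 1) (-1) \<beta>' \<in> M0" using M0_closed th' b' by (simp add: lattice_closed_def)
  then have rn: "rt n \<in> M0" by (simp add: \<beta>'_def lc_def)
  have "rt j \<in> M" if j: "j \<in> {1..n}" for j
  proof -
    consider "j = 1" | "j = n" "j \<noteq> 1" | "2 \<le> j" "j < n" using j by force
    then show ?thesis using M1 Mj[OF rn] Mj[OF mid] by cases auto
  qed
  then have "\<beta> \<in> M" using lattice_gen[OF Mc, of n \<beta>] b Q_D(3) by blast
  moreover have "\<beta> 1 = 0" using even_laced_pr0[OF _ b] k2 p by simp
  ultimately show ?thesis by (simp add: M_def lc_def)
qed

lemma quadruply_laced_final:
  assumes k3: quadruply_laced_at_0 and b: "\<beta> \<in> Q" and p: "pr 0 \<beta> = 0"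
  shows "\<beta> \<in> M0"
proof -
  have n: "n = 1" using k3 by (simp add: quadruply_laced_at_0_def)
  have "\<beta> 1 = 0" using even_laced_pr0[OF _ b] k3 p by simp
  then have "\<beta> k = 0" for k using Q_D(2,3)[OF b] n by (cases "k = 0"; cases "k = 1") auto
  then have "\<beta> = (\<lambda>_. 0)" by auto
  then show ?thesis using M0_closed by (simp add: lattice_closed_def)
qed

lemma S_Y0:
  assumes "\<beta> \<in> Q" "pr 0 \<beta> = 0"
  shows "commute S (Y \<beta>)"
  using kinds assms simply_laced_final(1) doubly_laced_final quadruply_laced_final unfolding M0_def by blast

lemma S_Y1:
  assumes "\<beta> \<in> Q" "pr 0 \<beta> = -1"
  shows "S \<otimes> (Y \<beta> \<otimes> S) = Y (lc \<beta> (-1) \<theta>) \<otimes> inv Z"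
  using kinds assms simply_laced_final(2) even_laced_pr0_ne unfolding M1_def by blast

section \<open>Braid relations for the images of the generators\<close>

definition T' :: "nat \<Rightarrow> 'g" where
  "T' i = (if i = 0 then S else inv T i)"

lemma inverse_word: "set js \<subseteq> {..n} \<Longrightarrow> foldr (\<lambda>j g. inv T j \<otimes> g) js \<one> = inv tw (rev js)"
  by (induction js) (auto simp: tw_append tw_closed inv_mult_group)

text \<open>Inverting a product reverses its word. An alternating word reversed is again one of the
  two alternating words of its length, so the inverses of the T_i satisfy the same braid
  relations.\<close>

lemma rev_alt: "rev (alt i j m) = (if even m then alt j i m else alt i j m)"
proof -
  have "alt i j (Suc m) = alt i j m @ [if even m then i else j]" for i j m
    by (induction m arbitrary: i j) auto
  note snoc = this
  show ?thesis
  proof (induction m arbitrary: i j)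
    case (Suc m)
    have "rev (alt i j (Suc m)) = rev (alt j i m) @ [i]" by simp
    then show ?case using Suc[of j i] by (simp only: snoc) auto
  qed simp
qed

lemma T'_braid:
  assumes ij: "i \<le> n" "j \<le> n" "i \<noteq> j" and m: "(A i j * A j i, m) \<in> braid_lengths"
  shows "foldr (\<lambda>j g. T' j \<otimes> g) (alt i j m) \<one> = foldr (\<lambda>j g. T' j \<otimes> g) (alt j i m) \<one>"
proof -
  have zero: "foldr (\<lambda>j g. T' j \<otimes> g) (alt 0 k m) \<one> = foldr (\<lambda>j g. T' j \<otimes> g) (alt k 0 m) \<one>"
    if k: "k \<in> {1..n}" and m: "(A 0 k * A k 0, m) \<in> braid_lengths" for k
  proof -
    have kn: "k \<le> n" "k \<noteq> 0" using k by auto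
    have T': "T' 0 = S" "T' k = inv T k" using kn by (auto simp: T'_def)
    consider "A 0 k = 0" "A k 0 = 0" | "A 0 k = -1" "A k 0 = -1" | "doubly_laced_at_0" "k = 1" | "A 0 k = -2" "A k 0 = -2"
    proof (cases "A 0 k = 0")
      case True then show ?thesis using that(1) zero_iff[of 0 k] kn by simp
    next
      case False
      show ?thesis using kinds
      proof (elim disjE)
        assume simply_laced_at_0 then show ?thesis using that(2) simply_laced_adj k False by blast
      next
        assume k2: doubly_laced_at_0
        then have "k = 1" using k False by (cases "k = 1") (auto simp: doubly_laced_at_0_def)
        then show ?thesis using that(3) k2 by blast
      next
        assume quadruply_laced_at_0
        then have "k = 1" "A 0 1 = -2" "A 1 0 = -2" using k by (auto simp: quadruply_laced_at_0_def)
        then show ?thesis using that(4) by blast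
      qed
    qed
    then show ?thesis
    proof cases
      case 1
      then have m2: "m = 2" using m by (auto simp: braid_lengths_def)
      have "commute S (inv T k)" using S_comm_T[OF k 1(2)] by (rule commute_inv)
      then show ?thesis using kn commute_eq by (simp add: m2 alt_num T')
    next
      case 2
      then have m3: "m = 3" using m by (auto simp: braid_lengths_def)
      show ?thesis using S_braid3[OF k 2(2,1)] kn by (simp add: m3 alt_num T')
    next
      case 3
      have m4: "m = 4" using m 3 doubly_laced_facts(3,4)[OF 3(1)] by (auto simp: braid_lengths_def)
      show ?thesis using S_braid4[OF 3(1)] kn unfolding 3(2)[symmetric] by (simp add: m4 alt_num T')
    next
      case 4
      then show ?thesis using m by (auto simp: braid_lengths_def)
    qed
  qed
  consider "i = 0" | "j = 0" | "i \<noteq> 0" "j \<noteq> 0" by blast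
  then show ?thesis
  proof cases
    case 1 then show ?thesis using zero[of j] ij m by simp
  next
    case 2 then show ?thesis using zero[of i] ij m by (simp add: mult.commute)
  next
    case 3
    have f: "foldr (\<lambda>j g. T' j \<otimes> g) js \<one> = foldr (\<lambda>j g. inv T j \<otimes> g) js \<one>" if "0 \<notin> set js" for js
      using that by (induction js) (auto simp: T'_def)
    have n0: "0 \<notin> set (alt i j m)" "0 \<notin> set (alt j i m)" using set_alt[of i j m] set_alt[of j i m] 3 by auto
    have sub: "set (alt i j m) \<subseteq> {..n}" "set (alt j i m) \<subseteq> {..n}"
      using set_alt[of i j m] set_alt[of j i m] ij by auto
    show ?thesis
      unfolding f[OF n0(1)] f[OF n0(2)] inverse_word[OF sub(1)] inverse_word[OF sub(2)] rev_alt
      using T_braid[OF ij m] by (simp add: tw_def)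
  qed
qed

end

section \<open>Affine types\<close>

definition off :: "bond list \<Rightarrow> nat \<Rightarrow> nat \<Rightarrow> int" where
  "off bs i j = (\<Sum>(k, l, p, q)\<leftarrow>bs. (if (k, l) = (i, j) then p else 0) + (if (k, l) = (j, i) then q else 0))"

lemma off_Nil [simp]: "off [] i j = 0"
  and off_Cons: "off ((k, l, p, q) # bs) i j =
    (if (k, l) = (i, j) then p else 0) + (if (k, l) = (j, i) then q else 0) + off bs i j"
  and off_append: "off (bs @ cs) i j = off bs i j + off cs i j"
  unfolding off_def by simp_all

lemma chain_Suc: "chain i (Suc k) = (if i \<le> k then chain i k @ [(k, Suc k, 1, 1)] else [])"
  by (simp add: chain_def)

lemma off_chain: "off (chain a b) i j = (if a \<le> i \<and> i < b \<and> j = Suc i then 1 else 0) + (if a \<le> j \<and> j < b \<and> i = Suc j then 1 else 0)"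
proof (induction b)
  case 0 then show ?case by (simp add: chain_def)
next
  case (Suc b)
  show ?case
  proof (cases "a \<le> b")
    case True
    then show ?thesis by (simp only: chain_Suc if_True off_append Suc off_Cons off_Nil) (auto simp: less_Suc_eq)
  next
    case False
    then show ?thesis by (auto simp: chain_Suc)
  qed
qed

lemma kac_matrix_off: "kac_matrix t i j = (if i = j then 2 else - off (kac_bonds t) i j)"
  by (simp add: kac_matrix_def off_def)

text \<open>The off-diagonal entries applied to a vector, collected bond by bond: at a given node
  only the incident bonds contribute, whatever the rank.\<close>

definition row :: "bond list \<Rightarrow> (nat \<Rightarrow> int) \<Rightarrow> nat \<Rightarrow> int" where
  "row bs a i = (\<Sum>(k, l, p, q)\<leftarrow>bs. (if i = k then p * a l else 0) + (if i = l then q * a k else 0))"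

lemma row_Nil [simp]: "row [] a i = 0"
  and row_Cons: "row ((k, l, p, q) # bs) a i = (if i = k then p * a l else 0) + (if i = l then q * a k else 0) + row bs a i"
  and row_append: "row (bs @ cs) a i = row bs a i + row cs a i"
  unfolding row_def by simp_all

lemma row_chain: "row (chain c b) a i = (if c \<le> i \<and> i < b then a (Suc i) else 0) + (if c < i \<and> i \<le> b then a (i - 1) else 0)"
proof (induction b)
  case 0 then show ?case by (simp add: chain_def)
next
  case (Suc b)
  show ?case
  proof (cases "c \<le> b")
    case True
    then show ?thesis
      by (simp only: chain_Suc if_True row_append Suc row_Cons row_Nil) (auto simp: less_Suc_eq le_Suc_eq)
  next
    case False
    then show ?thesis by (auto simp: chain_Suc)
  qed
qed

definition valid_bonds :: "nat \<Rightarrow> bond list \<Rightarrow> bool" where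
  "valid_bonds n bs \<longleftrightarrow> (\<forall>(k, l, p, q)\<in>set bs. k \<noteq> l \<and> k \<le> n \<and> l \<le> n)"

lemma valid_bonds_simps [simp]: "valid_bonds n []"
  "valid_bonds n ((k, l, p, q) # bs) \<longleftrightarrow> k \<noteq> l \<and> k \<le> n \<and> l \<le> n \<and> valid_bonds n bs"
  "valid_bonds n (bs @ cs) \<longleftrightarrow> valid_bonds n bs \<and> valid_bonds n cs"
  unfolding valid_bonds_def by (simp, simp, simp only: set_append ball_Un)

lemma valid_bonds_chain: "b \<le> n \<Longrightarrow> valid_bonds n (chain a b)"
  by (auto simp: valid_bonds_def chain_def)

lemma row_off:
  assumes "valid_bonds n bs" "i \<le> n"
  shows "(\<Sum>j\<le>n. off bs i j * a j) = row bs a i"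
  using assms(1)
proof (induction bs)
  case Nil then show ?case by simp
next
  case (Cons b bs)
  obtain k l p q where b: "b = (k, l, p, q)" by (cases b)
  have kl: "k \<noteq> l" "k \<le> n" "l \<le> n" and v: "valid_bonds n bs" using Cons.prems by (auto simp: b)
  have "(\<Sum>j\<le>n. off (b # bs) i j * a j) = (\<Sum>j\<le>n. if j = l then (if i = k then p * a l else 0) else 0)
      + (\<Sum>j\<le>n. if j = k then (if i = l then q * a k else 0) else 0) + (\<Sum>j\<le>n. off bs i j * a j)"
    unfolding sum.distrib[symmetric] by (intro sum.cong HOL.refl) (auto simp: b off_Cons algebra_simps)
  then show ?case using kl Cons.IH[OF v] by (simp add: b row_Cons)
qed

lemma off_diag: "valid_bonds n bs \<Longrightarrow> off bs i i = 0"
proof (induction bs)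
  case (Cons b bs)
  then show ?case by (cases b) (auto simp: off_Cons)
qed simp

lemma kac_row:
  assumes "valid_bonds n (kac_bonds t)" "i \<le> n"
  shows "(\<Sum>j\<le>n. kac_matrix t i j * a j) = 2 * a i - row (kac_bonds t) a i"
proof -
  have "(\<Sum>j\<le>n. kac_matrix t i j * a j) = (\<Sum>j\<le>n. (if j = i then 2 * a i else 0) - off (kac_bonds t) i j * a j)"
    by (intro sum.cong HOL.refl) (auto simp: kac_matrix_off off_diag[OF assms(1)])
  then show ?thesis using assms by (simp add: sum_subtractf row_off)
qed

lemma off_sym:
  assumes "\<forall>(k, l, p, q)\<in>set bs. e k * p = e l * q"
  shows "e i * off bs i j = e j * off bs j i"
  using assms
proof (induction bs)
  case (Cons b bs)
  obtain k l p q where b: "b = (k, l, p, q)" by (cases b)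
  have pq: "e k * p = e l * q" and IH: "e i * off bs i j = e j * off bs j i" using Cons by (auto simp: b)
  have "e i * (if (k, l) = (i, j) then p else 0) = e j * (if (k, l) = (i, j) then q else 0)"
    "e i * (if (k, l) = (j, i) then q else 0) = e j * (if (k, l) = (j, i) then p else 0)"
    using pq by auto
  then show ?case unfolding b off_Cons distrib_left IH by linarith
qed simp

text \<open>The null space is a line, so another solution b is b_0 times a because a_0 = 1; then b_0
  divides all its entries and must be 1.\<close>

lemma kac_label_eqI:
  assumes dim: "\<And>v. (\<And>i. i \<le> n \<Longrightarrow> mat_vec n M v i = 0) \<Longrightarrow> \<exists>c. \<forall>i\<le>n. v i = c * real_of_int (a i)"
    and a: "\<And>i. i \<le> n \<Longrightarrow> a i > 0" "a 0 = 1" "\<And>i. i \<le> n \<Longrightarrow> (\<Sum>j\<le>n. M i j * a j) = 0"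
  shows "kac_label n M = (\<lambda>j. if j \<le> n then a j else 0)"
  unfolding kac_label_def
proof (rule the_equality)
  have s: "(\<Sum>j\<le>n. M i j * (if j \<le> n then a j else 0)) = (\<Sum>j\<le>n. M i j * a j)" for i
    by (intro sum.cong) auto
  have "Gcd ((\<lambda>j. if j \<le> n then a j else 0) ` {..n}) dvd 1"
    using Gcd_dvd[of "1" "(\<lambda>j. if j \<le> n then a j else 0) ` {..n}"] a(2) by (force simp: image_iff)
  then have "Gcd ((\<lambda>j. if j \<le> n then a j else 0) ` {..n}) = 1" by (metis Gcd_int_greater_eq_0 zdvd1_eq abs_of_nonneg)
  then show "(\<forall>j\<le>n. 0 < (if j \<le> n then a j else 0)) \<and> (\<forall>j>n. (if j \<le> n then a j else 0) = 0) \<and>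
    Gcd ((\<lambda>j. if j \<le> n then a j else 0) ` {..n}) = 1 \<and> (\<forall>i\<le>n. (\<Sum>j\<le>n. M i j * (if j \<le> n then a j else 0)) = 0)"
    using a by (simp only: s) simp
next
  fix b assume b: "(\<forall>j\<le>n. 0 < b j) \<and> (\<forall>j>n. b j = 0) \<and> Gcd (b ` {..n}) = 1 \<and> (\<forall>i\<le>n. (\<Sum>j\<le>n. M i j * b j) = 0)"
  have "mat_vec n M (\<lambda>j. real_of_int (b j)) i = 0" if "i \<le> n" for i
  proof -
    have "mat_vec n M (\<lambda>j. real_of_int (b j)) i = of_int (\<Sum>j\<le>n. M i j * b j)" by (simp add: mat_vec_def)
    then show ?thesis using b that by (simp del: of_int_sum)
  qed
  from dim[OF this] obtain c where c: "\<forall>i\<le>n. real_of_int (b i) = c * real_of_int (a i)" by blast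
  have "c = b 0" using c a(2) by force
  then have "real_of_int (b i) = of_int (b 0 * a i)" if "i \<le> n" for i using c that by simp
  then have ba: "b i = b 0 * a i" if "i \<le> n" for i using that of_int_eq_iff by blast
  have "b 0 dvd Gcd (b ` {..n})"
  proof (rule Gcd_greatest)
    fix x assume "x \<in> b ` {..n}"
    then obtain i where "i \<le> n" "x = b i" by auto
    then show "b 0 dvd x" using ba by (metis dvd_triv_left)
  qed
  then have "b 0 dvd 1" "b 0 > 0" using b by auto
  then have "b 0 = 1" by simp
  then have "b i = a i" if "i \<le> n" for i using ba[OF that] by simp
  then show "b = (\<lambda>j. if j \<le> n then a j else 0)" using b by (simp add: fun_eq_iff not_le)
qed

section \<open>Labels, symmetrizers and connectivity, type by type\<close>

fun type_label :: "affine_type \<Rightarrow> nat \<Rightarrow> int" where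
  "type_label (D1 n) j = (if j \<le> 1 \<or> n - 1 \<le> j then 1 else 2)"
| "type_label E6_1 j = [1, 1, 2, 3, 2, 1, 2] ! j"
| "type_label E7_1 j = [1, 2, 3, 4, 3, 2, 1, 2] ! j"
| "type_label E8_1 j = [1, 2, 3, 4, 5, 6, 4, 2, 3] ! j"
| "type_label (A_odd2 n) j = (if j \<le> 1 \<or> j = n then 1 else 2)"
| "type_label E6_2 j = [1, 2, 3, 2, 1] ! j"
| "type_label D4_3 j = [1, 2, 1] ! j"
| "type_label _ j = 1"

text \<open>Half the norms of the simple roots with \<alpha>_0 normalized to norm 2. The default
  value 1 is intended for the simply laced types.\<close>

fun type_ratio :: "affine_type \<Rightarrow> nat \<Rightarrow> int" where
  "type_ratio (A_odd2 n) j = (if j = n then 2 else 1)"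
| "type_ratio (D2 n) j = (if j = 0 \<or> j = n then 1 else 2)"
| "type_ratio E6_2 j = (if j \<ge> 3 then 2 else 1)"
| "type_ratio D4_3 j = (if j = 2 then 3 else 1)"
| "type_ratio _ j = 1"

definition short_type :: "affine_type \<Rightarrow> bool" where
  "short_type t \<longleftrightarrow> admissible_type t \<and> t \<notin> range B1 \<union> range C1 \<union> {F4_1, G2_1} \<and> t \<notin> range A_even2"

lemma short_type_cases [consumes 1]:
  assumes "short_type t"
  obtains "t = A1 1" | n where "t = A1 n" "n \<ge> 2" | n where "t = D1 n" "n \<ge> 4" | "t = E6_1" | "t = E7_1" | "t = E8_1"
    | n where "t = A_odd2 n" "n \<ge> 3" | n where "t = D2 n" "n \<ge> 2" | "t = E6_2" | "t = D4_3"
  using assms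
proof (cases t)
  case (A1 x1)
  then show ?thesis using that(1,2) assms by (cases "x1 = 1") (auto simp: short_type_def)
qed (use that assms in \<open>auto simp: short_type_def\<close>)

lemma type_valid: "short_type t \<Longrightarrow> valid_bonds (affine_rank t) (kac_bonds t)"
  by (erule short_type_cases) (auto intro: valid_bonds_chain)

lemma le_num: 
  "(j::nat) \<le> 2 \<longleftrightarrow> j \<in> {0, 1, 2}" "j \<le> 4 \<longleftrightarrow> j \<in> {0, 1, 2, 3, 4}"
  "j \<le> 6 \<longleftrightarrow> j \<in> {0, 1, 2, 3, 4, 5, 6}" "j \<le> 7 \<longleftrightarrow> j \<in> {0, 1, 2, 3, 4, 5, 6, 7}"
  "j \<le> 8 \<longleftrightarrow> j \<in> {0, 1, 2, 3, 4, 5, 6, 7, 8}"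
  by auto

lemma type_label_pos: "short_type t \<Longrightarrow> j \<le> affine_rank t \<Longrightarrow> type_label t j > 0"
  by (erule short_type_cases) (auto simp: le_num)

lemma type_label_0: "short_type t \<Longrightarrow> type_label t 0 = 1"
  by (erule short_type_cases) auto

lemma type_ratio_pos: "type_ratio t j > 0" 
  by (cases t) auto

lemma type_ratio_0: "short_type t \<Longrightarrow> type_ratio t 0 = 1"
  by (erule short_type_cases) auto

lemma type_null:
  assumes "short_type t" "i \<le> affine_rank t"
  shows "(\<Sum>j\<le>affine_rank t. kac_matrix t i j * type_label t j) = 0"
proof -
  note row_simps = row_Cons row_append row_chain
  have "row (kac_bonds t) (type_label t) i = 2 * type_label t i"
    using assms(1)
  proof (cases rule: short_type_cases)
    case 1
    then have "i = 0 \<or> i = 1" using assms(2) by auto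
    then show ?thesis using 1 by (auto simp: row_simps)
  next
    case (2 n)
    then show ?thesis using assms(2) by (auto simp: row_simps)
  next
    case (3 n)
    \<comment> \<open>The substitution n = m + 4 removes truncated subtraction from the bond list,
      so each position of i becomes linear arithmetic.\<close>
    define m where "m = n - 4"
    have n: "n = m + 4" using 3 by (simp add: m_def)
    have i: "i \<le> m + 4" using assms(2) 3 n by simp
    consider "i = 0" | "i = 1" | "i = 2" "m = 0" | "i = 2" "m > 0" | "3 \<le> i" "i < m + 2" | "i = m + 2" "m > 0"
      | "i = m + 3" | "i = m + 4"
      using i by linarith
    then show ?thesis unfolding 3 n by cases (simp_all add: row_simps, arith)
  next
    case 4
    then have "i \<in> {0, 1, 2, 3, 4, 5, 6}" using assms(2) by (simp only: le_num affine_rank.simps)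
    then show ?thesis unfolding 4 by (elim insertE emptyE) (simp_all add: row_simps)
  next
    case 5
    then have "i \<in> {0, 1, 2, 3, 4, 5, 6, 7}" using assms(2) by (simp only: le_num affine_rank.simps)
    then show ?thesis unfolding 5 by (elim insertE emptyE) (simp_all add: row_simps)
  next
    case 6
    then have "i \<in> {0, 1, 2, 3, 4, 5, 6, 7, 8}" using assms(2) by (simp only: le_num affine_rank.simps)
    then show ?thesis unfolding 6 by (elim insertE emptyE) (simp_all add: row_simps)
  next
    case (7 n)
    define m where "m = n - 3"
    have n: "n = m + 3" using 7 by (simp add: m_def)
    have i: "i \<le> m + 3" using assms(2) 7 n by simp
    consider "i = 0" | "i = 1" | "i = 2" "m = 0" | "i = 2" "m > 0" | "3 \<le> i" "i < m + 2" | "i = m + 2" "m > 0"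
      | "i = m + 3"
      using i by linarith
    then show ?thesis unfolding 7 n by cases (simp_all add: row_simps, arith)
  next
    case (8 n)
    define m where "m = n - 2"
    have n: "n = m + 2" using 8 by (simp add: m_def)
    have i: "i \<le> m + 2" using assms(2) 8 n by simp
    consider "i = 0" | "i = 1" "m = 0" | "i = 1" "m > 0" | "2 \<le> i" "i < m + 1" | "i = m + 1" "m > 0" | "i = m + 2"
      using i by linarith
    then show ?thesis unfolding 8 n by cases (simp_all add: row_simps)
  next
    case 9
    then have "i \<in> {0, 1, 2, 3, 4}" using assms(2) by (simp only: le_num affine_rank.simps)
    then show ?thesis unfolding 9 by (elim insertE emptyE) (simp_all add: row_simps)
  next
    case 10
    then have "i \<in> {0, 1, 2}" using assms(2) by (simp only: le_num affine_rank.simps)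
    then show ?thesis unfolding 10 by (elim insertE emptyE) (simp_all add: row_simps)
  qed
  then show ?thesis using kac_row[OF type_valid[OF assms(1)] assms(2), of "type_label t"] by simp
qed

lemma type_sym:
  assumes "short_type t"
  shows "type_ratio t i * kac_matrix t i j = type_ratio t j * kac_matrix t j i"
proof -
  have "\<forall>(k, l, p, q)\<in>set (kac_bonds t). type_ratio t k * p = type_ratio t l * q"
    using assms
    by (cases rule: short_type_cases) (auto simp: chain_def)
  from off_sym[OF this] show ?thesis by (simp add: kac_matrix_off)
qed

text \<open>Both label vectors are identified by \<open>kac_label_eqI\<close>. For the transposed
  matrix the symmetrizer gives the null vector e_j a_j, so that d_j = 1 / e_j.\<close>

lemma affine_datum_exists:
  assumes aff: "irreducible_affine_cartan n A" and t: "kac_labelled t n A" "short_type t"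
  shows "affine_datum n A (type_label t) (type_ratio t)"
proof -
  let ?a = "type_label t" and ?e = "type_ratio t"
  have n: "n = affine_rank t" and A: "\<And>i j. i \<le> n \<Longrightarrow> j \<le> n \<Longrightarrow> A i j = kac_matrix t i j"
    using t(1) by (auto simp: kac_labelled_def)
  have a: "?a j > 0" if "j \<le> n" for j using type_label_pos t(2) that n by simp
  have a0: "?a 0 = 1" using type_label_0 t(2) .
  have null: "(\<Sum>j\<le>n. A i j * ?a j) = 0" if "i \<le> n" for i
  proof -
    have "(\<Sum>j\<le>n. A i j * ?a j) = (\<Sum>j\<le>n. kac_matrix t i j * ?a j)"
      using that by (intro sum.cong) (auto simp: A)
    then show ?thesis using type_null[OF t(2)] that n by simp
  qed
  have sym: "?e i * A i j = ?e j * A j i" if "i \<le> n" "j \<le> n" for i j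
    using type_sym[OF t(2)] that by (simp add: A)
  obtain u where u: "\<forall>i\<le>n. u i > 0"
    and u1: "\<And>v. \<forall>i\<le>n. mat_vec n A v i = 0 \<Longrightarrow> \<exists>c. \<forall>i\<le>n. v i = c * u i"
    using aff unfolding irreducible_affine_cartan_def by blast
  have dim: "\<exists>c. \<forall>i\<le>n. v i = c * real_of_int (?a i)" if v: "\<And>i. i \<le> n \<Longrightarrow> mat_vec n A v i = 0" for v
  proof -
    have "mat_vec n A (\<lambda>j. real_of_int (?a j)) i = 0" if "i \<le> n" for i
    proof -
      have "mat_vec n A (\<lambda>j. real_of_int (?a j)) i = of_int (\<Sum>j\<le>n. A i j * ?a j)" by (simp add: mat_vec_def)
      then show ?thesis using null that by (simp del: of_int_sum)
    qed
    then obtain c where c: "\<forall>i\<le>n. real_of_int (?a i) = c * u i" using u1 by blast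
    obtain d where d: "\<forall>i\<le>n. v i = d * u i" using u1 v by blast
    have "c \<noteq> 0" using c a0 by force
    then have "\<forall>i\<le>n. v i = (d / c) * real_of_int (?a i)" using c d by simp
    then show ?thesis ..
  qed
  have lab: "kac_label n A = (\<lambda>j. if j \<le> n then ?a j else 0)"
    by (rule kac_label_eqI) (use dim a a0 null in auto)
  have e: "?e j > 0" for j by (rule type_ratio_pos)
  have e0: "?e 0 = 1" using type_ratio_0 t(2) .
  have colab: "kac_label n (\<lambda>i j. A j i) = (\<lambda>j. if j \<le> n then ?e j * ?a j else 0)"
  proof (rule kac_label_eqI)
    fix v assume v: "\<And>i. i \<le> n \<Longrightarrow> mat_vec n (\<lambda>i j. A j i) v i = 0"
    \<comment> \<open>Dividing by the symmetrizer maps the null space of the transpose into that of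
      A, which is known to be a line.\<close>
    have "mat_vec n A (\<lambda>j. v j / of_int (?e j)) i = 0" if i: "i \<le> n" for i
    proof -
      have "of_int (?e i) * mat_vec n A (\<lambda>j. v j / of_int (?e j)) i
          = (\<Sum>j\<le>n. of_int (?e i * A i j) * (v j / of_int (?e j)))"
        by (simp add: mat_vec_def sum_distrib_left mult.assoc)
      also have "\<dots> = (\<Sum>j\<le>n. of_int (A j i) * v j)"
      proof (rule sum.cong)
        fix j assume "j \<in> {..n}"
        then have "real_of_int (?e i * A i j) = of_int (?e j) * of_int (A j i)" using sym[OF i, of j] by simp
        then show "real_of_int (?e i * A i j) * (v j / of_int (?e j)) = of_int (A j i) * v j"
          using e[of j] by (simp del: of_int_mult)
      qed simp
      also have "\<dots> = 0" using v[OF i] by (simp add: mat_vec_def)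
      finally show ?thesis using e[of i] by simp
    qed
    from dim[OF this] obtain c where c: "\<forall>i\<le>n. v i / of_int (?e i) = c * real_of_int (?a i)" by blast
    have "v i = c * real_of_int (?e i * ?a i)" if "i \<le> n" for i
    proof -
      have "v i = (v i / of_int (?e i)) * of_int (?e i)" using e[of i] by simp
      also have "v i / of_int (?e i) = c * real_of_int (?a i)" using c that by blast
      finally show ?thesis by (simp add: mult_ac)
    qed
    then show "\<exists>c. \<forall>i\<le>n. v i = c * real_of_int (?e i * ?a i)" by blast
  next
    fix i assume i: "i \<le> n"
    show "0 < ?e i * ?a i" using e a i by simp
    have "(\<Sum>j\<le>n. A j i * (?e j * ?a j)) = (\<Sum>j\<le>n. ?e i * (A i j * ?a j))"
    proof (rule sum.cong)
      fix j assume "j \<in> {..n}"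
      then have "?e j * A j i = ?e i * A i j" using sym i by simp
      then show "A j i * (?e j * ?a j) = ?e i * (A i j * ?a j)" by (metis mult.assoc mult.commute)
    qed simp
    then show "(\<Sum>j\<le>n. A j i * (?e j * ?a j)) = 0" using null[OF i] by (simp add: sum_distrib_left[symmetric])
  qed (use e0 a0 in simp)
  show ?thesis
  proof
    show "generalized_cartan_matrix n A" "irreducible_cartan n A"
      using aff by (auto simp: irreducible_affine_cartan_def)
    show "kac_label n A j = ?a j" if "j \<le> n" for j using that by (simp add: lab)
    show "dd n A j = 1 / of_int (?e j)" if "j \<le> n" for j
      using that a[OF that] by (simp add: dd_def kac_colabel_def lab colab)
  qed (use a a0 null e e0 sym in auto)
qed

lemma kac_entry:
  assumes "kac_labelled t n A" "i \<le> n" "j \<le> n" "i \<noteq> j"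
  shows "A i j = - off (kac_bonds t) i j"
  using assms by (simp add: kac_labelled_def kac_matrix_off)

text \<open>Every listed node \<open>k\<close> has a predecessor \<open>i\<close> with \<open>a\<^sub>k\<^sub>i = -1\<close>, so that \<open>s\<^sub>k \<alpha>\<^sub>i = \<alpha>\<^sub>i + \<alpha>\<^sub>k\<close>.\<close>

fun spans :: "bond list \<Rightarrow> nat list \<Rightarrow> nat list \<Rightarrow> bool" where
  "spans bs seen [] \<longleftrightarrow> True"
| "spans bs seen (k # ks) \<longleftrightarrow> (\<exists>i\<in>set seen. i \<noteq> k \<and> off bs k i = 1) \<and> spans bs (k # seen) ks"

lemma spans_subset:
  assumes "spans bs seen ks" "set ks \<subseteq> {1..n}" "\<And>i. i \<in> set seen \<Longrightarrow> i = 0 \<or> (i \<in> {1..n} \<and> i \<in> J)"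
    and "\<And>k. k \<in> {1..n} \<Longrightarrow> off bs k 0 = 1 \<Longrightarrow> k \<in> J"
    and "\<And>i j. i \<in> J \<Longrightarrow> i \<in> {1..n} \<Longrightarrow> j \<in> {1..n} \<Longrightarrow> i \<noteq> j \<Longrightarrow> off bs j i = 1 \<Longrightarrow> j \<in> J"
  shows "set ks \<subseteq> J"
  using assms(1-3)
proof (induction ks arbitrary: seen)
  case (Cons k ks)
  obtain i where i: "i \<in> set seen" "i \<noteq> k" "off bs k i = 1" using Cons.prems(1) by auto
  have k: "k \<in> {1..n}" using Cons.prems(2) by simp
  have kJ: "k \<in> J" using assms(4)[OF k] assms(5)[of i k] i k Cons.prems(3)[OF i(1)] by blast
  have "set ks \<subseteq> J"
    by (rule Cons.IH[of "k # seen"]) (use Cons.prems k kJ in auto)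
  then show ?case using kJ by simp
qed simp

text \<open>In the infinite families the nodes are reached by induction along the chain. In the
  exceptional types a list of nodes, ordered outwards from the affine node, serves as a certificate
  for \<open>spans\<close>.\<close>

lemma affine_short_exists:
  assumes aff: "irreducible_affine_cartan n A" and t: "kac_labelled t n A" "short_type t"
  shows "affine_short n A (type_label t) (type_ratio t)"
proof -
  interpret affine_datum n A "type_label t" "type_ratio t" by (rule affine_datum_exists[OF assms])
  have n: "n = affine_rank t" using t(1) by (simp add: kac_labelled_def)
  note entry = kac_entry[OF t(1)]
  note off_simps = off_Cons off_append off_chain
  have k1: simply_laced_at_0 if "\<And>k. k \<in> {1..n} \<Longrightarrow> off (kac_bonds t) 0 k \<in> {0, 1}"
    "\<And>J. (\<And>k. k \<in> {1..n} \<Longrightarrow> off (kac_bonds t) k 0 = 1 \<Longrightarrow> k \<in> J) \<Longrightarrow>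
      (\<And>i j. i \<in> J \<Longrightarrow> i \<in> {1..n} \<Longrightarrow> j \<in> {1..n} \<Longrightarrow> i \<noteq> j \<Longrightarrow> off (kac_bonds t) j i = 1 \<Longrightarrow> j \<in> J) \<Longrightarrow> {1..n} \<subseteq> J"
    unfolding simply_laced_at_0_def
  proof (intro conjI allI impI ballI)
    fix k assume "k \<in> {1..n}"
    then show "A 0 k = 0 \<or> A 0 k = -1" using that(1)[of k] by (simp add: entry)
  next
    fix J assume J: "J \<subseteq> {1..n} \<and> (\<forall>k\<in>{1..n}. A k 0 = -1 \<longrightarrow> k \<in> J) \<and> (\<forall>i\<in>J. \<forall>j\<in>{1..n}. A j i = -1 \<longrightarrow> j \<in> J)"
    have "{1..n} \<subseteq> J"
    proof (rule that(2))
      fix k assume "k \<in> {1..n}" "off (kac_bonds t) k 0 = 1"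
      then show "k \<in> J" using J by (simp add: entry)
    next
      fix i j assume "i \<in> J" "i \<in> {1..n}" "j \<in> {1..n}" "i \<noteq> j" "off (kac_bonds t) j i = 1"
      then have "A j i = -1" by (simp add: entry)
      then show "j \<in> J" using J \<open>i \<in> J\<close> \<open>j \<in> {1..n}\<close> by blast
    qed
    then show "J = {1..n}" using J by blast
  qed
  have k1_list: simply_laced_at_0
    if ks: "set ks = {1..n}" "\<And>k. k \<in> set ks \<Longrightarrow> off (kac_bonds t) 0 k \<in> {0, 1}" "spans (kac_bonds t) [0] ks" for ks
  proof (rule k1)
    show "off (kac_bonds t) 0 k \<in> {0, 1}" if "k \<in> {1..n}" for k using ks(2) that unfolding ks(1) .
    show "{1..n} \<subseteq> J" if "\<And>k. k \<in> {1..n} \<Longrightarrow> off (kac_bonds t) k 0 = 1 \<Longrightarrow> k \<in> J"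
      "\<And>i j. i \<in> J \<Longrightarrow> i \<in> {1..n} \<Longrightarrow> j \<in> {1..n} \<Longrightarrow> i \<noteq> j \<Longrightarrow> off (kac_bonds t) j i = 1 \<Longrightarrow> j \<in> J" for J
      using spans_subset[OF ks(3), of n J] that unfolding ks(1) by simp
  qed
  have "n \<ge> 1 \<and> (simply_laced_at_0 \<or> doubly_laced_at_0 \<or> quadruply_laced_at_0)"
    using t(2)
  proof (cases rule: short_type_cases)
    case 1
    then have "n = 1" using n by simp
    then have quadruply_laced_at_0 unfolding quadruply_laced_at_0_def using 1 by (simp add: entry off_simps)
    then show ?thesis using \<open>n = 1\<close> by blast
  next
    case (2 m)
    then have m: "n = m" using n by simp
    have simply_laced_at_0
    proof (rule k1)
      show "off (kac_bonds t) 0 k \<in> {0, 1}" if "k \<in> {1..n}" for k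
        using that 2 m by (auto simp: off_simps)
      fix J assume J: "\<And>k. k \<in> {1..n} \<Longrightarrow> off (kac_bonds t) k 0 = 1 \<Longrightarrow> k \<in> J"
        "\<And>i j. i \<in> J \<Longrightarrow> i \<in> {1..n} \<Longrightarrow> j \<in> {1..n} \<Longrightarrow> i \<noteq> j \<Longrightarrow> off (kac_bonds t) j i = 1 \<Longrightarrow> j \<in> J"
      have "k \<in> J" if "1 \<le> k" "k \<le> n" for k
        using that
      proof (induction k rule: nat_induct_at_least)
        case base
        show ?case by (rule J(1)) (use 2 m in \<open>auto simp: off_simps\<close>)
      next
        case (Suc k)
        show ?case by (rule J(2)[of k]) (use 2 m Suc in \<open>auto simp: off_simps\<close>)
      qed
      then show "{1..n} \<subseteq> J" by auto
    qed
    then show ?thesis using 2 m by simp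
  next
    case (3 m)
    then have m: "n = m" using n by simp
    have simply_laced_at_0
    proof (rule k1)
      show "off (kac_bonds t) 0 k \<in> {0, 1}" if "k \<in> {1..n}" for k
        using that 3 m by (auto simp: off_simps)
      fix J assume J: "\<And>k. k \<in> {1..n} \<Longrightarrow> off (kac_bonds t) k 0 = 1 \<Longrightarrow> k \<in> J"
        "\<And>i j. i \<in> J \<Longrightarrow> i \<in> {1..n} \<Longrightarrow> j \<in> {1..n} \<Longrightarrow> i \<noteq> j \<Longrightarrow> off (kac_bonds t) j i = 1 \<Longrightarrow> j \<in> J"
      have 22: "k \<in> J" if "2 \<le> k" "k \<le> n - 1" for k
        using that
      proof (induction k rule: nat_induct_at_least)
        case base
        show ?case by (rule J(1)) (use 3 m in \<open>auto simp: off_simps\<close>)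
      next
        case (Suc k)
        show ?case by (rule J(2)[of k]) (use 3 m Suc in \<open>auto simp: off_simps\<close>)
      qed
      \<comment> \<open>Nodes 1 and n are not met when walking up the chain from 2; they hang on 2
        and n - 2.\<close>
      have 1: "1 \<in> J" by (rule J(2)[of 2]) (use 3 m 22[of 2] in \<open>auto simp: off_simps\<close>)
      have n: "n \<in> J" by (rule J(2)[of "n - 2"]) (use 3 m 22[of "n - 2"] in \<open>auto simp: off_simps\<close>)
      show "{1..n} \<subseteq> J"
      proof
        fix k assume k: "k \<in> {1..n}"
        then consider "k = 1" | "k = n" | "2 \<le> k" "k \<le> n - 1" by force
        then show "k \<in> J" using 1 n 22 by cases auto
      qed
    qed
    then show ?thesis using 3 m by simp
  next
    case (7 m)
    then have m: "n = m" using n by simp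
    have simply_laced_at_0
    proof (rule k1)
      show "off (kac_bonds t) 0 k \<in> {0, 1}" if "k \<in> {1..n}" for k
        using that 7 m by (auto simp: off_simps)
      fix J assume J: "\<And>k. k \<in> {1..n} \<Longrightarrow> off (kac_bonds t) k 0 = 1 \<Longrightarrow> k \<in> J"
        "\<And>i j. i \<in> J \<Longrightarrow> i \<in> {1..n} \<Longrightarrow> j \<in> {1..n} \<Longrightarrow> i \<noteq> j \<Longrightarrow> off (kac_bonds t) j i = 1 \<Longrightarrow> j \<in> J"
      have 22: "k \<in> J" if "2 \<le> k" "k \<le> n" for k
        using that
      proof (induction k rule: nat_induct_at_least)
        case base
        show ?case by (rule J(1)) (use 7 m in \<open>auto simp: off_simps\<close>)
      next
        case (Suc k)
        show ?case by (rule J(2)[of k]) (use 7 m Suc in \<open>auto simp: off_simps\<close>)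
      qed
      have 1: "1 \<in> J" by (rule J(2)[of 2]) (use 7 m 22[of 2] in \<open>auto simp: off_simps\<close>)
      show "{1..n} \<subseteq> J"
      proof
        fix k assume k: "k \<in> {1..n}"
        then consider "k = 1" | "2 \<le> k" "k \<le> n" by force
        then show "k \<in> J" using 1 22 by cases auto
      qed
    qed
    then show ?thesis using 7 m by simp
  next
    case (8 m)
    then have m: "n = m" using n by simp
    have doubly_laced_at_0
      unfolding doubly_laced_at_0_def
    proof (intro conjI allI impI ballI)
      show "2 \<le> n" using 8 m by simp
      show "A 0 1 = -2" "A 1 0 = -1" using 8 m by (simp_all add: entry off_simps)
      show "type_label t n = 1" using 8 by simp
      show "A 0 k = 0" if "k \<in> {2..n}" for k using 8 m that by (simp add: entry off_simps)
      show "A (k + 1) k = -1" if "1 \<le> k \<and> k + 1 < n" for k using 8 m that by (simp add: entry off_simps) arith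
    qed
    then show ?thesis using 8 m by simp
  next
    case 4
    have simply_laced_at_0
    proof (rule k1_list[of "[6, 3, 2, 1, 4, 5]"])
      show "set [6, 3, 2, 1, 4, 5] = {1..n}" using n 4 by auto
      show "off (kac_bonds t) 0 k \<in> {0, 1}" if "k \<in> set [6, 3, 2, 1, 4, 5]" for k
        using that unfolding 4 list.set by (elim insertE emptyE) (simp_all add: off_simps)
    qed (simp add: 4 off_simps)
    then show ?thesis using n 4 by simp
  next
    case 5
    have simply_laced_at_0
    proof (rule k1_list[of "[1, 2, 3, 4, 5, 6, 7]"])
      show "set [1, 2, 3, 4, 5, 6, 7] = {1..n}" using n 5 by auto
      show "off (kac_bonds t) 0 k \<in> {0, 1}" if "k \<in> set [1, 2, 3, 4, 5, 6, 7]" for k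
        using that unfolding 5 list.set by (elim insertE emptyE) (simp_all add: off_simps)
    qed (simp add: 5 off_simps)
    then show ?thesis using n 5 by simp
  next
    case 6
    have simply_laced_at_0
    proof (rule k1_list[of "[1, 2, 3, 4, 5, 6, 7, 8]"])
      show "set [1, 2, 3, 4, 5, 6, 7, 8] = {1..n}" using n 6 by auto
      show "off (kac_bonds t) 0 k \<in> {0, 1}" if "k \<in> set [1, 2, 3, 4, 5, 6, 7, 8]" for k
        using that unfolding 6 list.set by (elim insertE emptyE) (simp_all add: off_simps)
    qed (simp add: 6 off_simps)
    then show ?thesis using n 6 by simp
  next
    case 9
    have simply_laced_at_0
    proof (rule k1_list[of "[1, 2, 3, 4]"])
      show "set [1, 2, 3, 4] = {1..n}" using n 9 by auto
      show "off (kac_bonds t) 0 k \<in> {0, 1}" if "k \<in> set [1, 2, 3, 4]" for k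
        using that unfolding 9 list.set by (elim insertE emptyE) (simp_all add: off_simps)
    qed (simp add: 9 off_simps)
    then show ?thesis using n 9 by simp
  next
    case 10
    have simply_laced_at_0
    proof (rule k1_list[of "[1, 2]"])
      show "set [1, 2] = {1..n}" using n 10 by auto
      show "off (kac_bonds t) 0 k \<in> {0, 1}" if "k \<in> set [1, 2]" for k
        using that unfolding 10 list.set by (elim insertE emptyE) (simp_all add: off_simps)
    qed (simp add: 10 off_simps)
    then show ?thesis using n 10 by simp
  qed
  then show ?thesis by unfold_locales auto
qed

section \<open>Homomorphisms from presented groups\<close>

context group
begin

definition word_eval :: "('g \<Rightarrow> 'a) \<Rightarrow> 'g word \<Rightarrow> 'a" where
  "word_eval f w = foldr (\<lambda>(g, b) x. (if b then f g else inv (f g)) \<otimes> x) w \<one>"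

lemma word_eval_Nil [simp]: "word_eval f [] = \<one>"
  and word_eval_Cons [simp]: "word_eval f ((g, b) # w) = (if b then f g else inv (f g)) \<otimes> word_eval f w"
  by (simp_all add: word_eval_def)

lemma word_eval_closed: "f \<in> S \<rightarrow> carrier G \<Longrightarrow> w \<in> words S \<Longrightarrow> word_eval f w \<in> carrier G"
  by (induction w) (auto simp: words_def Pi_iff)

lemma word_eval_append:
  assumes f: "f \<in> S \<rightarrow> carrier G"
  shows "u \<in> words S \<Longrightarrow> v \<in> words S \<Longrightarrow> word_eval f (u @ v) = word_eval f u \<otimes> word_eval f v"
proof (induction u)
  case (Cons x u)
  obtain g b where x: "x = (g, b)" by force
  have "g \<in> S" "u \<in> words S" using Cons.prems by (auto simp: words_def x)
  then show ?case
    using Cons f word_eval_closed[OF f] by (auto simp: x m_assoc Pi_iff)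
qed (simp add: word_eval_closed[OF f])

lemma word_eval_equiv:
  assumes f: "f \<in> S \<rightarrow> carrier G"
    and R: "\<And>u v. (u, v) \<in> R \<Longrightarrow> u \<in> words S \<Longrightarrow> v \<in> words S \<Longrightarrow> word_eval f u = word_eval f v"
  shows "word_equiv S R u v \<Longrightarrow> word_eval f u = word_eval f v"
proof (induction rule: word_equiv.induct)
  case (append u u' v v')
  then show ?case using word_equiv_words[OF append(1)] word_equiv_words[OF append(2)] by (simp add: word_eval_append[OF f])
next
  case (cancel g b)
  then show ?case using f by (auto simp: Pi_iff)
qed (use R in auto)

lemma presented_hom:
  assumes f: "f \<in> S \<rightarrow> carrier G"
    and R: "\<And>u v. (u, v) \<in> R \<Longrightarrow> u \<in> words S \<Longrightarrow> v \<in> words S \<Longrightarrow> word_eval f u = word_eval f v"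
  shows "\<exists>h\<in>hom (presented_group S R) G. \<forall>w\<in>words S. h (word_class S R w) = word_eval f w"
proof -
  define h where "h c = word_eval f (SOME w. w \<in> c)" for c
  have h: "h (word_class S R w) = word_eval f w" if "w \<in> words S" for w
  proof -
    have "w \<in> word_class S R w" using that by (simp add: word_class_def word_rel_def word_equiv.refl)
    then have "(SOME v. v \<in> word_class S R w) \<in> word_class S R w" by (rule someI)
    then have "word_equiv S R w (SOME v. v \<in> word_class S R w)" by (simp add: word_class_def word_rel_def)
    then show ?thesis unfolding h_def using word_eval_equiv[OF f R] by metis
  qed
  have app: "u @ v \<in> words S" if "u \<in> words S" "v \<in> words S" for u v using that by (auto simp: words_def)
  have "h \<in> hom (presented_group S R) G"
    by (rule homI)
      (auto simp: carrier_presented_group mult_presented_group h app word_eval_append[OF f] word_eval_closed[OF f])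
  then show ?thesis using h by blast
qed

end

lemma word_class_eval:
  assumes "w \<in> words S"
  shows "word_class S R w = group.word_eval (presented_group S R) (\<lambda>g. word_class S R [(g, True)]) w"
proof -
  interpret P: group "presented_group S R" by (rule group_presented_group)
  have one: "\<one>\<^bsub>presented_group S R\<^esub> = word_class S R []" by (simp add: presented_group_def)
  have single: "[(g, b)] \<in> words S" if "g \<in> S" for g b using that by (simp add: words_def)
  have inv: "inv\<^bsub>presented_group S R\<^esub> (word_class S R [(g, True)]) = word_class S R [(g, False)]" if g: "g \<in> S" for g
  proof (rule P.inv_equality)
    have "word_equiv S R [(g, False), (g, True)] []" using word_equiv.cancel[OF g, of R False] by simp
    then have "word_class S R [(g, False), (g, True)] = word_class S R []"
      using word_equiv_words by (subst word_class_eq_iff) blast+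
    then show "word_class S R [(g, False)] \<otimes>\<^bsub>presented_group S R\<^esub> word_class S R [(g, True)] = \<one>\<^bsub>presented_group S R\<^esub>"
      using single[OF g] by (simp add: mult_presented_group one)
  qed (use single[OF g] in \<open>auto simp: carrier_presented_group\<close>)
  show ?thesis
    using assms
  proof (induction w)
    case Nil then show ?case by (simp add: one)
  next
    case (Cons x w)
    obtain g b where x: "x = (g, b)" by force
    have g: "g \<in> S" and w: "w \<in> words S" using Cons.prems by (auto simp: words_def x)
    have "word_class S R (x # w) = word_class S R [(g, b)] \<otimes>\<^bsub>presented_group S R\<^esub> word_class S R w"
      using mult_presented_group[OF single[OF g] w] by (simp add: x)
    then show ?case using Cons.IH[OF w] inv[OF g] by (cases b) (simp_all add: x)
  qed
qed

lemma hom_presented_eq: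
  assumes H: "group H" and h: "h \<in> hom (presented_group S R) H" "k \<in> hom (presented_group S R) H"
    and gens: "\<And>g. g \<in> S \<Longrightarrow> h (word_class S R [(g, True)]) = k (word_class S R [(g, True)])"
    and x: "x \<in> carrier (presented_group S R)"
  shows "h x = k x"
proof -
  interpret P: group "presented_group S R" by (rule group_presented_group)
  interpret h: group_hom "presented_group S R" H h
    using H h by (simp add: group_hom_def group_hom_axioms_def group_presented_group)
  interpret k: group_hom "presented_group S R" H k
    using H h by (simp add: group_hom_def group_hom_axioms_def group_presented_group)
  have f: "(\<lambda>g. word_class S R [(g, True)]) \<in> S \<rightarrow> carrier (presented_group S R)"
    by (auto simp: carrier_presented_group words_def)
  have "h (P.word_eval (\<lambda>g. word_class S R [(g, True)]) w) = k (P.word_eval (\<lambda>g. word_class S R [(g, True)]) w)"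
    if "w \<in> words S" for w
    using that
  proof (induction w)
    case Nil then show ?case by simp
  next
    case (Cons x w)
    obtain g b where x: "x = (g, b)" by force
    have g: "g \<in> S" and w: "w \<in> words S" using Cons.prems by (auto simp: words_def x)
    have c: "word_class S R [(g, True)] \<in> carrier (presented_group S R)"
      "P.word_eval (\<lambda>g. word_class S R [(g, True)]) w \<in> carrier (presented_group S R)"
      using f g P.word_eval_closed[OF f w] by auto
    show ?case using Cons.IH[OF w] gens[OF g] c by (cases b) (simp_all add: x)
  qed
  moreover obtain w where "w \<in> words S" "x = word_class S R w" using x by (auto simp: carrier_presented_group)
  ultimately show ?thesis using word_class_eval[of w S R] by simp
qed

section \<open>Homomorphisms exchanging X and Y\<close>

context daag_rep
begin

text \<open>Inverting the letters without reversing their order gives the inverse of the reversed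
  word, which is reduced for the inverse of w. For the involution s_\<theta> this is plain inversion
  of T_{s_\<theta>}.\<close>

lemma hom_Tw:
  assumes h: "h \<in> hom G G" and hT: "\<And>i. i \<in> {1..n} \<Longrightarrow> h (T i) = inv T i" and w: "w \<in> W0"
  shows "h (Tw w) = inv (Tw (iv w))"
proof -
  interpret h: group_hom G G h using h by (simp add: group_hom_def group_hom_axioms_def)
  obtain js where js: "red w js" using red_ex W0_W w by blast
  have "h (tw js) = inv tw (rev js)" if "set js \<subseteq> {1..n}" for js
    using that
  proof (induction js)
    case (Cons j js)
    have j: "j \<in> {1..n}" "j \<le> n" and sub: "set js \<subseteq> {..n}" "set js \<subseteq> {1..n}" using Cons.prems by force+
    have c: "tw js \<in> carrier G" "tw (rev js) \<in> carrier G" using sub by (simp_all add: tw_closed)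
    have "tw (rev (j # js)) = tw (rev js) \<otimes> T j" using tw_append[of "rev js" "[j]"] sub j by simp
    then show ?case using Cons.IH[OF sub(2)] c j by (simp add: hT[OF j(1)] inv_mult_group)
  qed simp
  then show ?thesis using W0_red[OF w js] Tw_red[OF js] Tw_red[OF red_inv[OF js]] by simp
qed

lemma hom_Tw_theta:
  assumes "h \<in> hom G G" "\<And>i. i \<in> {1..n} \<Longrightarrow> h (T i) = inv T i"
  shows "h (Tw (sref \<theta>)) = inv (Tw (sref \<theta>))"
  using hom_Tw[OF assms W0_sref[OF short_theta pos_theta]] by (simp add: iv_sref[OF short_theta])

lemma Tw_theta_closed: "Tw (sref \<theta>) \<in> carrier G"
  by (rule short_pos_Tw[OF short_theta pos_theta])

lemma theta_Q: "(\<lambda>k. - \<theta> k) \<in> Q"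
  using Q_theta by (rule Q_uminus)

lemma S_eq: "S = Tw (sref \<theta>) \<otimes> X (\<lambda>k. - \<theta> k)"
  by (simp add: R_def)

text \<open>The assignment on X does not enter. The weights with the desired image form a lattice,
  which contains \<theta> because T_{s_\<theta>}^{-1} S = X_{-\<theta>}; Lusztig's relation is
  mapped to the reflection relation of X, so \<open>lattice_from_theta\<close> applies.\<close>

lemma hom_swap_Y:
  assumes h: "h \<in> hom G G" and hT: "\<And>i. i \<in> {1..n} \<Longrightarrow> h (T i) = inv T i" and h0: "h (T 0) = S"
  shows "\<beta> \<in> Q \<Longrightarrow> h (Y \<beta>) = X \<beta>"
proof -
  interpret h: group_hom G G h using h by (simp add: group_hom_def group_hom_axioms_def)
  define M where "M = {\<beta> \<in> Q. h (Y \<beta>) = X \<beta>}"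
  have X_diff: "X (lc x (-1) y) = X x \<otimes> inv X y" if "x \<in> Q" "y \<in> Q" for x y
  proof -
    have "lc x (-1) y = vadd x (\<lambda>k. - y k)" by (simp add: lc_def vadd_def)
    then show ?thesis using that by (simp add: X_add Q_uminus X_uminus)
  qed
  have closed: "lattice_closed M"
    unfolding lattice_closed_def
  proof (intro conjI ballI)
    show "(\<lambda>_. 0) \<in> M" by (simp add: M_def Q_zero X_zero Y_zero)
    fix x y assume "x \<in> M" "y \<in> M"
    then have m: "x \<in> Q" "y \<in> Q" "h (Y x) = X x" "h (Y y) = X y" by (auto simp: M_def)
    have "h (Y (vadd x y)) = X (vadd x y)" using m by (simp add: Y_add X_add)
    then show "lc x 1 y \<in> M" using m by (simp add: M_def Q_lc vadd_eq_lc)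
    show "lc x (-1) y \<in> M" using m by (simp add: M_def Q_lc Y_diff X_diff)
  qed
  have "h (Y (\<lambda>k. - \<theta> k)) = X (\<lambda>k. - \<theta> k)"
    unfolding Y_theta using hom_Tw_theta[OF h hT] h0 Tw_theta_closed theta_Q by (simp add: S_eq)
  then have "(\<lambda>k. - \<theta> k) \<in> M" by (simp add: M_def theta_Q)
  then have "\<theta> \<in> M" using lattice_closed_uminus[OF closed] by fastforce
  have "Q \<subseteq> M"
  proof (rule lattice_from_theta[OF closed \<open>\<theta> \<in> M\<close>])
    fix x j assume x: "x \<in> M" "x \<in> Q" and j: "j \<in> {1..n}" and p: "pr j x = -1"
    have jn: "j \<le> n" using j by simp
    have hx: "h (Y x) = X x" using x by (simp add: M_def)
    have "h (Y (s j x)) = h (inv T j \<otimes> (Y x \<otimes> inv T j))" unfolding Y_refl[OF x(2) j p] ..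
    also have "\<dots> = T j \<otimes> (X x \<otimes> T j)" using x jn hx by (simp add: hT[OF j])
    also have "\<dots> = X (s j x)" by (rule X_refl[OF j x(2) p])
    finally show "s j x \<in> M" using Q_s[OF x(2) j] by (simp add: M_def)
  qed
  then show "\<beta> \<in> Q \<Longrightarrow> h (Y \<beta>) = X \<beta>" by (auto simp: M_def)
qed

lemma hom_swap_S:
  assumes h: "h \<in> hom G G" and hT: "\<And>i. i \<in> {1..n} \<Longrightarrow> h (T i) = inv T i"
    and hX: "\<And>\<beta>. \<beta> \<in> Q \<Longrightarrow> h (X \<beta>) = Y \<beta>"
  shows "h S = T 0"
proof -
  interpret h: group_hom G G h using h by (simp add: group_hom_def group_hom_axioms_def)
  have "h S = inv (Tw (sref \<theta>)) \<otimes> Y (\<lambda>k. - \<theta> k)"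
    unfolding S_eq using hom_Tw_theta[OF h hT] hX[OF theta_Q] Tw_theta_closed theta_Q by simp
  then show ?thesis unfolding Y_theta using Tw_theta_closed by simp
qed

lemma hom_swap_T0:
  assumes h: "h \<in> hom G G" and hT: "\<And>i. i \<in> {1..n} \<Longrightarrow> h (T i) = inv T i"
    and hY: "\<And>\<beta>. \<beta> \<in> Q \<Longrightarrow> h (Y \<beta>) = X \<beta>"
  shows "h (T 0) = S"
proof -
  interpret h: group_hom G G h using h by (simp add: group_hom_def group_hom_axioms_def)
  have "X (\<lambda>k. - \<theta> k) = h (Tw (sref \<theta>) \<otimes> T 0)" using hY[OF theta_Q] by (simp add: Y_theta)
  also have "\<dots> = inv (Tw (sref \<theta>)) \<otimes> h (T 0)" using hom_Tw_theta[OF h hT] Tw_theta_closed by simp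
  finally show ?thesis unfolding S_eq using Tw_theta_closed by simp
qed

text \<open>The image of the affine reflection relation at \<beta> is compared with
  \<open>S_Y1\<close>; everything but the central factor agrees.\<close>

lemma hom_swap_Z:
  assumes h: "h \<in> hom G G" and h0: "h (T 0) = S" and hX: "\<And>\<beta>. \<beta> \<in> Q \<Longrightarrow> h (X \<beta>) = Y \<beta>"
    and b: "\<beta> \<in> Q" "pr 0 \<beta> = -1"
  shows "h Z = inv Z"
proof -
  interpret h: group_hom G G h using h by (simp add: group_hom_def group_hom_axioms_def)
  have q: "lc \<beta> (-1) \<theta> \<in> Q" using b Q_theta by (simp add: Q_lc)
  have "Y (lc \<beta> (-1) \<theta>) \<otimes> h Z = h (X (lc \<beta> (-1) \<theta>) \<otimes> Z)" using q by (simp add: hX)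
  also have "\<dots> = S \<otimes> (Y \<beta> \<otimes> S)" unfolding X_refl0[OF b, symmetric] using b by (simp add: hX h0)
  also have "\<dots> = Y (lc \<beta> (-1) \<theta>) \<otimes> inv Z" by (rule S_Y1[OF b])
  finally show ?thesis using q by simp
qed

lemma T'_Y_comm:
  assumes i: "i \<le> n" and b: "\<beta> \<in> Q" and p: "pr i \<beta> = 0"
  shows "commute (T' i) (Y \<beta>)"
  using S_Y0[OF b] commute_inv_left[OF Y_comm_T[OF b]] i p by (cases "i = 0") (auto simp: T'_def)

lemma T'_closed: "i \<le> n \<Longrightarrow> T' i \<in> carrier G"
  by (simp add: T'_def)

lemma Z_central_Tw: "w \<in> W \<Longrightarrow> commute Z (Tw w)"
proof -
  assume "w \<in> W"
  have cT: "commute Z (T i)" if "i \<le> n" for i using Z_T that by (simp add: commute_def)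
  have "commute Z (tw js)" if "set js \<subseteq> {..n}" for js
    using that by (induction js) (auto intro!: commute_one commute_mult cT)
  moreover obtain js where "red w js" using red_ex \<open>w \<in> W\<close> by blast
  ultimately show ?thesis using Tw_red[of w js] by (simp add: red_iff)
qed

lemma Z_central_S: "commute Z S"
  unfolding S_eq
  by (intro commute_mult Z_central_Tw W0_W W0_sref short_theta pos_theta)
    (use Z_X theta_Q in \<open>simp add: commute_def\<close>)

lemma Z_central_Y: "\<beta> \<in> Q \<Longrightarrow> commute Z (Y \<beta>)"
proof -
  assume "\<beta> \<in> Q"
  then obtain \<mu> \<nu> where "\<mu> \<in> P" "\<nu> \<in> P" "Y \<beta> = L \<mu> \<otimes> inv L \<nu>" using Y_ex by blast
  then show ?thesis unfolding L_def using Z_central_Tw trans_W P_Q by (auto intro!: commute_mult commute_inv)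
qed

lemma Z_central_T': "i \<le> n \<Longrightarrow> commute Z (T' i)"
  using Z_central_S commute_inv[of Z "T i"] Z_T by (auto simp: T'_def commute_def)

end

context affine_short
begin

text \<open>The vector \<open>s\<^sub>i \<beta>\<close> has coordinate \<open>0\<close> or \<open>1\<close> at the affine node, which determines the
  multiple of \<open>\<delta>\<close> in the reflection relations.\<close>

lemma reflection_level:
  assumes i: "i \<le> n" and b: "\<beta> \<in> Q" "\<gamma> \<in> Q" and p: "pr i \<beta> = -1"
    and eq: "s i \<beta> = vadd \<gamma> (\<lambda>l. of_int k * (\<delta> l / of_int (kac_label n A 0)))"
  shows "if i = 0 then k = 1 \<and> \<gamma> = lc \<beta> (-1) \<theta> else k = 0 \<and> \<gamma> = s i \<beta>"
proof -
  have lab: "kac_label n A 0 = 1" using label[of 0] by (simp add: a_0)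
  have eq': "s i \<beta> = lc \<gamma> (of_int k) \<delta>" unfolding eq by (simp add: vadd_def lc_def lab)
  have si: "s i \<beta> = lc \<beta> 1 (rt i)" unfolding s_eq[OF i] p by simp
  have "real_of_int k = rt i 0" using fun_cong[OF eq', of 0] unfolding si using Q_D(2)[OF b(1)] Q_D(2)[OF b(2)]
    by (simp add: lc_def delta_apply a_0)
  then have k: "k = (if i = 0 then 1 else 0)" by (auto simp: rt_apply split: if_splits)
  show ?thesis
  proof (cases "i = 0")
    case True
    have "\<gamma> l = lc \<beta> (-1) \<theta> l" for l
      using fun_cong[OF eq', of l] True k unfolding si by (simp add: lc_def \<theta>_def)
    then show ?thesis using True k by auto
  next
    case False
    then show ?thesis using k eq' by (simp add: lc_def)
  qed
qed

lemma reflection_level_0: "s 0 \<beta> = vadd (lc \<beta> (-1) \<theta>) (\<lambda>l. of_int 1 * (\<delta> l / of_int (kac_label n A 0)))" if "pr 0 \<beta> = -1"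
proof -
  have lab: "kac_label n A 0 = 1" using label[of 0] by (simp add: a_0)
  show ?thesis unfolding s_eq[OF le0] that lab by (simp add: lc_def vadd_def \<theta>_def)
qed

end

section \<open>The involution of the double affine Artin group\<close>

theorem theorem4p4:
  fixes n :: nat and A :: cartan and t :: affine_type
  assumes "irreducible_affine_cartan n A"
    and "kac_labelled t n A"
    and "t \<notin> range B1 \<union> range C1 \<union> {F4_1, G2_1}"
    and "t \<notin> range A_even2"
  shows "(\<exists>!e. e \<in> auto (daag t n A) \<and> inverts_T_swaps_X_Y t n A e \<and>
               (delta_detached t n A \<longrightarrow> e (X_delta t n A) = inv\<^bsub>daag t n A\<^esub> X_delta t n A)) \<and>
         (\<forall>e. e \<in> auto (daag t n A) \<and> inverts_T_swaps_X_Y t n A e \<and>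
              (delta_detached t n A \<longrightarrow> e (X_delta t n A) = inv\<^bsub>daag t n A\<^esub> X_delta t n A)
              \<longrightarrow> (\<forall>g \<in> carrier (daag t n A). e (e g) = g))"
proof -
  have aff: "irreducible_affine_cartan n A" and lab: "kac_labelled t n A" and st: "short_type t"
    using assms by (auto simp: short_type_def kac_labelled_def)
  interpret AS: affine_short n A "type_label t" "type_ratio t" by (rule affine_short_exists[OF aff lab st])
  let ?G = "daag t n A"
  let ?gens = "daag_gens t n A" and ?rels = "daag_relations t n A"
  interpret G: group ?G unfolding daag_def by (rule group_presented_group)
  define cl where "cl = word_class ?gens ?rels"
  define g where "g x = cl [(x, True)]" for x
  have Q: "lattice_Q t n A = AS.Q" using st by (auto simp: lattice_Q_def short_type_def)
  have gT: "Gen_T i \<in> ?gens" if "i \<le> n" for i using that by (simp add: daag_gens_def)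
  have gX: "Gen_X \<beta> \<in> ?gens" if "\<beta> \<in> AS.Q" for \<beta> using that by (simp add: daag_gens_def Q)
  have gD: "Gen_delta \<in> ?gens" by (simp add: daag_gens_def)
  have gens_cases: "(\<exists>i\<le>n. x = Gen_T i) \<or> (\<exists>\<beta>\<in>AS.Q. x = Gen_X \<beta>) \<or> x = Gen_delta" if "x \<in> ?gens" for x
    using that by (auto simp: daag_gens_def Q)
  have clG: "cl w \<in> carrier ?G" if "w \<in> words ?gens" for w
    using that by (simp add: cl_def daag_def carrier_presented_group)
  have gf: "g \<in> ?gens \<rightarrow> carrier ?G" using clG by (auto simp: g_def words_def)
  have cl_eval: "cl w = G.word_eval g w" if "w \<in> words ?gens" for w
    using word_class_eval[OF that, of ?rels] by (simp add: cl_def g_def[abs_def] daag_def)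
  have rel: "G.word_eval g u = G.word_eval g v" if "(u, v) \<in> ?rels" "u \<in> words ?gens" "v \<in> words ?gens" for u v
  proof -
    have "word_equiv ?gens ?rels u v" using that by (rule word_equiv.relation)
    then have "cl u = cl v" using that unfolding cl_def by (simp add: word_class_eq_iff)
    then show ?thesis using that cl_eval by simp
  qed
  have wT: "[(Gen_T i, True)] \<in> words ?gens" if "i \<le> n" for i using gT that by (simp add: words_def)
  define T where "T i = g (Gen_T i)" for i
  define X where "X \<beta> = g (Gen_X \<beta>)" for \<beta>
  define Z where "Z = g Gen_delta"
  have T_c: "T i \<in> carrier ?G" if "i \<le> n" for i using gf gT that by (auto simp: T_def)
  have X_c: "X \<beta> \<in> carrier ?G" if "\<beta> \<in> AS.Q" for \<beta> using gf gX that by (auto simp: X_def)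
  have Z_c: "Z \<in> carrier ?G" using gf gD by (auto simp: Z_def)
  have alt_words: "map (\<lambda>j. (Gen_T j, True)) js \<in> words ?gens" if "set js \<subseteq> {..n}" for js
    using that gT by (auto simp: words_def subset_iff)
  have evT: "G.word_eval F (map (\<lambda>j. (Gen_T j, True)) js) = foldr (\<lambda>j g. F (Gen_T j) \<otimes>\<^bsub>?G\<^esub> g) js \<one>\<^bsub>?G\<^esub>" for F js
    by (induction js) simp_all
  interpret D: daag_rep n A "type_label t" "type_ratio t" ?G T X Z
  proof unfold_locales
    show "T i \<in> carrier ?G" if "i \<le> n" for i by (rule T_c[OF that])
  next
    fix i j m assume ij: "i \<le> n" "j \<le> n" "i \<noteq> j" "(A i j * A j i, m) \<in> braid_lengths"
    have "(alternating i j m, alternating j i m) \<in> ?rels"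
      using ij by (auto simp: daag_relations_def braid_relations_def)
    moreover have "set (AS.alt i j m) \<subseteq> {..n}" "set (AS.alt j i m) \<subseteq> {..n}"
      using AS.set_alt[of i j m] AS.set_alt[of j i m] ij by auto
    ultimately show "foldr (\<lambda>j g. T j \<otimes>\<^bsub>?G\<^esub> g) (AS.alt i j m) \<one>\<^bsub>?G\<^esub> = foldr (\<lambda>j g. T j \<otimes>\<^bsub>?G\<^esub> g) (AS.alt j i m) \<one>\<^bsub>?G\<^esub>"
      using rel alt_words unfolding AS.alternating_alt T_def evT[symmetric] by blast
  next
    show "X \<beta> \<in> carrier ?G" if "\<beta> \<in> AS.Q" for \<beta> by (rule X_c[OF that])
    show "Z \<in> carrier ?G" by (rule Z_c)
  next
    fix \<beta> \<gamma> assume b: "\<beta> \<in> AS.Q" "\<gamma> \<in> AS.Q"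
    then have v: "vadd \<beta> \<gamma> \<in> AS.Q" by (simp add: vadd_eq_lc AS.Q_lc)
    have "(wX \<beta> @ wX \<gamma>, wX (vadd \<beta> \<gamma>)) \<in> ?rels"
      using b by (auto simp: daag_relations_def lattice_relations_def Q)
    from rel[OF this] show "X (vadd \<beta> \<gamma>) = X \<beta> \<otimes>\<^bsub>?G\<^esub> X \<gamma>"
      using b v gX X_c by (simp add: X_def words_def)
  next
    fix i assume i: "i \<le> n"
    have "(wDelta @ wT i, wT i @ wDelta) \<in> ?rels"
      using gT[OF i] by (auto simp: daag_relations_def central_relations_def)
    from rel[OF this] show "Z \<otimes>\<^bsub>?G\<^esub> T i = T i \<otimes>\<^bsub>?G\<^esub> Z"
      using i gT gD T_c Z_c by (simp add: T_def Z_def words_def)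
  next
    fix \<beta> assume b: "\<beta> \<in> AS.Q"
    have "(wDelta @ wX \<beta>, wX \<beta> @ wDelta) \<in> ?rels"
      using gX[OF b] by (auto simp: daag_relations_def central_relations_def)
    from rel[OF this] show "Z \<otimes>\<^bsub>?G\<^esub> X \<beta> = X \<beta> \<otimes>\<^bsub>?G\<^esub> Z"
      using b gX gD X_c Z_c by (simp add: X_def Z_def words_def)
  next
    fix i \<beta> assume i: "i \<le> n" and b: "\<beta> \<in> AS.Q" and p: "AS.pr i \<beta> = 0"
    have "(wT i @ wX \<beta>, wX \<beta> @ wT i) \<in> ?rels"
      using i b p by (auto simp: daag_relations_def commuting_relations_def Q AS.form_coroot)
    from rel[OF this] show "T i \<otimes>\<^bsub>?G\<^esub> X \<beta> = X \<beta> \<otimes>\<^bsub>?G\<^esub> T i"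
      using i b gT gX T_c X_c by (simp add: T_def X_def words_def)
  next
    fix i \<beta> assume i: "i \<in> {1..n}" and b: "\<beta> \<in> AS.Q" and p: "AS.pr i \<beta> = -1"
    have sb: "AS.s i \<beta> \<in> AS.Q" by (rule AS.Q_s[OF b i])
    have "AS.s i \<beta> = vadd (AS.s i \<beta>) (\<lambda>l. of_int 0 * (AS.\<delta> l / of_int (kac_label n A 0)))" by (simp add: vadd_def)
    then have "(wT i @ wX \<beta> @ wT i, wX_level (AS.s i \<beta>) 0) \<in> ?rels"
      using i b p sb unfolding daag_relations_def reflection_relations_def Q
      by (intro UnI2 CollectI exI[of _ i] exI[of _ \<beta>] exI[of _ "AS.s i \<beta>"] exI[of _ 0]) (auto simp: AS.form_coroot)
    from rel[OF this] show "T i \<otimes>\<^bsub>?G\<^esub> (X \<beta> \<otimes>\<^bsub>?G\<^esub> T i) = X (AS.s i \<beta>)"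
      using i b sb gT gX T_c X_c by (simp add: T_def X_def words_def wX_level_def)
  next
    fix \<beta> assume b: "\<beta> \<in> AS.Q" and p: "AS.pr 0 \<beta> = -1"
    have sb: "lc \<beta> (-1) AS.\<theta> \<in> AS.Q" using b AS.Q_theta by (simp add: AS.Q_lc)
    have "(wT 0 @ wX \<beta> @ wT 0, wX_level (lc \<beta> (-1) AS.\<theta>) 1) \<in> ?rels"
      using b p sb AS.reflection_level_0[OF p] unfolding daag_relations_def reflection_relations_def Q
      by (intro UnI2 CollectI exI[of _ 0] exI[of _ \<beta>] exI[of _ "lc \<beta> (-1) AS.\<theta>"] exI[of _ 1]) (auto simp: AS.form_coroot)
    from rel[OF this] show "T 0 \<otimes>\<^bsub>?G\<^esub> (X \<beta> \<otimes>\<^bsub>?G\<^esub> T 0) = X (lc \<beta> (-1) AS.\<theta>) \<otimes>\<^bsub>?G\<^esub> Z"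
      using b sb gT gX gD T_c X_c Z_c by (simp add: T_def X_def Z_def words_def wX_level_def)
  qed
  have T_elem: "T_elem t n A i = T i" and X_elem: "X_elem t n A \<beta> = X \<beta>" and Z_elem: "X_delta t n A = Z" for i \<beta>
    by (simp_all add: T_elem_def X_elem_def X_delta_def daag_elem_def T_def X_def Z_def g_def cl_def)
  have T_weyl: "T_weyl t n A w = D.Tw w" if "w \<in> AS.W" for w
  proof -
    have "AS.red w (SOME js. AS.red w js)" using AS.red_ex[OF that] by (rule someI_ex)
    then have "set (SOME js. AS.red w js) \<subseteq> {..n}" by (simp add: AS.red_iff)
    from cl_eval[OF alt_words[OF this]] show ?thesis
      unfolding T_weyl_def D.Tw_def D.tw_def daag_elem_def cl_def[symmetric] evT T_def .
  qed
  have P_iff: "\<mu> \<in> AS.P \<longleftrightarrow> \<mu> \<in> AS.Q \<and> antidominant n A \<mu>" for \<mu> by (simp add: AS.P_def)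
  \<comment> \<open>The definite description is resolved here: a family is determined on the lattice
    by its antidominant values, and off the lattice by extensionality.\<close>
  have Y_elem: "Y_elem t n A = restrict D.Y AS.Q"
    unfolding Y_elem_def
  proof (rule the_equality)
    show "Y_family t n A (restrict D.Y AS.Q)"
      unfolding Y_family_def Q
    proof (intro conjI ballI impI)
      show "restrict D.Y AS.Q \<in> AS.Q \<rightarrow>\<^sub>E carrier ?G" by (auto simp: PiE_def)
      fix \<mu> assume m: "\<mu> \<in> AS.Q"
      show "restrict D.Y AS.Q \<mu> \<otimes>\<^bsub>?G\<^esub> restrict D.Y AS.Q \<nu> = restrict D.Y AS.Q (vadd \<mu> \<nu>)" if "\<nu> \<in> AS.Q" for \<nu>
      proof -
        have "vadd \<mu> \<nu> \<in> AS.Q" using m that by (simp add: vadd_eq_lc AS.Q_lc)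
        then show ?thesis using m that by (simp add: D.Y_add)
      qed
      show "restrict D.Y AS.Q \<mu> = T_weyl t n A (AS.trans \<mu>)" if "antidominant n A \<mu>"
        using m that P_iff[of \<mu>] by (simp add: D.Y_P T_weyl AS.trans_W D.L_def)
    qed
  next
    fix F assume F: "Y_family t n A F"
    have "F \<beta> = D.Y \<beta>" if "\<beta> \<in> AS.Q" for \<beta>
    proof (rule D.Y_unique[OF _ _ _ that])
      show "F (vadd \<beta> \<gamma>) = F \<beta> \<otimes>\<^bsub>?G\<^esub> F \<gamma>" if "\<beta> \<in> AS.Q" "\<gamma> \<in> AS.Q" for \<beta> \<gamma>
        using F that unfolding Y_family_def Q by simp
      show "F \<mu> = D.L \<mu>" if "\<mu> \<in> AS.P" for \<mu>
        using F that P_iff[of \<mu>] T_weyl[OF AS.trans_W[of \<mu>]] unfolding Y_family_def Q D.L_def by simp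
      show "F \<beta> \<in> carrier ?G" if "\<beta> \<in> AS.Q" for \<beta>
        using F that unfolding Y_family_def Q by auto
    qed
    moreover have "F \<in> extensional AS.Q" using F unfolding Y_family_def Q by (simp add: PiE_def)
    ultimately show "F = restrict D.Y AS.Q" by (auto simp: fun_eq_iff extensional_def)
  qed
  have swaps: "inverts_T_swaps_X_Y t n A e \<longleftrightarrow> (\<forall>i\<in>{1..n}. e (T i) = inv\<^bsub>?G\<^esub> T i) \<and>
      (\<forall>\<mu>\<in>AS.Q. e (X \<mu>) = D.Y \<mu> \<and> e (D.Y \<mu>) = X \<mu>)" for e
    unfolding inverts_T_swaps_X_Y_def Q T_elem X_elem Y_elem by simp
  \<comment> \<open>Inverting the central generator is forced by \<open>D.S_Y1\<close> whenever a
    reflection relation at the affine node exists; in the detached types it is the prescribed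
    value.\<close>
  define F where "F x = (case x of Gen_T i \<Rightarrow> D.T' i | Gen_X \<beta> \<Rightarrow> D.Y \<beta> | Gen_delta \<Rightarrow> inv\<^bsub>?G\<^esub> Z)" for x
  have F_simps: "F (Gen_T i) = D.T' i" "F (Gen_X \<beta>) = D.Y \<beta>" "F Gen_delta = inv\<^bsub>?G\<^esub> Z" for i \<beta>
    by (simp_all add: F_def)
  have FG: "F \<in> ?gens \<rightarrow> carrier ?G" using gens_cases D.T'_closed by (fastforce simp: F_simps)
  have Frel: "G.word_eval F u = G.word_eval F v"
    if uv: "(u, v) \<in> ?rels" and words: "u \<in> words ?gens" "v \<in> words ?gens" for u v
  proof -
    have cZ: "G.commute (inv\<^bsub>?G\<^esub> Z) (F x)" if "x \<in> ?gens" for x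
      using gens_cases[OF that] D.Z_central_T' D.Z_central_Y
      by (auto simp: F_simps intro!: G.commute_inv_left G.commute_inv G.commute_self)
    consider "(u, v) \<in> braid_relations n A" | "(u, v) \<in> lattice_relations AS.Q" | "(u, v) \<in> central_relations ?gens"
      | "(u, v) \<in> commuting_relations n A AS.Q" | "(u, v) \<in> reflection_relations n A AS.Q"
      using uv unfolding daag_relations_def Q by blast
    then show ?thesis
    proof cases
      case 1
      then obtain i j m where ij: "i \<le> n" "j \<le> n" "i \<noteq> j" "(A i j * A j i, m) \<in> braid_lengths"
        and u: "u = alternating i j m" "v = alternating j i m" by (auto simp: braid_relations_def)
      show ?thesis unfolding u AS.alternating_alt evT F_simps by (rule D.T'_braid[OF ij])
    next
      case 2
      then obtain \<beta> \<gamma> where b: "\<beta> \<in> AS.Q" "\<gamma> \<in> AS.Q" and u: "u = wX \<beta> @ wX \<gamma>" "v = wX (vadd \<beta> \<gamma>)"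
        by (auto simp: lattice_relations_def)
      have "vadd \<beta> \<gamma> \<in> AS.Q" using b by (simp add: vadd_eq_lc AS.Q_lc)
      then show ?thesis unfolding u using b by (simp add: F_simps D.Y_add)
    next
      case 3
      then obtain x where x: "x \<in> ?gens" and u: "u = wDelta @ [(x, True)]" "v = [(x, True)] @ wDelta"
        by (auto simp: central_relations_def)
      have "F x \<in> carrier ?G" using FG x by auto
      then show ?thesis unfolding u using G.commute_eq[OF cZ[OF x]] by (simp add: F_simps(3))
    next
      case 4
      then obtain i \<beta> where i: "i \<le> n" "\<beta> \<in> AS.Q" "AS.pr i \<beta> = 0" and u: "u = wT i @ wX \<beta>" "v = wX \<beta> @ wT i"
        by (auto simp: commuting_relations_def AS.form_coroot)
      show ?thesis unfolding u using G.commute_eq[OF D.T'_Y_comm[OF i]] D.T'_closed i by (simp add: F_simps)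
    next
      case 5
      then obtain i \<beta> \<gamma> k where i: "i \<le> n" "\<beta> \<in> AS.Q" "\<gamma> \<in> AS.Q" "AS.pr i \<beta> = -1"
        and eq: "AS.s i \<beta> = vadd \<gamma> (\<lambda>l. of_int k * (AS.\<delta> l / of_int (kac_label n A 0)))"
        and u: "u = wT i @ wX \<beta> @ wT i" "v = wX_level \<gamma> k"
        by (auto simp: reflection_relations_def AS.form_coroot)
      note lev = AS.reflection_level[OF i eq]
      show ?thesis
      proof (cases "i = 0")
        case True
        then have k: "k = 1" and g: "\<gamma> = lc \<beta> (-1) AS.\<theta>" using lev by auto
        show ?thesis
          unfolding u True wX_level_def k using D.S_Y1[OF i(2)] i True unfolding g
          by (simp add: F_simps D.T'_def)
      next
        case False
        then have k: "k = 0" and g: "\<gamma> = AS.s i \<beta>" and i1: "i \<in> {1..n}" using lev i by auto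
        show ?thesis
          unfolding u wX_level_def k g using D.Y_refl[OF i(2) i1 i(4)] i(1) i(3)[unfolded g] False
          by (simp add: F_simps D.T'_def)
      qed
    qed
  qed
  have "\<exists>h\<in>hom (presented_group ?gens ?rels) ?G. \<forall>w\<in>words ?gens. h (word_class ?gens ?rels w) = G.word_eval F w"
    by (rule G.presented_hom[OF FG Frel])
  then obtain h where h0: "h \<in> hom (presented_group ?gens ?rels) ?G"
    and hw': "\<forall>w\<in>words ?gens. h (word_class ?gens ?rels w) = G.word_eval F w"
    by (elim bexE)
  have hw: "h (cl w) = G.word_eval F w" if "w \<in> words ?gens" for w
    unfolding cl_def by (rule bspec[OF hw' that])
  have h: "h \<in> hom ?G ?G" using h0 by (simp add: daag_def)
  have hg: "h (g x) = F x" if "x \<in> ?gens" for x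
  proof -
    have "[(x, True)] \<in> words ?gens" "F x \<in> carrier ?G" using that FG by (auto simp: words_def)
    then show ?thesis using hw[of "[(x, True)]"] by (simp add: g_def)
  qed
  have hT: "h (T i) = D.T' i" if "i \<le> n" for i using hg[OF gT[OF that]] by (simp add: T_def F_simps)
  have hX: "h (X \<beta>) = D.Y \<beta>" if "\<beta> \<in> AS.Q" for \<beta> using hg[OF gX[OF that]] by (simp add: X_def F_simps)
  have hZ: "h Z = inv\<^bsub>?G\<^esub> Z" using hg[OF gD] by (simp add: Z_def F_simps)
  have hT1: "h (T i) = inv\<^bsub>?G\<^esub> T i" if "i \<in> {1..n}" for i using hT[of i] that by (simp add: D.T'_def)
  have hT0: "h (T 0) = D.S" using hT[of 0] by (simp add: D.T'_def)
  have hY: "h (D.Y \<beta>) = X \<beta>" if "\<beta> \<in> AS.Q" for \<beta> by (rule D.hom_swap_Y[OF h hT1 hT0 that])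
  have hS: "h D.S = T 0" by (rule D.hom_swap_S[OF h hT1 hX])
  interpret h: group_hom ?G ?G h using h by (simp add: group_hom_def group_hom_axioms_def)
  have hom_eq: "k x = l x" if "k \<in> hom ?G ?G" "l \<in> hom ?G ?G" "\<And>y. y \<in> ?gens \<Longrightarrow> k (g y) = l (g y)" "x \<in> carrier ?G" for k l x
    using hom_presented_eq[of ?G k ?gens ?rels l x] that by (simp add: daag_def[symmetric] g_def cl_def)
  have hh: "h (h x) = x" if "x \<in> carrier ?G" for x
  proof -
    have "(h \<circ> h) x = id x"
    proof (rule hom_eq[OF _ _ _ that])
      show "h \<circ> h \<in> hom ?G ?G" by (rule hom_compose[OF h h])
      show "id \<in> hom ?G ?G" by (auto simp: hom_def)
      fix y assume "y \<in> ?gens"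
      then consider i where "i \<in> {1..n}" "y = Gen_T i" | "y = Gen_T 0" | \<beta> where "\<beta> \<in> AS.Q" "y = Gen_X \<beta>" | "y = Gen_delta"
        using gens_cases[of y] by (metis One_nat_def Suc_leI atLeastAtMost_iff not_gr0)
      then show "(h \<circ> h) (g y) = id (g y)"
      proof cases
        case (1 i)
        then show ?thesis using hT1[OF 1(1)] by (simp add: T_def[symmetric])
      next
        case 2
        then show ?thesis using hT0 hS by (simp add: T_def[symmetric])
      next
        case (3 \<beta>)
        then show ?thesis using hX[OF 3(1)] hY[OF 3(1)] by (simp add: X_def[symmetric])
      next
        case 4
        then show ?thesis using hZ by (simp add: Z_def[symmetric])
      qed
    qed
    then show ?thesis by simp
  qed
  \<comment> \<open>Elements of \<open>auto\<close> are extensional, so the homomorphism is cut down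
    to the carrier; this also makes equality with another automorphism an equality of
    functions.\<close>
  define e where "e = restrict h (carrier ?G)"
  have e_auto: "e \<in> auto ?G"
  proof -
    have "e \<in> hom ?G ?G" using h by (auto simp: e_def hom_def)
    moreover have "bij_betw e (carrier ?G) (carrier ?G)"
      by (rule bij_betw_byWitness[where f' = h]) (auto simp: e_def hh)
    ultimately show ?thesis by (simp add: auto_def Bij_def e_def)
  qed
  have e_swap: "inverts_T_swaps_X_Y t n A e" unfolding swaps by (auto simp: e_def hT1 hX hY)
  have e_Z: "e Z = inv\<^bsub>?G\<^esub> Z" by (simp add: e_def hZ)
  have unique: "k = e" if k: "k \<in> auto ?G" "inverts_T_swaps_X_Y t n A k"
    "delta_detached t n A \<longrightarrow> k Z = inv\<^bsub>?G\<^esub> Z" for k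
  proof -
    have kh: "k \<in> hom ?G ?G" and ext: "k \<in> extensional (carrier ?G)" using k(1) by (auto simp: auto_def Bij_def)
    have kT: "\<And>i. i \<in> {1..n} \<Longrightarrow> k (T i) = inv\<^bsub>?G\<^esub> T i" and kX: "\<And>\<beta>. \<beta> \<in> AS.Q \<Longrightarrow> k (X \<beta>) = D.Y \<beta>"
      and kY: "\<And>\<beta>. \<beta> \<in> AS.Q \<Longrightarrow> k (D.Y \<beta>) = X \<beta>" using k(2) unfolding swaps by auto
    have kT0: "k (T 0) = D.S" by (rule D.hom_swap_T0[OF kh kT kY])
    \<comment> \<open>Either the value is prescribed, or some \<beta> with pairing -1 at the affine
      node determines it.\<close>
    have kZ: "k Z = inv\<^bsub>?G\<^esub> Z"
    proof (cases "delta_detached t n A")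
      case True then show ?thesis using k(3) by blast
    next
      case False
      then obtain \<beta> where b: "\<beta> \<in> AS.Q" "AS.pr 0 \<beta> = -1" by (auto simp: delta_detached_def Q AS.form_coroot)
      show ?thesis by (rule D.hom_swap_Z[OF kh kT0 kX b])
    qed
    have "k x = h x" if "x \<in> carrier ?G" for x
    proof (rule hom_eq[OF kh h _ that])
      fix y assume "y \<in> ?gens"
      then consider i where "i \<in> {1..n}" "y = Gen_T i" | "y = Gen_T 0" | \<beta> where "\<beta> \<in> AS.Q" "y = Gen_X \<beta>" | "y = Gen_delta"
        using gens_cases[of y] by (metis One_nat_def Suc_leI atLeastAtMost_iff not_gr0)
      then show "k (g y) = h (g y)"
        using kT hT1 kT0 hT0 kX hX kZ hZ by cases (simp_all add: T_def[symmetric] X_def[symmetric] Z_def[symmetric])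
    qed
    then show ?thesis using ext by (auto simp: e_def extensional_def fun_eq_iff)
  qed
  show ?thesis
    unfolding Z_elem
  proof (intro conjI allI impI ex1I[of _ e] ballI)
    show "e \<in> auto ?G" "inverts_T_swaps_X_Y t n A e" "e Z = inv\<^bsub>?G\<^esub> Z" by fact+
    show "k = e" if "k \<in> auto ?G \<and> inverts_T_swaps_X_Y t n A k \<and> (delta_detached t n A \<longrightarrow> k Z = inv\<^bsub>?G\<^esub> Z)" for k
      using that unique by blast
    fix k x assume "k \<in> auto ?G \<and> inverts_T_swaps_X_Y t n A k \<and> (delta_detached t n A \<longrightarrow> k Z = inv\<^bsub>?G\<^esub> Z)"
      and x: "x \<in> carrier ?G"
    then have "k = e" using unique by blast
    then show "k (k x) = x" using x hh by (simp add: e_def)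
  qed
qed

end
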